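(* Let $N\ge1$, let $\Phi$ be a homogeneous Poisson point process on $\mathbb{R}^N$ with unit intensity, and let $\kappa:\mathscr{F}(\mathbb{R}^N)\to[0,\infty]$ be a filtration function (for unmarked point sets). For $n\ge1$ let $\Lambda_n=[-n/2,n/2)^N$. Then, for any $r,s\in[0,\infty)$ (not necessarily $r\le s$) and any integer $q\ge0$, there exists a constant $\sigma_{r,s}^2=\sigma_{r,s}^2(\kappa,q)$ such that $$\frac{\beta_{q,\Lambda_n}^{\kappa,r,s}-\mathbb{E}[\beta_{q,\Lambda_n}^{\kappa,r,s}]}{n^{N/2}}\xrightarrow{d}\mathcal{N}(0,\sigma_{r,s}^2)\quad\text{as } n\to\infty .$$
   Context: $\xrightarrow{d}$ is convergence in distribution and $\mathcal{N}(\mu,\sigma^2)$ is the normal distribution with mean $\mu$ and variance $\sigma^2$. **Extended persistent Betti number.** Fix a coefficient field $\mathbb{F}$. For an increasing right-continuous family $\mathbb{K}=\{K_t\}_{t\ge0}$ of subcomplexes of a finite simplicial complex and any $r,s\in[0,\infty)$, $$\beta_q^{r,s}(\mathbb{K}):=\dim\frac{\mathcal{Z}_q(K_r)}{\mathcal{Z}_q(K_r)\cap\mathcal{B}_q(K_s)},$$ where $\mathcal{Z}_q$ and $\mathcal{B}_q$ are the spaces of simplicial $q$-cycles and $q$-boundaries over $\mathbb{F}$, viewed inside the $q$-chains of the big complex. For bounded Borel $\Lambda\subset\mathbb{R}^N$, $\Phi_\Lambda$ is the restriction of $\Phi$ to $\Lambda$, identified almost surely with a finite subset of $\Lambda$,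 and $\beta_{q,\Lambda}^{\kappa,r,s}:=\beta_q^{r,s}(\mathbb{K}^\kappa(\Phi_\Lambda))$, an (almost surely defined) integer-valued random variable. **Filtration functions.** $\mathscr{F}(S)$ is the set of nonempty finite subsets of $S$. A function $f$ on $\mathscr{F}(\mathbb{R}^N)$ is measurable if for each $k\ge1$ there is a permutation-invariant measurable $\tilde f_k$ on $(\mathbb{R}^N)^k$ with $f(\{x_1,\dots,x_k\})=\tilde f_k(x_1,\dots,x_k)$. A filtration function for unmarked point sets is a measurable $\kappa:\mathscr{F}(\mathbb{R}^N)\to[0,\infty]$ such that: (1) $\kappa(\sigma)\le\kappa(\tau)$ if $\sigma\subset\tau$; (2) $\kappa(\sigma)=\kappa(\sigma+x)$ for all $x\in\mathbb{R}^N$; (3) there is an increasing $\rho:[0,\infty]\to[0,\infty]$ with $\rho(t)<\infty$ for finite $t$ and $\|x-y\|\le\rho(\kappa(\{x,y\}))$ for all $x,y\in\mathbb{R}^N$. The $\kappa$-filtration on a finite $X\subset\mathbb{R}^N$ is $\mathbb{K}^\kappa(X)=\{K^\kappa(X,t)\}_{t\ge0}$, $K^\kappa(X,t)=\{\emptyset\ne\sigma\subset X:\kappa(\sigma)\le t\}$. *)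

theory Defs
  imports
    "HOL-Probability.Probability"
    "HOL-Combinatorics.Combinatorics"
    "HOL-Library.Function_Algebras"
begin

section \<open>Dimension of a quotient space\<close>

text \<open>
  \<open>quotient_basis V W A\<close>: the cosets \<open>a + W\<close>, for \<open>a \<in> A\<close>, are pairwise distinct and form a
  basis of \<open>V / W\<close>. As for the library's \<open>dim\<close>, an infinite-dimensional quotient gets dimension 0;
  the quotients used below are finite-dimensional.
\<close>

definition (in vector_space) quotient_basis :: "'b set \<Rightarrow> 'b set \<Rightarrow> 'b set \<Rightarrow> bool" where
  "quotient_basis V W A \<longleftrightarrow>
     A \<subseteq> V \<and>
     (\<forall>v\<in>V. \<exists>a\<in>span A. v - a \<in> W) \<and>
     (\<forall>T u. finite T \<and> T \<subseteq> A \<and> (\<Sum>a\<in>T. scale (u a) a) \<in> W \<longrightarrow> (\<forall>a\<in>T. u a = 0))"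

definition (in vector_space) quotient_dim :: "'b set \<Rightarrow> 'b set \<Rightarrow> nat" where
  "quotient_dim V W = card (SOME A. quotient_basis V W A)"

lemma (in vector_space) quotient_basis_union:
  assumes W: "subspace W" and V: "subspace V" and WV: "W \<subseteq> V"
    and A: "quotient_basis V W A" and B: "independent B" "span B = W"
  shows "independent (A \<union> B)" "span (A \<union> B) = V" "A \<inter> B = {}"
proof -
  note A_conj = A[unfolded quotient_basis_def]
  have AV: "A \<subseteq> V" using A_conj by (rule conjunct1)
  have sp: "\<exists>a\<in>span A. v - a \<in> W" if "v \<in> V" for v
    using A_conj[THEN conjunct2, THEN conjunct1] that by (rule bspec)
  have ind: "\<forall>a\<in>T. u a = 0"
    if "finite T" "T \<subseteq> A" "(\<Sum>a\<in>T. scale (u a) a) \<in> W" for T u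
  proof -
    have "finite T \<and> T \<subseteq> A \<and> (\<Sum>a\<in>T. scale (u a) a) \<in> W \<longrightarrow> (\<forall>a\<in>T. u a = 0)"
      using A_conj[THEN conjunct2, THEN conjunct2, THEN spec[of _ T], THEN spec[of _ u]] .
    then show ?thesis using that by (elim mp) simp
  qed
  have BW: "B \<subseteq> W" using B(2) span_superset by blast
  show disj: "A \<inter> B = {}"
  proof (rule ccontr)
    assume "A \<inter> B \<noteq> {}"
    then obtain a where a: "a \<in> A" "a \<in> B" by blast
    have "(\<Sum>b\<in>{a}. scale 1 b) \<in> W" using a BW by auto
    with ind[of "{a}" "\<lambda>_. 1"] a show False by simp
  qed
  show "span (A \<union> B) = V"
  proof
    show "span (A \<union> B) \<subseteq> V" using AV BW WV V by (intro span_minimal) auto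
    show "V \<subseteq> span (A \<union> B)"
    proof
      fix v assume "v \<in> V"
      then obtain a where a: "a \<in> span A" "v - a \<in> W" using sp by blast
      have "a \<in> span (A \<union> B)" using a(1) span_mono[of A "A \<union> B"] by blast
      moreover have "v - a \<in> span (A \<union> B)" using a(2) B(2) span_mono[of B "A \<union> B"] by blast
      ultimately have "a + (v - a) \<in> span (A \<union> B)" by (rule span_add)
      then show "v \<in> span (A \<union> B)" by simp
    qed
  qed
  show "independent (A \<union> B)"
    unfolding independent_explicit_module
  proof (intro allI impI)
    fix T u c assume fin: "finite T" and T: "T \<subseteq> A \<union> B"
      and s: "(\<Sum>v\<in>T. scale (u v) v) = 0" and c: "c \<in> T"
    have split: "T = (T \<inter> A) \<union> (T \<inter> B)" using T by blast
    have "(\<Sum>v\<in>T. scale (u v) v) = (\<Sum>v\<in>(T \<inter> A) \<union> (T \<inter> B). scale (u v) v)"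
      by (rule sum.cong[OF split refl])
    also have "\<dots> = (\<Sum>v\<in>T \<inter> A. scale (u v) v) + (\<Sum>v\<in>T \<inter> B. scale (u v) v)"
      using fin disj by (intro sum.union_disjoint) auto
    finally have s2: "(\<Sum>v\<in>T \<inter> A. scale (u v) v) + (\<Sum>v\<in>T \<inter> B. scale (u v) v) = 0"
      using s by simp
    have TB: "(\<Sum>v\<in>T \<inter> B. scale (u v) v) \<in> W"
      using BW by (intro subspace_sum[OF W] subspace_scale[OF W]) auto
    have eq: "(\<Sum>v\<in>T \<inter> A. scale (u v) v) = - (\<Sum>v\<in>T \<inter> B. scale (u v) v)"
      using s2 by (simp add: eq_neg_iff_add_eq_0)
    have zA: "\<forall>a\<in>T \<inter> A. u a = 0"
      using fin TB by (intro ind[of "T \<inter> A" u]) (simp_all add: eq subspace_neg[OF W])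
    then have "(\<Sum>v\<in>T \<inter> B. scale (u v) v) = 0" using s2 by simp
    then have "\<forall>b\<in>T \<inter> B. u b = 0"
      using independentD[OF B(1), of "T \<inter> B" u] fin by simp
    then show "u c = 0" using zA c T by blast
  qed
qed

lemma (in vector_space) quotient_basis_exists:
  assumes W: "subspace W" and V: "subspace V" and WV: "W \<subseteq> V"
  shows "\<exists>A. quotient_basis V W A"
proof -
  obtain B where B: "B \<subseteq> W" "independent B" "W \<subseteq> span B"
    using maximal_independent_subset[of W] by blast
  obtain C where C: "B \<subseteq> C" "C \<subseteq> V" "independent C" "V \<subseteq> span C"
    using maximal_independent_subset_extend[of B V] B WV by blast
  have spB: "span B = W" using B W span_minimal by blast
  have "quotient_basis V W (C - B)"
    unfolding quotient_basis_def
  proof (intro conjI ballI allI impI)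
    show "C - B \<subseteq> V" using C by blast
  next
    fix v assume "v \<in> V"
    then have "v \<in> span ((C - B) \<union> B)" using C(1,4) by (simp add: Un_absorb2 subset_iff)
    then obtain x y where "v = x + y" "x \<in> span (C - B)" "y \<in> span B"
      unfolding span_Un by blast
    then show "\<exists>a\<in>span (C - B). v - a \<in> W" using spB by auto
  next
    fix T u a assume *: "finite T \<and> T \<subseteq> C - B \<and> (\<Sum>a\<in>T. scale (u a) a) \<in> W" and a: "a \<in> T"
    obtain S w where S: "finite S" "S \<subseteq> B" "(\<Sum>a\<in>T. scale (u a) a) = (\<Sum>a\<in>S. scale (w a) a)"
      using * spB unfolding span_explicit by auto
    define z where "z x = (if x \<in> T then u x else - w x)" for x
    have "(\<Sum>x\<in>T \<union> S. scale (z x) x) = (\<Sum>x\<in>T. scale (z x) x) + (\<Sum>x\<in>S. scale (z x) x)"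
      using * S by (intro sum.union_disjoint) auto
    also have "(\<Sum>x\<in>T. scale (z x) x) = (\<Sum>x\<in>T. scale (u x) x)"
      by (intro sum.cong) (auto simp: z_def)
    also have "(\<Sum>x\<in>S. scale (z x) x) = (\<Sum>x\<in>S. - (scale (w x) x))"
      using * S by (intro sum.cong) (auto simp: z_def)
    finally have "(\<Sum>x\<in>T \<union> S. scale (z x) x) = 0" using S by (simp add: sum_negf)
    moreover have "finite (T \<union> S)" "T \<union> S \<subseteq> C" "a \<in> T \<union> S" using * S C a by auto
    ultimately have "z a = 0" using independentD[OF C(3), of "T \<union> S" z a] by simp
    then show "u a = 0" using a by (simp add: z_def)
  qed
  then show ?thesis ..
qed

lemma (in vector_space) quotient_dim_eq:
  assumes W: "subspace W" and V: "subspace V" and WV: "W \<subseteq> V"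
    and fin: "finite C" "V \<subseteq> span C"
  shows "quotient_dim V W = dim V - dim W"
proof -
  obtain B where B: "B \<subseteq> W" "independent B" "W \<subseteq> span B"
    using maximal_independent_subset[of W] by blast
  have spB: "span B = W" using B W span_minimal by blast
  define A where "A = (SOME A. quotient_basis V W A)"
  have A: "quotient_basis V W A"
    unfolding A_def using quotient_basis_exists[OF W V WV] by (rule someI_ex)
  note u = quotient_basis_union[OF W V WV A B(2) spB]
  have "finite (A \<union> B)"
    using independent_span_bound[OF fin(1) u(1)] fin(2) u(2) span_superset[of "A \<union> B"] by blast
  then have "card (A \<union> B) = card A + card B" using u(3) by (simp add: card_Un_disjoint)
  moreover have "card (A \<union> B) = dim V" using u by (metis dim_eq_card_independent dim_span)
  moreover have "card B = dim W" using B by (intro basis_card_eq_dim)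
  ultimately show ?thesis unfolding quotient_dim_def A_def[symmetric] by simp
qed


section \<open>Simplicial chains over a field and the extended persistent Betti number\<close>

text \<open>
  A finite simplicial complex is given by its set \<open>K\<close> of (nonempty, finite) simplices.
  An oriented \<open>q\<close>-chain is represented by its coefficient function: \<open>c [v\<^sub>0, \<dots>, v\<^sub>q]\<close> is the
  coefficient of the oriented simplex \<open>[v\<^sub>0, \<dots>, v\<^sub>q]\<close>, so reordering the vertices by a permutation
  multiplies it by the sign of that permutation. A chain of \<open>K\<close> is supported on the simplices
  of \<open>K\<close>; hence the chain spaces of all subcomplexes lie in one ambient vector space.
\<close>

definition chains :: "nat \<Rightarrow> 'a set set \<Rightarrow> ('a list \<Rightarrow> 'f::field) set" where
  "chains q K = {c.
     (\<forall>vs. c vs \<noteq> 0 \<longrightarrow> length vs = Suc q \<and> distinct vs \<and> set vs \<in> K) \<and>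
     (\<forall>vs p. p permutes {..<length vs} \<longrightarrow> c (permute_list p vs) = of_int (sign p) * c vs)}"

text \<open>
  The textbook boundary \<open>\<Sum>i. (-1)^i [v\<^sub>0, \<dots>, v\<^sub>(i-1), v\<^sub>(i+1), \<dots>, v\<^sub>q]\<close>, read off coefficientwise:
  a simplex having \<open>[w\<^sub>0, \<dots>, w\<^sub>(q-1)]\<close> as the face opposite to \<open>v\<close>, oriented as
  \<open>[v, w\<^sub>0, \<dots>, w\<^sub>(q-1)]\<close>, contributes its coefficient with sign \<open>+1\<close>. The empty list is excluded
  because the homology is not reduced: the boundary of a \<open>0\<close>-chain is \<open>0\<close>.
\<close>

definition boundary :: "('a list \<Rightarrow> 'f::field) \<Rightarrow> 'a list \<Rightarrow> 'f" where
  "boundary c ws = (if ws = [] then 0 else (\<Sum>v | c (v # ws) \<noteq> 0. c (v # ws)))"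

definition cycles :: "nat \<Rightarrow> 'a set set \<Rightarrow> ('a list \<Rightarrow> 'f::field) set" where
  "cycles q K = {c \<in> chains q K. boundary c = 0}"

definition boundaries :: "nat \<Rightarrow> 'a set set \<Rightarrow> ('a list \<Rightarrow> 'f::field) set" where
  "boundaries q K = boundary ` chains (Suc q) K"

abbreviation (input) chain_scale :: "'f::field \<Rightarrow> ('a list \<Rightarrow> 'f) \<Rightarrow> 'a list \<Rightarrow> 'f" where
  "chain_scale a c \<equiv> (\<lambda>vs. a * c vs)"

lemma vector_space_chains: "vector_space (chain_scale :: 'f::field \<Rightarrow> ('a list \<Rightarrow> 'f) \<Rightarrow> _)"
  by unfold_locales (auto simp: fun_eq_iff algebra_simps)

lemma chains_support:
  "c \<in> chains q K \<Longrightarrow> c vs \<noteq> 0 \<Longrightarrow> length vs = Suc q \<and> distinct vs \<and> set vs \<in> K"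
  unfolding chains_def by simp

lemma chains_permute:
  assumes "c \<in> chains q K" "p permutes {..<length vs}"
  shows "c (permute_list p vs) = of_int (sign p) * c vs"
proof -
  have "\<forall>vs p. p permutes {..<length vs} \<longrightarrow> c (permute_list p vs) = of_int (sign p) * c vs"
    using assms(1) unfolding chains_def mem_Collect_eq by (rule conjunct2)
  then show ?thesis using assms(2) by (elim allE impE)
qed

text \<open>The incidence number of \<open>[v\<^sub>0, \<dots>, v\<^sub>q]\<close> and its \<open>i\<close>-th face is \<open>(-1)^i\<close>.\<close>

lemma chains_swap:
  assumes c: "c \<in> chains q K"
  shows "c (xs @ a # b # ys) = - c (xs @ b # a # ys)"
proof -
  let ?n = "length xs" and ?v = "xs @ b # a # ys"
  let ?p = "Transposition.transpose (length xs) (Suc (length xs))"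
  have p: "?p permutes {..<length ?v}" by (intro permutes_swap_id) auto
  have "permute_list ?p ?v = xs @ a # b # ys"
  proof (rule nth_equalityI)
    fix i assume "i < length (permute_list ?p ?v)"
    then have i: "i < length ?v" by (simp add: permute_list_def)
    consider "i < length xs" | "i = length xs" | "i = Suc (length xs)"
      | k where "i = Suc (Suc (length xs + k))"
      by (metis add_Suc less_imp_Suc_add linorder_neqE_nat not_less_eq)
    then have "?v ! ?p i = (xs @ a # b # ys) ! i"
      by cases (auto simp: Transposition.transpose_def nth_append)
    then show "permute_list ?p ?v ! i = (xs @ a # b # ys) ! i"
      using permute_list_nth[OF p i] by simp
  qed (simp add: permute_list_def)
  moreover have "c (permute_list ?p ?v) = of_int (sign ?p) * c ?v"
    by (rule chains_permute[OF c p])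
  ultimately show ?thesis by (simp add: sign_swap_id)
qed

lemma chains_move:
  assumes c: "c \<in> chains q K"
  shows "c (v # xs @ ys) = (-1) ^ length xs * c (xs @ v # ys)"
proof (induction xs arbitrary: ys rule: rev_induct)
  case (snoc x xs)
  have "c (v # (xs @ [x]) @ ys) = (-1) ^ length xs * c (xs @ v # x # ys)"
    using snoc.IH[of "x # ys"] by simp
  also have "c (xs @ v # x # ys) = - c (xs @ x # v # ys)" by (rule chains_swap[OF c])
  finally show ?case by simp
qed simp

lemma boundary_oriented_simplex:
  assumes c: "c \<in> chains q {set vs}" and q: "length vs = Suc q" "q \<ge> 1"
    and i: "i \<le> q" and d: "distinct vs"
  shows "boundary c (take i vs @ drop (Suc i) vs) = (-1) ^ i * c vs"
proof -
  let ?w = "take i vs @ drop (Suc i) vs"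
  have vs: "vs = take i vs @ vs ! i # drop (Suc i) vs" using i q by (intro id_take_nth_drop) simp
  have w: "set ?w = set vs - {vs ! i}" "?w \<noteq> []"
  proof -
    have "distinct (take i vs @ vs ! i # drop (Suc i) vs)" using vs d by metis
    moreover have "set vs = set (take i vs @ vs ! i # drop (Suc i) vs)" using vs by metis
    ultimately show "set ?w = set vs - {vs ! i}" by auto
    show "?w \<noteq> []" using q i by auto
  qed
  have sub: "{v. c (v # ?w) \<noteq> 0} \<subseteq> {vs ! i}"
  proof
    fix v assume "v \<in> {v. c (v # ?w) \<noteq> 0}"
    then have "distinct (v # ?w)" "set (v # ?w) = set vs" using chains_support[OF c, of "v # ?w"] by simp_all
    moreover have "vs ! i \<in> set vs" using q i by simp
    ultimately show "v \<in> {vs ! i}" using w by auto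
  qed
  have "boundary c ?w = (\<Sum>v | c (v # ?w) \<noteq> 0. c (v # ?w))" unfolding boundary_def using w(2) by (rule if_not_P)
  also have "\<dots> = (\<Sum>v\<in>{vs ! i}. c (v # ?w))" using sub by (intro sum.mono_neutral_left) auto
  also have "\<dots> = (-1) ^ i * c vs"
    using chains_move[OF c, of "vs ! i" "take i vs" "drop (Suc i) vs", folded vs] q i
    by (simp add: min_def)
  finally show ?thesis .
qed

definition persistent_betti ::
    "'f::field itself \<Rightarrow> nat \<Rightarrow> real \<Rightarrow> real \<Rightarrow> (real \<Rightarrow> 'a set set) \<Rightarrow> nat" where
  "persistent_betti TYPE('f) q r s K =
     vector_space.quotient_dim (chain_scale :: 'f \<Rightarrow> ('a list \<Rightarrow> 'f) \<Rightarrow> _)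
       (cycles q (K r)) (cycles q (K r) \<inter> boundaries q (K s))"


section \<open>Filtration functions\<close>

text \<open>
  Functions on nonempty finite subsets are total functions on sets whose values at other
  sets are irrelevant. A \<open>k\<close>-tuple of points is an element of the product space indexed by \<open>{..<k}\<close>.
\<close>

definition measurable_on_finite_sets :: "('a::euclidean_space set \<Rightarrow> ennreal) \<Rightarrow> bool" where
  "measurable_on_finite_sets f \<longleftrightarrow>
     (\<forall>k::nat. k \<ge> 1 \<longrightarrow> (\<exists>g \<in> borel_measurable (PiM {..<k} (\<lambda>_. borel)).
        \<forall>x \<in> space (PiM {..<k} (\<lambda>_. borel)).
          (\<forall>p. p permutes {..<k} \<longrightarrow> g (x \<circ> p) = g x) \<and> f (x ` {..<k}) = g x))"

definition filtration_function :: "('a::euclidean_space set \<Rightarrow> ennreal) \<Rightarrow> bool" where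
  "filtration_function \<kappa> \<longleftrightarrow>
     measurable_on_finite_sets \<kappa> \<and>
     (\<forall>\<sigma> \<tau>. \<sigma> \<noteq> {} \<and> finite \<tau> \<and> \<sigma> \<subseteq> \<tau> \<longrightarrow> \<kappa> \<sigma> \<le> \<kappa> \<tau>) \<and>
     (\<forall>\<sigma> x. \<sigma> \<noteq> {} \<and> finite \<sigma> \<longrightarrow> \<kappa> ((\<lambda>y. y + x) ` \<sigma>) = \<kappa> \<sigma>) \<and>
     (\<exists>\<rho> :: ennreal \<Rightarrow> ennreal. mono \<rho> \<and> (\<forall>t<\<infinity>. \<rho> t < \<infinity>) \<and>
        (\<forall>x y. ennreal (norm (x - y)) \<le> \<rho> (\<kappa> {x, y})))"

definition filtration_complex :: "('a set \<Rightarrow> ennreal) \<Rightarrow> 'a set \<Rightarrow> real \<Rightarrow> 'a set set" where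
  "filtration_complex \<kappa> X t = {\<sigma>. \<sigma> \<noteq> {} \<and> \<sigma> \<subseteq> X \<and> \<kappa> \<sigma> \<le> ennreal t}"


section \<open>Poisson point processes\<close>

text \<open>A point process is a random integer-valued Borel measure that is finite on bounded sets.\<close>

definition point_process :: "'w measure \<Rightarrow> ('w \<Rightarrow> 'a::euclidean_space measure) \<Rightarrow> bool" where
  "point_process M \<Phi> \<longleftrightarrow>
     prob_space M \<and>
     (\<forall>\<omega>\<in>space M. sets (\<Phi> \<omega>) = sets borel \<and>
        (\<forall>B\<in>sets borel. bounded B \<longrightarrow> (\<exists>k::nat. emeasure (\<Phi> \<omega>) B = of_nat k))) \<and>
     (\<forall>B\<in>sets borel. (\<lambda>\<omega>. emeasure (\<Phi> \<omega>) B) \<in> borel_measurable M)"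

text \<open>
  The Poisson weights are written out because the library's \<open>poisson_pmf\<close> requires a positive
  rate, whereas \<open>B\<close> may be a null set.
\<close>

definition homogeneous_poisson_process ::
    "real \<Rightarrow> 'w measure \<Rightarrow> ('w \<Rightarrow> 'a::euclidean_space measure) \<Rightarrow> bool" where
  "homogeneous_poisson_process intensity M \<Phi> \<longleftrightarrow>
     point_process M \<Phi> \<and>
     (\<forall>B\<in>sets borel. bounded B \<longrightarrow>
        (\<forall>k::nat. measure M {\<omega> \<in> space M. emeasure (\<Phi> \<omega>) B = of_nat k} =
           (intensity * measure lborel B) ^ k / fact k * exp (- (intensity * measure lborel B)))) \<and>
     (\<forall>(B :: nat \<Rightarrow> 'a set) I. finite I \<and> disjoint_family_on B I \<and>
        (\<forall>i\<in>I. B i \<in> sets borel \<and> bounded (B i)) \<longrightarrow>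
        prob_space.indep_vars M (\<lambda>_. borel) (\<lambda>i \<omega>. emeasure (\<Phi> \<omega>) (B i)) I)"

text \<open>
  The finite point set \<open>\<Phi>\<^sub>\<Lambda>\<close>. A Poisson process almost surely has no multiple points, so that
  almost surely the restriction of \<open>\<Phi>\<close> to \<open>\<Lambda>\<close> is the counting measure of this set.
\<close>

definition points_in :: "'a::euclidean_space set \<Rightarrow> 'a measure \<Rightarrow> 'a set" where
  "points_in \<Lambda> \<phi> = {x \<in> \<Lambda>. emeasure \<phi> {x} \<noteq> 0}"

definition window :: "nat \<Rightarrow> (real ^ 'n) set" where
  "window n = {x. \<forall>i. - (real n / 2) \<le> x $ i \<and> x $ i < real n / 2}"

text \<open>The random variable \<open>\<beta>\<close> of the window \<open>\<Lambda>\<^sub>n\<close>, as a real number.\<close>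

definition window_betti ::
    "'f::field itself \<Rightarrow> ((real ^ 'n) set \<Rightarrow> ennreal) \<Rightarrow> nat \<Rightarrow> real \<Rightarrow> real \<Rightarrow>
     ('w \<Rightarrow> (real ^ 'n) measure) \<Rightarrow> nat \<Rightarrow> 'w \<Rightarrow> real" where
  "window_betti F \<kappa> q r s \<Phi> n \<omega> =
     real (persistent_betti F q r s (filtration_complex \<kappa> (points_in (window n) (\<Phi> \<omega>))))"


section \<open>Convergence in distribution to a normal law\<close>

text \<open>
  Parametrised by the variance. The library's \<open>normal_density\<close> describes the law only for positive
  variance; the normal law with variance 0 is the point mass at the mean.
\<close>

definition normal_distribution :: "real \<Rightarrow> real \<Rightarrow> real measure" where
  "normal_distribution \<mu> v =
     (if v = 0 then return borel \<mu> else density lborel (normal_density \<mu> (sqrt v)))"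

definition converges_in_distribution ::
    "'w measure \<Rightarrow> (nat \<Rightarrow> 'w \<Rightarrow> real) \<Rightarrow> real measure \<Rightarrow> bool" where
  "converges_in_distribution M X \<nu> \<longleftrightarrow>
     (\<forall>n. X n \<in> borel_measurable M) \<and> weak_conv_m (\<lambda>n. distr M borel (X n)) \<nu>"

end

theory Submission
  imports Defs "HOL-Real_Asymp.Real_Asymp"
begin

text \<open>
  Rank-nullity writes the persistent Betti number of a finite point set \<open>X\<close> as \<open>f\<^sub>1 X - f\<^sub>2 X + f\<^sub>3 X\<close>,
  where each \<open>f\<^sub>i X\<close> is the dimension of the part supported on \<open>X\<close> of a space of chains. Such a
  dimension is a supermodular function of \<open>X\<close>. Hence the increment \<open>D\<^sub>j f\<^sub>i(A)\<close> caused by the points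
  of a unit cell \<open>j\<close>, seen from a region \<open>A\<close>, increases with \<open>A\<close>, and it is bounded by the number of
  simplices near the cell. Since \<open>(x - y)\<^sup>2 \<le> x\<^sup>2 - y\<^sup>2\<close> for \<open>0 \<le> y \<le> x\<close>, the monotone bounded sequence of
  second moments of \<open>D\<^sub>j f\<^sub>i\<close> along growing cubes controls \<open>E (D\<^sub>j f\<^sub>i(A) - D\<^sub>j f\<^sub>i(B))\<^sup>2\<close>: this is a
  quantitative form of stabilization.

  By the Efron-Stein inequality the functional of a large window then differs in \<open>L\<^sup>2\<close> by little from the sum
  of the functionals of disjoint large blocks. These are independent and identically distributed, so
  their normalised sum has a Gaussian limit, and the Gaussian limits for growing blocks accumulate at
  the limit law of the theorem.

  The law of the point set enters only through its void probabilities: the events that a Borel set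
  contains no point are stable under intersections and generate the \<open>\<sigma>\<close>-algebra of configurations.
\<close>

section \<open>Dimensions of spaces of chains\<close>

text \<open>In general the Betti number is neither monotone nor supermodular in the points, and
  spaces of boundaries cannot serve as terms of a decomposition: a cycle supported on Y may bound
  only chains that leave Y. \<open>fillings\<close> is the remedy. It collects the (q+1)-chains of
  the second complex whose boundary is a q-cycle of the first. Membership can be read off the chain
  and its support, and the boundary operator maps this space onto the cycles that are boundaries,
  with the (q+1)-cycles as kernel. No order between r and s enters. The minus sign in the resulting
  formula destroys supermodularity. Therefore the monotonicity argument is run on each term
  separately, and only its L2 conclusion, \<open>stabilizing\<close>, is carried over to the signed
  sum. In the Efron-Stein inequality a cell is emptied instead of resampled, which produces exactly
  the increments; this is legitimate because a variance is at most the second moment about any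
  constant. The limiting variance is obtained by compactness, so the value 0 is not
  excluded.\<close>

context vector_space
begin

lemma quotient_basisD:
  assumes "quotient_basis V W A"
  shows "A \<subseteq> V" "v \<in> V \<Longrightarrow> \<exists>a\<in>span A. v - a \<in> W"
    "finite T \<Longrightarrow> T \<subseteq> A \<Longrightarrow> (\<Sum>a\<in>T. scale (u a) a) \<in> W \<Longrightarrow> a \<in> T \<Longrightarrow> u a = 0"
proof -
  note * = assms[unfolded quotient_basis_def]
  show "A \<subseteq> V" using * by (rule conjunct1)
  show "\<exists>a\<in>span A. v - a \<in> W" if "v \<in> V"
    using *[THEN conjunct2, THEN conjunct1] that by (rule bspec)
  show "u a = 0" if "finite T" "T \<subseteq> A" "(\<Sum>a\<in>T. scale (u a) a) \<in> W" "a \<in> T"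
    using *[THEN conjunct2, THEN conjunct2, THEN spec[of _ T], THEN spec[of _ u]] that by simp
qed

text \<open>Subtraction-free counterpart of \<open>quotient_dim_eq\<close>, for an arbitrary
  quotient basis: a basis of W completes A to a basis of V.\<close>

lemma quotient_basis_card:
  assumes W: "subspace W" and V: "subspace V" and WV: "W \<subseteq> V"
    and A: "quotient_basis V W A" and fin: "finite C" "V \<subseteq> span C"
  shows "finite A" "dim V = card A + dim W"
proof -
  obtain B where B: "B \<subseteq> W" "independent B" "W \<subseteq> span B"
    using maximal_independent_subset[of W] by blast
  have spB: "span B = W" using B W span_minimal by blast
  note u = quotient_basis_union[OF W V WV A B(2) spB]
  have "finite (A \<union> B)"
    using independent_span_bound[OF fin(1) u(1)] fin(2) u(2) span_superset[of "A \<union> B"] by blast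
  then show "finite A" and "dim V = card A + dim W"
    using u basis_card_eq_dim[OF B(1,3,2)] dim_eq_card_independent[OF u(1)] dim_span[of "A \<union> B"]
    by (auto simp: card_Un_disjoint)
qed

text \<open>\<open>dim\<close> is 0 on infinite-dimensional spaces, so monotonicity requires a
  finite spanning set for the larger space. The other dimension lemmas carry such a set for the same
  reason.\<close>

lemma dim_mono_finite:
  assumes "V \<subseteq> W" and fin: "finite C" "W \<subseteq> span C"
  shows "dim V \<le> dim W"
proof -
  obtain B where B: "B \<subseteq> W" "independent B" "W \<subseteq> span B"
    using maximal_independent_subset[of W] by blast
  have "finite B" using independent_span_bound[OF fin(1) B(2)] B(1) fin(2) by blast
  then have "dim V \<le> card B" using assms B by (intro dim_le_card) auto
  then show ?thesis using basis_card_eq_dim[OF B(1,3,2)] by simp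
qed

text \<open>U/(U \<inter> W) embeds in S/W: a basis of U modulo U \<inter> W stays independent
  modulo W. S may exceed U + W, as happens for chains, where simplices with vertices on both sides
  appear only for the union of the two point sets.\<close>

lemma dim_supermodular:
  assumes U: "subspace U" and W: "subspace W" and S: "subspace S"
    and sub: "U \<subseteq> S" "W \<subseteq> S" and fin: "finite C" "S \<subseteq> span C"
  shows "dim U + dim W \<le> dim S + dim (U \<inter> W)"
proof -
  have UW: "subspace (U \<inter> W)" using U W by (rule subspace_inter)
  obtain A where A: "quotient_basis U (U \<inter> W) A"
    using quotient_basis_exists[OF UW U] by blast
  have AU: "A \<subseteq> U" by (rule quotient_basisD(1)[OF A])
  define T where "T = span (A \<union> W)"
  have TS: "T \<subseteq> S" unfolding T_def using AU sub S by (intro span_minimal) auto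
  have WT: "W \<subseteq> T" unfolding T_def using span_superset by blast
  have "quotient_basis T W A"
    unfolding quotient_basis_def
  proof (intro conjI ballI allI impI)
    show "A \<subseteq> T" unfolding T_def using span_superset by blast
  next
    fix v assume "v \<in> T"
    then obtain x y where "v = x + y" "x \<in> span A" "y \<in> span W"
      unfolding T_def span_Un by blast
    then show "\<exists>a\<in>span A. v - a \<in> W" using span_eq_iff[THEN iffD2, OF W] by (intro bexI[of _ x]) auto
  next
    fix X u a assume X: "finite X \<and> X \<subseteq> A \<and> (\<Sum>a\<in>X. scale (u a) a) \<in> W" and a: "a \<in> X"
    \<comment> \<open>The combination lies in W by assumption, hence in U \<inter> W, where A is
      independent modulo.\<close>
    have "(\<Sum>a\<in>X. scale (u a) a) \<in> U"
      using X AU by (intro subspace_sum[OF U] subspace_scale[OF U]) auto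
    then show "u a = 0" using X a by (intro quotient_basisD(3)[OF A, of X]) auto
  qed
  then have "dim T = card A + dim W"
    using fin TS WT W by (intro quotient_basis_card[OF _ _ _ _ fin(1)]) (auto simp: T_def)
  moreover have "dim T \<le> dim S" by (rule dim_mono_finite[OF TS fin])
  moreover have "dim U = card A + dim (U \<inter> W)"
    using sub fin by (intro quotient_basis_card[OF UW U _ A fin(1)]) auto
  ultimately show ?thesis by simp
qed

text \<open>Rank-nullity on a finite-dimensional subspace of a possibly infinite-dimensional space:
  T maps a basis of V modulo the kernel injectively onto a basis of the image.\<close>

lemma dim_image_kernel:
  assumes T: "Vector_Spaces.linear scale scale T" and V: "subspace V" and fin: "finite C" "V \<subseteq> span C"
  shows "dim V = dim (T ` V) + dim {v \<in> V. T v = 0}"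
proof -
  interpret T: Vector_Spaces.linear scale scale T by (rule T)
  define K where "K = {v \<in> V. T v = 0}"
  have K: "subspace K" unfolding K_def using V
    by (auto simp: subspace_def T.add T.scale T.zero)
  have KV: "K \<subseteq> V" unfolding K_def by auto
  obtain A where A: "quotient_basis V K A" using quotient_basis_exists[OF K V KV] by blast
  note AV = quotient_basisD(1)[OF A] and sp = quotient_basisD(2)[OF A]
    and ind = quotient_basisD(3)[OF A]
  have in_K: "(\<Sum>a\<in>X. scale (u a) a) \<in> K" if "X \<subseteq> A" "(\<Sum>a\<in>X. scale (u a) (T a)) = 0" for X u
  proof -
    have "(\<Sum>a\<in>X. scale (u a) a) \<in> V"
      using that AV by (intro subspace_sum[OF V] subspace_scale[OF V]) auto
    then show ?thesis using that by (simp add: K_def T.sum T.scale)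
  qed
  have inj: "inj_on T A"
  proof (rule inj_onI, rule ccontr)
    fix a b assume *: "a \<in> A" "b \<in> A" "T a = T b" "a \<noteq> b"
    \<comment> \<open>These coefficients represent a - b, which T annihilates, so independence
      modulo the kernel would force them to vanish.\<close>
    define u where "u x = (if x = a then 1 else -1 :: 'a)" for x
    have "(\<Sum>x\<in>{a, b}. scale (u x) (T x)) = 0" using * by (simp add: u_def)
    then have "u a = 0" using * by (intro ind[of "{a, b}"] in_K) auto
    then show False by (simp add: u_def)
  qed
  have indep: "independent (T ` A)"
    unfolding independent_explicit_module
  proof (intro allI impI)
    fix X u v assume X: "finite X" "X \<subseteq> T ` A" "(\<Sum>v\<in>X. scale (u v) v) = 0" "v \<in> X"
    then obtain Y where Y: "Y \<subseteq> A" "finite Y" "X = T ` Y" by (meson finite_subset_image)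
    then have "(\<Sum>v\<in>X. scale (u v) v) = (\<Sum>a\<in>Y. scale (u (T a)) (T a))"
      using inj by (simp add: sum.reindex[OF inj_on_subset])
    then have *: "(\<Sum>a\<in>Y. scale (u (T a)) a) \<in> K" using Y X by (intro in_K) auto
    obtain a where "a \<in> Y" "v = T a" using X Y by auto
    then show "u v = 0" using ind[OF Y(2,1) *] by simp
  qed
  have "T ` V \<subseteq> span (T ` A)"
  proof
    fix y assume "y \<in> T ` V"
    then obtain v where v: "v \<in> V" "y = T v" by auto
    then obtain a where a: "a \<in> span A" "v - a \<in> K" using sp by blast
    then have "T v = T a" using T.diff[of v a] by (simp add: K_def)
    then show "y \<in> span (T ` A)" using a v by (simp add: T.span_image)
  qed
  then have "dim (T ` V) = card (T ` A)"
    using AV indep by (intro basis_card_eq_dim[symmetric]) auto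
  then show ?thesis
    using quotient_basis_card[OF K V KV A fin] card_image[OF inj] unfolding K_def by simp
qed

end

section \<open>Tame functionals from spaces of chains\<close>

interpretation chain: vector_space "chain_scale :: 'f::field \<Rightarrow> ('a list \<Rightarrow> 'f) \<Rightarrow> _"
  by (rule vector_space_chains)

lemma sum_fun_apply: "(\<Sum>i\<in>S. f i) x = (\<Sum>i\<in>S. f i x :: 'b::comm_monoid_add)"
  by (induction S rule: infinite_finite_induct) auto

lemma finitely_supported_span:
  fixes V :: "('a list \<Rightarrow> 'f::field) set"
  assumes "finite S" "\<And>c vs. c \<in> V \<Longrightarrow> c vs \<noteq> 0 \<Longrightarrow> vs \<in> S"
  shows "V \<subseteq> chain.span ((\<lambda>vs ws. if ws = vs then 1 else 0) ` S)"
proof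
  fix c assume c: "c \<in> V"
  let ?e = "\<lambda>vs ws. if ws = vs then 1 else 0 :: 'f"
  have "c = (\<Sum>vs\<in>S. chain_scale (c vs) (?e vs))"
  proof
    fix ws
    have "(\<Sum>vs\<in>S. chain_scale (c vs) (?e vs)) ws = (\<Sum>vs\<in>S. if ws = vs then c vs else 0)"
      by (simp add: sum_fun_apply) (intro sum.cong, auto)
    also have "\<dots> = c ws" using assms c by (auto simp: sum.delta')
    finally show "c ws = (\<Sum>vs\<in>S. chain_scale (c vs) (?e vs)) ws" ..
  qed
  also have "\<dots> \<in> chain.span (?e ` S)"
    by (intro chain.span_sum chain.span_scale chain.span_base) auto
  finally show "c \<in> chain.span (?e ` S)" .
qed


text \<open>The interface between homology and probability. In the applications p is the number of
  vertices of a simplex and R bounds the diameters, so the power counts the vertex lists that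
  deleting C can affect. The value 0 at the empty set turns the third condition with C = X into a
  bound on f X itself.\<close>

definition tame :: "nat \<Rightarrow> real \<Rightarrow> ('a::metric_space set \<Rightarrow> nat) \<Rightarrow> bool" where
  "tame p R f \<longleftrightarrow>
     (\<forall>X Y. finite X \<longrightarrow> finite Y \<longrightarrow> f X + f Y \<le> f (X \<union> Y) + f (X \<inter> Y)) \<and>
     (\<forall>X Y. finite Y \<longrightarrow> X \<subseteq> Y \<longrightarrow> f X \<le> f Y) \<and>
     (\<forall>X C. finite X \<longrightarrow> f X \<le> f (X - C) + card {x \<in> X. \<exists>y\<in>C. dist x y \<le> R} ^ p) \<and> f {} = 0"

text \<open>\<open>restrict\<close> is the decisive axiom: within V X, belonging to V Y is a matter
  of support. It yields \<open>inter\<close>, by which the intersection of subspaces in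
  \<open>chain.dim_supermodular\<close> becomes an intersection of point sets.\<close>

locale chain_family =
  fixes V :: "'a::metric_space set \<Rightarrow> ('a list \<Rightarrow> 'f::field) set" and p :: nat and R :: real
  assumes subspace: "finite X \<Longrightarrow> chain.subspace (V X)"
    and mono: "X \<subseteq> Y \<Longrightarrow> V X \<subseteq> V Y"
    and restrict: "Y \<subseteq> X \<Longrightarrow> c \<in> V X \<Longrightarrow> (\<And>vs. c vs \<noteq> 0 \<Longrightarrow> set vs \<subseteq> Y) \<Longrightarrow> c \<in> V Y"
    and support: "c \<in> V X \<Longrightarrow> c vs \<noteq> 0 \<Longrightarrow> length vs = p \<and> vs \<noteq> [] \<and> set vs \<subseteq> X"
    and diameter: "c \<in> V X \<Longrightarrow> c vs \<noteq> 0 \<Longrightarrow> x \<in> set vs \<Longrightarrow> y \<in> set vs \<Longrightarrow> dist x y \<le> R"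
begin

lemma finite_span:
  assumes "finite X"
  obtains C where "finite C" "V X \<subseteq> chain.span C"
proof -
  have "V X \<subseteq> chain.span ((\<lambda>vs ws. if ws = vs then 1 else 0) ` {vs. set vs \<subseteq> X \<and> length vs = p})"
    using support assms by (intro finitely_supported_span finite_lists_length_eq) auto
  then show ?thesis using assms by (intro that[rotated]) (auto intro: finite_lists_length_eq)
qed

lemma inter: "V X \<inter> V Y = V (X \<inter> Y)"
proof
  show "V (X \<inter> Y) \<subseteq> V X \<inter> V Y" using mono by blast
  show "V X \<inter> V Y \<subseteq> V (X \<inter> Y)"
  proof
    fix c assume c: "c \<in> V X \<inter> V Y"
    show "c \<in> V (X \<inter> Y)"
    proof (rule restrict[of _ X])
      show "set vs \<subseteq> X \<inter> Y" if "c vs \<noteq> 0" for vs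
        using c support[of c X vs] support[of c Y vs] that by simp
    qed (use c in simp_all)
  qed
qed

text \<open>Rank-nullity for the projection T onto the vertex lists that meet C. Its kernel in V X
  is supported off C, hence lies in V (X - C). Its image, which need not lie in any V, lives on
  lists whose vertices are all within R of C.\<close>

lemma dim_remove:
  assumes X: "finite X"
  shows "chain.dim (V X) \<le> chain.dim (V (X - C)) + card {x \<in> X. \<exists>y\<in>C. dist x y \<le> R} ^ p"
proof -
  define S where "S = {vs. set vs \<subseteq> {x \<in> X. \<exists>y\<in>C. dist x y \<le> R} \<and> length vs = p}"
  define T where "T c vs = (if set vs \<inter> C = {} then 0 else c vs)" for c :: "'a list \<Rightarrow> 'f" and vs
  let ?e = "\<lambda>vs ws. if ws = vs then 1 else 0 :: 'f"
  have lin: "Vector_Spaces.linear chain_scale chain_scale T"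
    by unfold_locales (auto simp: T_def fun_eq_iff algebra_simps)
  obtain D where D: "finite D" "V X \<subseteq> chain.span D" using finite_span[OF X] by blast
  have fS: "finite S" unfolding S_def using X by (intro finite_lists_length_eq) auto
  have "T ` V X \<subseteq> chain.span (?e ` S)"
  proof (rule finitely_supported_span[OF fS])
    fix c vs assume "c \<in> T ` V X" "c vs \<noteq> 0"
    then obtain d where d: "d \<in> V X" "c = T d" "d vs \<noteq> 0" "set vs \<inter> C \<noteq> {}"
      by (auto simp: T_def split: if_splits)
    then show "vs \<in> S" using support[OF d(1,3)] diameter[OF d(1,3)] unfolding S_def by blast
  qed
  then have "chain.dim (T ` V X) \<le> card (?e ` S)" using fS by (intro chain.dim_le_card) auto
  also have "\<dots> \<le> card S" using fS by (rule card_image_le)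
  also have "card S = card {x \<in> X. \<exists>y\<in>C. dist x y \<le> R} ^ p"
    unfolding S_def using X by (intro card_lists_length_eq) auto
  finally have 1: "chain.dim (T ` V X) \<le> card {x \<in> X. \<exists>y\<in>C. dist x y \<le> R} ^ p" .
  have "{c \<in> V X. T c = 0} \<subseteq> V (X - C)"
  proof
    fix c assume c: "c \<in> {c \<in> V X. T c = 0}"
    then have "T c vs = 0" for vs by simp
    then have "set vs \<inter> C = {}" if "c vs \<noteq> 0" for vs
      using that unfolding T_def by (metis (full_types))
    note disj = this
    show "c \<in> V (X - C)"
    proof (rule restrict[of _ X])
      show "set vs \<subseteq> X - C" if "c vs \<noteq> 0" for vs
        using c support[of c X vs] disj[OF that] that by auto
    qed (use c in simp_all)
  qed
  moreover have "V (X - C) \<subseteq> chain.span D" using D mono[of "X - C" X] by auto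
  ultimately have "chain.dim {c \<in> V X. T c = 0} \<le> chain.dim (V (X - C))"
    using D by (intro chain.dim_mono_finite)
  with 1 show ?thesis using chain.dim_image_kernel[OF lin subspace[OF X] D] by simp
qed

lemma tame_dim: "tame p R (\<lambda>X. chain.dim (V X))"
  unfolding tame_def
proof (intro conjI allI impI)
  fix X Y :: "'a set" assume XY: "finite X" "finite Y"
  then obtain C where C: "finite C" "V (X \<union> Y) \<subseteq> chain.span C" using finite_span[of "X \<union> Y"] by auto
  show "chain.dim (V X) + chain.dim (V Y) \<le> chain.dim (V (X \<union> Y)) + chain.dim (V (X \<inter> Y))"
    unfolding inter[symmetric] using XY subspace mono C by (intro chain.dim_supermodular) auto
next
  fix X Y :: "'a set" assume XY: "finite Y" "X \<subseteq> Y"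
  then obtain C where "finite C" "V Y \<subseteq> chain.span C" using finite_span by blast
  then show "chain.dim (V X) \<le> chain.dim (V Y)" using mono[OF XY(2)] by (intro chain.dim_mono_finite)
next
  \<comment> \<open>Vertex lists are nonempty, so a chain on no points is 0.\<close>
  have "V {} \<subseteq> chain.span {}"
  proof
    fix c assume "c \<in> V {}"
    then have "c = 0" using support[of c "{}"] by (fastforce simp: fun_eq_iff)
    then show "c \<in> chain.span {}" by simp
  qed
  then show "chain.dim (V {}) = 0" using chain.dim_le_card[of "V {}" "{}"] by simp
qed (rule dim_remove)

end

section \<open>Cycles, fillings and the decomposition of the Betti number\<close>

lemma chains_subspace: "chain.subspace (chains q K :: ('a list \<Rightarrow> 'f::field) set)"
  unfolding chain.subspace_def
proof (intro conjI ballI allI)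
  show "0 \<in> chains q K" by (simp add: chains_def)
next
  fix c d :: "'a list \<Rightarrow> 'f" assume c: "c \<in> chains q K" and d: "d \<in> chains q K"
  show "c + d \<in> chains q K"
    unfolding chains_def mem_Collect_eq
  proof (intro conjI allI impI)
    fix vs assume "(c + d) vs \<noteq> 0"
    then have "c vs \<noteq> 0 \<or> d vs \<noteq> 0" by auto
    then show "length vs = Suc q" "distinct vs" "set vs \<in> K"
      using chains_support[OF c, of vs] chains_support[OF d, of vs] by blast+
  next
    fix vs :: "'a list" and p :: "nat \<Rightarrow> nat" assume "p permutes {..<length vs}"
    then show "(c + d) (permute_list p vs) = of_int (sign p) * (c + d) vs"
      using chains_permute[OF c] chains_permute[OF d] by (simp add: algebra_simps)
  qed
next
  fix a and c :: "'a list \<Rightarrow> 'f" assume c: "c \<in> chains q K"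
  show "chain_scale a c \<in> chains q K"
    unfolding chains_def mem_Collect_eq
  proof (intro conjI allI impI)
    fix vs assume "a * c vs \<noteq> 0"
    then have "c vs \<noteq> 0" by auto
    then show "length vs = Suc q" "distinct vs" "set vs \<in> K"
      using chains_support[OF c, of vs] by blast+
  next
    fix vs :: "'a list" and p :: "nat \<Rightarrow> nat" assume "p permutes {..<length vs}"
    then show "a * c (permute_list p vs) = of_int (sign p) * (a * c vs)"
      using chains_permute[OF c] by (simp add: algebra_simps)
  qed
qed

lemma chains_mono: "c \<in> chains q K \<Longrightarrow> (\<And>vs. c vs \<noteq> 0 \<Longrightarrow> set vs \<in> L) \<Longrightarrow> c \<in> chains q L"
  unfolding chains_def by blast

lemma boundary_cong_finite:
  assumes "finite S" "\<And>v. c (v # ws) \<noteq> 0 \<Longrightarrow> v \<in> S" "ws \<noteq> []"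
  shows "boundary c ws = (\<Sum>v\<in>S. c (v # ws))"
  unfolding boundary_def using assms by (auto intro!: sum.mono_neutral_left)

text \<open>Unlike \<^const>\<open>boundary\<close>, whose defining sum is junk on chains of infinite support, this
  operator is linear on the whole ambient space.\<close>

definition boundary_in :: "'a set \<Rightarrow> ('a list \<Rightarrow> 'f::field) \<Rightarrow> 'a list \<Rightarrow> 'f" where
  "boundary_in X c ws = (if ws = [] then 0 else \<Sum>v\<in>X. c (v # ws))"

lemma linear_boundary_in: "Vector_Spaces.linear chain_scale chain_scale (boundary_in X)"
  by unfold_locales
    (auto simp: boundary_in_def fun_eq_iff sum.distrib sum_distrib_left)

lemma boundary_eq_boundary_in:
  assumes "finite X" "c \<in> chains q K" "K \<subseteq> Pow X"
  shows "boundary c = boundary_in X c"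
proof
  fix ws
  have "v \<in> X" if "c (v # ws) \<noteq> 0" for v using chains_support[OF assms(2) that] assms(3) by auto
  then show "boundary c ws = boundary_in X c ws"
    using boundary_cong_finite[OF assms(1), of c ws] by (simp add: boundary_in_def boundary_def)
qed

lemma boundary_support:
  assumes "boundary c ws \<noteq> 0" obtains v where "c (v # ws) \<noteq> 0"
proof -
  have "\<exists>v. c (v # ws) \<noteq> 0"
  proof (rule ccontr)
    assume "\<nexists>v. c (v # ws) \<noteq> 0"
    then have "boundary c ws = 0" by (simp add: boundary_def)
    with assms show False by simp
  qed
  then show thesis using that by blast
qed

lemma subspace_linear_vimage:
  assumes "Vector_Spaces.linear chain_scale chain_scale T" "chain.subspace V" "chain.subspace W"
  shows "chain.subspace {c \<in> V. T c \<in> W}"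
proof -
  interpret T: Vector_Spaces.linear chain_scale chain_scale T by (rule assms(1))
  show ?thesis using assms(2,3)
    by (auto simp: chain.subspace_def T.add T.scale T.zero)
qed

lemma cycles_subspace:
  assumes "finite X" "K \<subseteq> Pow X"
  shows "chain.subspace (cycles q K :: ('a list \<Rightarrow> 'f::field) set)"
proof -
  have "(cycles q K :: ('a list \<Rightarrow> 'f) set) = {c \<in> chains q K. boundary_in X c \<in> {0}}"
    using boundary_eq_boundary_in[OF assms(1) _ assms(2), where 'b='f] unfolding cycles_def by auto
  then show ?thesis
    using subspace_linear_vimage[OF linear_boundary_in chains_subspace chain.subspace_single_0] by simp
qed

text \<open>With K = K_r and L = K_s this is the preimage of Z_q(K_r) under the boundary operator on
  (q+1)-chains of K_s.\<close>

definition fillings :: "nat \<Rightarrow> 'a set set \<Rightarrow> 'a set set \<Rightarrow> ('a list \<Rightarrow> 'f::field) set" where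
  "fillings q K L = {b \<in> chains (Suc q) L. boundary b \<in> cycles q K}"

lemma fillings_subspace:
  assumes "finite X" "K \<subseteq> Pow X" "L \<subseteq> Pow X"
  shows "chain.subspace (fillings q K L :: ('a list \<Rightarrow> 'f::field) set)"
proof -
  have "(fillings q K L :: ('a list \<Rightarrow> 'f) set) = {c \<in> chains (Suc q) L. boundary_in X c \<in> cycles q K}"
    using boundary_eq_boundary_in[OF assms(1) _ assms(3), where 'b='f] unfolding fillings_def by auto
  then show ?thesis
    using subspace_linear_vimage[OF linear_boundary_in chains_subspace cycles_subspace[OF assms(1,2)]]
    by simp
qed

lemma chains_finite_span:
  assumes "finite X" "K \<subseteq> Pow X"
  obtains C :: "('a list \<Rightarrow> 'f::field) set" where "finite C" "chains q K \<subseteq> chain.span C"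
proof -
  have "(chains q K :: ('a list \<Rightarrow> 'f) set) \<subseteq> chain.span ((\<lambda>vs ws. if ws = vs then 1 else 0) ` {vs. set vs \<subseteq> X \<and> length vs = Suc q})"
    using assms by (intro finitely_supported_span finite_lists_length_eq) (auto dest!: chains_support)
  then show ?thesis using assms by (intro that[rotated]) (auto intro: finite_lists_length_eq)
qed

text \<open>Rank-nullity for the boundary operator turns the extended persistent Betti number into a signed
  sum of dimensions of spaces whose dependence on the points is a pure support condition.\<close>

lemma persistent_betti_eq:
  fixes K :: "real \<Rightarrow> 'a set set"
  assumes X: "finite X" "K r \<subseteq> Pow X" "K s \<subseteq> Pow X"
  shows "real (persistent_betti TYPE('f::field) q r s K) =
    real (chain.dim (cycles q (K r) :: ('a list \<Rightarrow> 'f) set)) -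
    real (chain.dim (fillings q (K r) (K s) :: ('a list \<Rightarrow> 'f) set)) +
    real (chain.dim (cycles (Suc q) (K s) :: ('a list \<Rightarrow> 'f) set))" (is "_ = real (chain.dim ?Z) - real (chain.dim ?E) + real (chain.dim ?Z')")
proof -
  obtain C :: "('a list \<Rightarrow> 'f) set" where C: "finite C" "chains q (K r) \<subseteq> chain.span C"
    using chains_finite_span[OF X(1,2)] by blast
  obtain D :: "('a list \<Rightarrow> 'f) set" where D: "finite D" "chains (Suc q) (K s) \<subseteq> chain.span D"
    using chains_finite_span[OF X(1,3)] by blast
  have E: "chain.subspace ?E" by (rule fillings_subspace[OF X])
  have ZC: "?Z \<subseteq> chain.span C" using C by (auto simp: cycles_def)
  have ED: "?E \<subseteq> chain.span D" using D by (auto simp: fillings_def)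
  have b: "boundary b = boundary_in X b" if "b \<in> chains (Suc q) (K s)" for b :: "'a list \<Rightarrow> 'f"
    by (rule boundary_eq_boundary_in[OF X(1) that X(3)])
  have ZB: "?Z \<inter> boundaries q (K s) = boundary_in X ` ?E"
    using b by (auto simp: boundaries_def fillings_def image_iff)
  \<comment> \<open>Since 0 is a cycle of \<open>K r\<close>, every (q+1)-cycle of
    \<open>K s\<close> is a filling, whatever the order of r and s.\<close>
  have "(0 :: 'a list \<Rightarrow> 'f) \<in> cycles q (K r)"
    using cycles_subspace[OF X(1,2)] by (rule chain.subspace_0)
  then have ker: "{c \<in> ?E. boundary_in X c = 0} = ?Z'"
    using b by (auto simp: fillings_def cycles_def[of "Suc q"])
  have sub: "chain.subspace (boundary_in X ` ?E)"
    using E by (intro module_hom.subspace_image[OF Vector_Spaces.linear.axioms(3)[OF linear_boundary_in]])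
  have "chain.quotient_dim ?Z (boundary_in X ` ?E) = chain.dim ?Z - chain.dim (boundary_in X ` ?E)"
    using ZB by (intro chain.quotient_dim_eq[OF sub cycles_subspace[OF X(1,2)] _ C(1) ZC]) auto
  \<comment> \<open>Guards the truncated subtraction of natural numbers just obtained.\<close>
  moreover have "chain.dim (boundary_in X ` ?E) \<le> chain.dim ?Z"
    using ZB by (intro chain.dim_mono_finite[OF _ C(1) ZC]) auto
  moreover have "chain.dim ?E = chain.dim (boundary_in X ` ?E) + chain.dim ?Z'"
    using chain.dim_image_kernel[OF linear_boundary_in E D(1) ED, of X] ker by simp
  ultimately show ?thesis unfolding persistent_betti_def ZB by simp
qed

section \<open>Relabelling the points\<close>

text \<open>\<psi> will be a bijection from Y onto X with arbitrary values off Y, hence the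
  cut-off.\<close>

definition pullback :: "('a \<Rightarrow> 'b) \<Rightarrow> 'a set \<Rightarrow> ('b list \<Rightarrow> 'f::field) \<Rightarrow> 'a list \<Rightarrow> 'f" where
  "pullback \<psi> Y c vs = (if set vs \<subseteq> Y then c (map \<psi> vs) else 0)"

lemma pullback_zero [simp]: "pullback \<psi> Y 0 = 0"
  by (simp add: pullback_def fun_eq_iff)

lemma linear_pullback: "Vector_Spaces.linear chain_scale chain_scale (pullback \<psi> Y)"
  by unfold_locales (auto simp: pullback_def fun_eq_iff algebra_simps)

lemma pullback_chains:
  fixes \<psi> :: "'a \<Rightarrow> 'b"
  assumes c: "c \<in> chains q K" and inj: "inj_on \<psi> Y"
    and KL: "\<And>\<sigma>. \<sigma> \<subseteq> Y \<Longrightarrow> \<psi> ` \<sigma> \<in> K \<Longrightarrow> \<sigma> \<in> L"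
  shows "pullback \<psi> Y c \<in> chains q L"
  unfolding chains_def mem_Collect_eq
proof (intro conjI allI impI)
  fix vs assume "pullback \<psi> Y c vs \<noteq> 0"
  then have Y: "set vs \<subseteq> Y" and "c (map \<psi> vs) \<noteq> 0"
    by (auto simp: pullback_def split: if_splits)
  then have "length (map \<psi> vs) = Suc q \<and> distinct (map \<psi> vs) \<and> set (map \<psi> vs) \<in> K"
    using chains_support[OF c] by blast
  then show "length vs = Suc q" "distinct vs" "set vs \<in> L"
    using KL[OF Y] by (auto simp: distinct_map)
next
  fix vs :: "'a list" and p :: "nat \<Rightarrow> nat" assume p: "p permutes {..<length vs}"
  have "c (map \<psi> (permute_list p vs)) = of_int (sign p) * c (map \<psi> vs)"
    using chains_permute[OF c, of p "map \<psi> vs"] p by (simp add: permute_list_map)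
  then show "pullback \<psi> Y c (permute_list p vs) = of_int (sign p) * pullback \<psi> Y c vs"
    using p by (simp add: pullback_def)
qed

text \<open>A coefficient of the boundary is a sum over apexes v, and \<psi> matches the apexes in Y
  with those in X. A chain supported on X has no apex outside the image of Y.\<close>

lemma pullback_boundary:
  assumes bij: "bij_betw \<psi> Y X" and c: "\<And>vs. c vs \<noteq> 0 \<Longrightarrow> set vs \<subseteq> X"
  shows "boundary (pullback \<psi> Y c) = pullback \<psi> Y (boundary c)"
proof
  fix ws
  consider "ws = []" | "ws \<noteq> []" "\<not> set ws \<subseteq> Y" | "ws \<noteq> []" "set ws \<subseteq> Y" by blast
  then show "boundary (pullback \<psi> Y c) ws = pullback \<psi> Y (boundary c) ws"
  proof cases
    case 3
    have "(\<Sum>v | pullback \<psi> Y c (v # ws) \<noteq> 0. pullback \<psi> Y c (v # ws)) =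
        (\<Sum>v | v \<in> Y \<and> c (\<psi> v # map \<psi> ws) \<noteq> 0. c (\<psi> v # map \<psi> ws))"
      using 3 by (intro sum.cong) (auto simp: pullback_def split: if_splits)
    also have "\<dots> = (\<Sum>x | c (x # map \<psi> ws) \<noteq> 0. c (x # map \<psi> ws))"
    proof (rule sum.reindex_bij_betw)
      have "{x. c (x # map \<psi> ws) \<noteq> 0} = \<psi> ` {v \<in> Y. c (\<psi> v # map \<psi> ws) \<noteq> 0}"
      proof (intro set_eqI iffI)
        fix x assume x: "x \<in> {x. c (x # map \<psi> ws) \<noteq> 0}"
        then have "x \<in> X" using c[of "x # map \<psi> ws"] by simp
        then obtain v where "v \<in> Y" "x = \<psi> v" using bij by (auto simp: bij_betw_def)
        then show "x \<in> \<psi> ` {v \<in> Y. c (\<psi> v # map \<psi> ws) \<noteq> 0}" using x by blast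
      qed auto
      moreover have "inj_on \<psi> {v \<in> Y. c (\<psi> v # map \<psi> ws) \<noteq> 0}"
        using bij by (auto simp: bij_betw_def inj_on_def)
      ultimately show "bij_betw \<psi> {v \<in> Y. c (\<psi> v # map \<psi> ws) \<noteq> 0} {x. c (x # map \<psi> ws) \<noteq> 0}"
        by (simp add: bij_betw_def)
    qed
    finally show ?thesis using 3 by (simp add: boundary_def pullback_def)
  qed (auto simp: boundary_def pullback_def)
qed

text \<open>Every vertex list on X is the image of one on Y, so no coefficient is lost.\<close>

lemma pullback_inj:
  assumes "bij_betw \<psi> Y X" "\<And>vs. c vs \<noteq> 0 \<Longrightarrow> set vs \<subseteq> X" "pullback \<psi> Y c = 0"
  shows "c = 0"
proof
  fix vs show "c vs = 0 vs"
  proof (rule ccontr)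
    assume "c vs \<noteq> 0 vs"
    then have X: "set vs \<subseteq> X" and nz: "c vs \<noteq> 0" using assms(2)[of vs] by auto
    define ws where "ws = map (inv_into Y \<psi>) vs"
    have "\<psi> (inv_into Y \<psi> x) = x" if "x \<in> set vs" for x
      using X assms(1) that by (auto simp: bij_betw_def intro!: f_inv_into_f)
    then have "map \<psi> ws = vs" by (simp add: ws_def map_idI)
    moreover have "set ws \<subseteq> Y" unfolding ws_def using X assms(1)
      by (auto simp: bij_betw_def intro: inv_into_into)
    ultimately have "pullback \<psi> Y c ws = c vs" by (simp add: pullback_def)
    with nz assms(3) show False by simp
  qed
qed

lemma pullback_cycles:
  assumes "c \<in> cycles q K" "bij_betw \<psi> Y X" "K \<subseteq> Pow X"
    "\<And>\<sigma>. \<sigma> \<subseteq> Y \<Longrightarrow> \<psi> ` \<sigma> \<in> K \<Longrightarrow> \<sigma> \<in> L"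
  shows "pullback \<psi> Y c \<in> cycles q L"
proof -
  have c: "c \<in> chains q K" "boundary c = 0" using assms(1) by (auto simp: cycles_def)
  have "boundary (pullback \<psi> Y c) = pullback \<psi> Y (boundary c)"
    using chains_support[OF c(1)] assms(3) by (intro pullback_boundary[OF assms(2)]) blast
  then show ?thesis using pullback_chains[OF c(1), of \<psi> Y L] assms c by (auto simp: cycles_def bij_betw_def)
qed

lemma pullback_fillings:
  assumes "b \<in> fillings q K K'" "bij_betw \<psi> Y X" "K \<subseteq> Pow X" "K' \<subseteq> Pow X"
    "\<And>\<sigma>. \<sigma> \<subseteq> Y \<Longrightarrow> \<psi> ` \<sigma> \<in> K \<Longrightarrow> \<sigma> \<in> L" "\<And>\<sigma>. \<sigma> \<subseteq> Y \<Longrightarrow> \<psi> ` \<sigma> \<in> K' \<Longrightarrow> \<sigma> \<in> L'"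
  shows "pullback \<psi> Y b \<in> fillings q L L'"
proof -
  have b: "b \<in> chains (Suc q) K'" "boundary b \<in> cycles q K" using assms(1) by (auto simp: fillings_def)
  have "boundary (pullback \<psi> Y b) = pullback \<psi> Y (boundary b)"
    using chains_support[OF b(1)] assms(4) by (intro pullback_boundary[OF assms(2)]) blast
  then show ?thesis
    using pullback_chains[OF b(1), of \<psi> Y L'] pullback_cycles[OF b(2) assms(2,3,5)] assms(2,6)
    by (auto simp: fillings_def bij_betw_def)
qed

lemma dim_le_pullback:
  fixes V W :: "('a list \<Rightarrow> 'f::field) set"
  assumes bij: "bij_betw \<psi> Y X" and V: "chain.subspace V" and fin: "finite X" "finite Y"
    and VX: "V \<subseteq> chains q K" "K \<subseteq> Pow X"
    and WY: "W \<subseteq> chains q L" "L \<subseteq> Pow Y"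
    and VW: "\<And>c. c \<in> V \<Longrightarrow> pullback \<psi> Y c \<in> W"
  shows "chain.dim V \<le> chain.dim W"
proof -
  obtain C :: "('a list \<Rightarrow> 'f) set" where C: "finite C" "chains q K \<subseteq> chain.span C"
    using chains_finite_span[OF fin(1) VX(2)] by blast
  obtain D :: "('a list \<Rightarrow> 'f) set" where D: "finite D" "chains q L \<subseteq> chain.span D"
    using chains_finite_span[OF fin(2) WY(2)] by blast
  have "{v \<in> V. pullback \<psi> Y v = 0} \<subseteq> chain.span {}"
  proof
    fix v assume v: "v \<in> {v \<in> V. pullback \<psi> Y v = 0}"
    have supp: "set vs \<subseteq> X" if "v vs \<noteq> 0" for vs
      using chains_support[of v q K, OF _ that] VX v by blast
    from pullback_inj[OF bij, where c=v, OF supp] have "v = 0" using v by simp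
    then show "v \<in> chain.span {}" by simp
  qed
  then have "chain.dim {v \<in> V. pullback \<psi> Y v = 0} = 0"
    using chain.dim_le_card[of _ "{}"] by simp
  moreover have "chain.dim (pullback \<psi> Y ` V) \<le> chain.dim W"
    using VW D WY by (intro chain.dim_mono_finite[OF _ D(1)]) auto
  moreover have "chain.dim V = chain.dim (pullback \<psi> Y ` V) + chain.dim {v \<in> V. pullback \<psi> Y v = 0}"
    using C VX(1) by (intro chain.dim_image_kernel[OF linear_pullback V C(1)]) auto
  ultimately show ?thesis by simp
qed

text \<open>f sees only the pair of complexes at the thresholds r and s, up to relabelling of the
  vertices. Both translation invariance and measurability of the dimensions are derived from this,
  without returning to the chain spaces.\<close>

definition pattern_invariant :: "('a set \<Rightarrow> ennreal) \<Rightarrow> real \<Rightarrow> real \<Rightarrow> ('a set \<Rightarrow> nat) \<Rightarrow> bool" where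
  "pattern_invariant \<kappa> r s f \<longleftrightarrow> (\<forall>X Y \<psi>. finite X \<longrightarrow> finite Y \<longrightarrow> bij_betw \<psi> Y X \<longrightarrow>
     (\<forall>\<sigma>\<subseteq>Y. \<sigma> \<noteq> {} \<longrightarrow> (\<kappa> (\<psi> ` \<sigma>) \<le> ennreal r \<longleftrightarrow> \<kappa> \<sigma> \<le> ennreal r) \<and>
       (\<kappa> (\<psi> ` \<sigma>) \<le> ennreal s \<longleftrightarrow> \<kappa> \<sigma> \<le> ennreal s)) \<longrightarrow> f X = f Y)"

text \<open>One inequality suffices, because the inverse bijection satisfies the same hypothesis
  with X and Y exchanged.\<close>

lemma pattern_invariantI:
  assumes le: "\<And>X Y \<psi>. finite X \<Longrightarrow> finite Y \<Longrightarrow> bij_betw \<psi> Y X \<Longrightarrow>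
     (\<And>t \<sigma>. t \<in> {r, s} \<Longrightarrow> \<sigma> \<subseteq> Y \<Longrightarrow> \<psi> ` \<sigma> \<in> filtration_complex \<kappa> X t \<longleftrightarrow> \<sigma> \<in> filtration_complex \<kappa> Y t) \<Longrightarrow>
     f X \<le> f Y"
  shows "pattern_invariant \<kappa> r s f"
  unfolding pattern_invariant_def
proof (intro allI impI)
  fix X Y \<psi> assume fin: "finite X" "finite Y" and bij: "bij_betw \<psi> Y X"
    and *: "\<forall>\<sigma>\<subseteq>Y. \<sigma> \<noteq> {} \<longrightarrow> (\<kappa> (\<psi> ` \<sigma>) \<le> ennreal r \<longleftrightarrow> \<kappa> \<sigma> \<le> ennreal r) \<and>
       (\<kappa> (\<psi> ` \<sigma>) \<le> ennreal s \<longleftrightarrow> \<kappa> \<sigma> \<le> ennreal s)"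
  have 1: "\<psi> ` \<sigma> \<in> filtration_complex \<kappa> X t \<longleftrightarrow> \<sigma> \<in> filtration_complex \<kappa> Y t"
    if "t \<in> {r, s}" "\<sigma> \<subseteq> Y" for t \<sigma>
    using * that bij by (auto simp: filtration_complex_def bij_betw_def)
  let ?\<phi> = "inv_into Y \<psi>"
  have bij': "bij_betw ?\<phi> X Y" using bij by (rule bij_betw_inv_into)
  have 2: "?\<phi> ` \<tau> \<in> filtration_complex \<kappa> Y t \<longleftrightarrow> \<tau> \<in> filtration_complex \<kappa> X t"
    if "t \<in> {r, s}" "\<tau> \<subseteq> X" for t \<tau>
  proof -
    have "\<psi> ` ?\<phi> ` \<tau> = \<tau>" using bij that(2) by (metis bij_betw_def image_inv_into_cancel)
    moreover have "?\<phi> ` \<tau> \<subseteq> Y" using bij' that(2) by (auto simp: bij_betw_def)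
    ultimately show ?thesis using 1[of t "?\<phi> ` \<tau>"] that by simp
  qed
  show "f X = f Y"
    by (rule antisym[OF le[OF fin bij 1] le[OF fin(2,1) bij' 2]]) auto
qed

lemma cycles_subset_chains: "cycles q K \<subseteq> chains q K"
  by (auto simp: cycles_def)

lemma fillings_subset_chains: "fillings q K L \<subseteq> chains (Suc q) L"
  by (auto simp: fillings_def)

lemma filtration_complex_Pow: "filtration_complex \<kappa> X t \<subseteq> Pow X"
  by (auto simp: filtration_complex_def)

lemma pattern_invariant_cycles:
  assumes "t \<in> {r, s}"
  shows "pattern_invariant \<kappa> r s (\<lambda>X. chain.dim (cycles q (filtration_complex \<kappa> X t) :: ('a list \<Rightarrow> 'f::field) set))"
proof (rule pattern_invariantI)
  fix X Y :: "'a set" and \<psi>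
  assume fin: "finite X" "finite Y" and bij: "bij_betw \<psi> Y X" and
    *: "\<And>t \<sigma>. t \<in> {r, s} \<Longrightarrow> \<sigma> \<subseteq> Y \<Longrightarrow> \<psi> ` \<sigma> \<in> filtration_complex \<kappa> X t \<longleftrightarrow> \<sigma> \<in> filtration_complex \<kappa> Y t"
  show "chain.dim (cycles q (filtration_complex \<kappa> X t) :: ('a list \<Rightarrow> 'f) set)
      \<le> chain.dim (cycles q (filtration_complex \<kappa> Y t) :: ('a list \<Rightarrow> 'f) set)"
  proof (rule dim_le_pullback[OF bij cycles_subspace[OF fin(1)] fin])
    fix c :: "'a list \<Rightarrow> 'f" assume "c \<in> cycles q (filtration_complex \<kappa> X t)"
    then show "pullback \<psi> Y c \<in> cycles q (filtration_complex \<kappa> Y t)"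
      by (rule pullback_cycles[OF _ bij filtration_complex_Pow]) (simp add: *[OF assms])
  qed (rule filtration_complex_Pow cycles_subset_chains)+
qed

lemma pattern_invariant_fillings:
  shows "pattern_invariant \<kappa> r s (\<lambda>X. chain.dim (fillings q (filtration_complex \<kappa> X r)
    (filtration_complex \<kappa> X s) :: ('a list \<Rightarrow> 'f::field) set))"
proof (rule pattern_invariantI)
  fix X Y :: "'a set" and \<psi>
  assume fin: "finite X" "finite Y" and bij: "bij_betw \<psi> Y X" and
    *: "\<And>t \<sigma>. t \<in> {r, s} \<Longrightarrow> \<sigma> \<subseteq> Y \<Longrightarrow> \<psi> ` \<sigma> \<in> filtration_complex \<kappa> X t \<longleftrightarrow> \<sigma> \<in> filtration_complex \<kappa> Y t"
  show "chain.dim (fillings q (filtration_complex \<kappa> X r) (filtration_complex \<kappa> X s) :: ('a list \<Rightarrow> 'f) set)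
      \<le> chain.dim (fillings q (filtration_complex \<kappa> Y r) (filtration_complex \<kappa> Y s) :: ('a list \<Rightarrow> 'f) set)"
  proof (rule dim_le_pullback[OF bij fillings_subspace[OF fin(1)] fin])
    fix c :: "'a list \<Rightarrow> 'f"
    assume "c \<in> fillings q (filtration_complex \<kappa> X r) (filtration_complex \<kappa> X s)"
    then show "pullback \<psi> Y c \<in> fillings q (filtration_complex \<kappa> Y r) (filtration_complex \<kappa> Y s)"
      by (rule pullback_fillings[OF _ bij filtration_complex_Pow filtration_complex_Pow]) (simp_all add: *)
  qed (rule filtration_complex_Pow fillings_subset_chains)+
qed

lemma pattern_invariant_translation:
  assumes "pattern_invariant \<kappa> r s f" "filtration_function \<kappa>" "finite X"
  shows "f ((\<lambda>x. x + v) ` X) = f X"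
proof -
  have "bij_betw (\<lambda>x. x + v) X ((\<lambda>x. x + v) ` X)" by (auto simp: bij_betw_def inj_on_def)
  moreover have "\<kappa> ((\<lambda>x. x + v) ` \<sigma>) = \<kappa> \<sigma>" if "\<sigma> \<noteq> {}" "\<sigma> \<subseteq> X" for \<sigma>
    using assms(2) that finite_subset[OF that(2) assms(3)] unfolding filtration_function_def by blast
  ultimately show ?thesis
    using assms(1,3) unfolding pattern_invariant_def by (metis (no_types, lifting) finite_imageI)
qed

section \<open>Bounded diameter of simplices and restriction to fewer points\<close>

lemma filtration_function_mono:
  assumes "filtration_function \<kappa>" "\<sigma> \<noteq> {}" "finite \<tau>" "\<sigma> \<subseteq> \<tau>"
  shows "\<kappa> \<sigma> \<le> \<kappa> \<tau>"
  using assms(1)[unfolded filtration_function_def, THEN conjunct2, THEN conjunct1] assms(2-) by simp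

text \<open>The radius is \<rho>(t), finite because t is: \<kappa> of a pair of points of \<sigma>
  is at most \<kappa> \<sigma>.\<close>

lemma filtration_diameter:
  fixes \<kappa> :: "'a::euclidean_space set \<Rightarrow> ennreal"
  assumes "filtration_function \<kappa>"
  obtains R :: real where "\<And>x y \<sigma>. finite \<sigma> \<Longrightarrow> \<kappa> \<sigma> \<le> ennreal t \<Longrightarrow> x \<in> \<sigma> \<Longrightarrow> y \<in> \<sigma> \<Longrightarrow> dist x y \<le> R"
proof -
  obtain \<rho> :: "ennreal \<Rightarrow> ennreal" where \<rho>: "mono \<rho>" "\<And>t. t < \<infinity> \<Longrightarrow> \<rho> t < \<infinity>"
      "\<And>x y. ennreal (norm (x - y)) \<le> \<rho> (\<kappa> {x, y})"
    using assms unfolding filtration_function_def by blast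
  have fin: "\<rho> (ennreal t) < \<infinity>" by (intro \<rho>(2)) (simp add: less_top)
  have "dist x y \<le> enn2real (\<rho> (ennreal t))"
    if "finite \<sigma>" "\<kappa> \<sigma> \<le> ennreal t" "x \<in> \<sigma>" "y \<in> \<sigma>" for x y \<sigma>
  proof -
    have "\<kappa> {x, y} \<le> \<kappa> \<sigma>" using that by (intro filtration_function_mono[OF assms]) auto
    then have "\<rho> (\<kappa> {x, y}) \<le> \<rho> (ennreal t)" using \<rho>(1) that(2) by (meson monoD order_trans)
    then have "ennreal (norm (x - y)) \<le> \<rho> (ennreal t)" using \<rho>(3) order_trans by blast
    then have "enn2real (ennreal (norm (x - y))) \<le> enn2real (\<rho> (ennreal t))"
      using fin by (intro enn2real_mono) auto
    then show ?thesis by (simp add: dist_norm)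
  qed
  then show ?thesis by (rule that)
qed

text \<open>\<open>boundary\<close> does not refer to the complex, so a cycle stays a cycle in every
  complex that contains its simplices.\<close>

lemma cycles_restrict:
  assumes "c \<in> cycles q (filtration_complex \<kappa> X t)" "\<And>vs. c vs \<noteq> 0 \<Longrightarrow> set vs \<subseteq> Y"
  shows "c \<in> cycles q (filtration_complex \<kappa> Y t)"
proof -
  have c: "c \<in> chains q (filtration_complex \<kappa> X t)" "boundary c = 0" using assms(1) by (auto simp: cycles_def)
  have "set vs \<in> filtration_complex \<kappa> Y t" if "c vs \<noteq> 0" for vs
    using chains_support[OF c(1) that] assms(2)[OF that] by (auto simp: filtration_complex_def)
  then show ?thesis using chains_mono[OF c(1)] c(2) by (auto simp: cycles_def)
qed

text \<open>A face with nonzero coefficient in the boundary comes from a list in the support of the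
  chain, so the boundary is supported on Y as well.\<close>

lemma fillings_restrict:
  assumes "b \<in> fillings q (filtration_complex \<kappa> X r) (filtration_complex \<kappa> X s)"
    "\<And>vs. b vs \<noteq> 0 \<Longrightarrow> set vs \<subseteq> Y"
  shows "b \<in> fillings q (filtration_complex \<kappa> Y r) (filtration_complex \<kappa> Y s)"
proof -
  have b: "b \<in> chains (Suc q) (filtration_complex \<kappa> X s)" "boundary b \<in> cycles q (filtration_complex \<kappa> X r)"
    using assms(1) by (auto simp: fillings_def)
  have "set ws \<subseteq> Y" if "boundary b ws \<noteq> 0" for ws
    using boundary_support[OF that] assms(2) by (metis list.set_intros(2) subset_iff)
  then have "boundary b \<in> cycles q (filtration_complex \<kappa> Y r)"
    using b(2) by (rule cycles_restrict[rotated])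
  moreover have "set vs \<in> filtration_complex \<kappa> Y s" if "b vs \<noteq> 0" for vs
    using chains_support[OF b(1) that] assms(2)[OF that] by (auto simp: filtration_complex_def)
  ultimately show ?thesis using chains_mono[OF b(1)] by (auto simp: fillings_def)
qed

lemma tame_cycles:
  fixes \<kappa> :: "'a::euclidean_space set \<Rightarrow> ennreal"
  assumes "\<And>x y \<sigma>. finite \<sigma> \<Longrightarrow> \<kappa> \<sigma> \<le> ennreal t \<Longrightarrow> x \<in> \<sigma> \<Longrightarrow> y \<in> \<sigma> \<Longrightarrow> dist x y \<le> R"
  shows "tame (Suc q) R (\<lambda>X. chain.dim (cycles q (filtration_complex \<kappa> X t) :: ('a list \<Rightarrow> 'f::field) set))"
proof -
  interpret chain_family "\<lambda>X. cycles q (filtration_complex \<kappa> X t) :: ('a list \<Rightarrow> 'f::field) set" "Suc q" R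
  proof
    have supp: "length vs = Suc q \<and> set vs \<subseteq> X \<and> \<kappa> (set vs) \<le> ennreal t"
      if "c \<in> cycles q (filtration_complex \<kappa> X t)" "c vs \<noteq> 0" for c :: "'a list \<Rightarrow> 'f" and X vs
      using that chains_support[of c q _ vs] by (auto simp: cycles_def filtration_complex_def)
    fix X Y :: "'a set"
    show "chain.subspace (cycles q (filtration_complex \<kappa> X t) :: ('a list \<Rightarrow> 'f) set)" if "finite X"
      using that by (rule cycles_subspace[OF _ filtration_complex_Pow])
    show "cycles q (filtration_complex \<kappa> X t) \<subseteq> (cycles q (filtration_complex \<kappa> Y t) :: ('a list \<Rightarrow> 'f) set)"
      if "X \<subseteq> Y"
      using that supp by (blast intro: cycles_restrict)
    fix c :: "'a list \<Rightarrow> 'f"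
    show "c \<in> cycles q (filtration_complex \<kappa> Y t)"
      if "c \<in> cycles q (filtration_complex \<kappa> X t)" "\<And>vs. c vs \<noteq> 0 \<Longrightarrow> set vs \<subseteq> Y"
      using that by (rule cycles_restrict)
    fix vs assume c: "c \<in> cycles q (filtration_complex \<kappa> X t)" "c vs \<noteq> 0"
    show "length vs = Suc q \<and> vs \<noteq> [] \<and> set vs \<subseteq> X" using supp[OF c] by auto
    fix x y assume "x \<in> set vs" "y \<in> set vs"
    then show "dist x y \<le> R" using assms[of "set vs" x y] supp[OF c] by simp
  qed
  show ?thesis by (rule tame_dim)
qed

text \<open>The chains consist of (q+1)-simplices of the complex at s; this fixes both the exponent
  q + 2 and the threshold that determines R.\<close>

lemma tame_fillings:
  fixes \<kappa> :: "'a::euclidean_space set \<Rightarrow> ennreal"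
  assumes "\<And>x y \<sigma>. finite \<sigma> \<Longrightarrow> \<kappa> \<sigma> \<le> ennreal s \<Longrightarrow> x \<in> \<sigma> \<Longrightarrow> y \<in> \<sigma> \<Longrightarrow> dist x y \<le> R"
  shows "tame (Suc (Suc q)) R (\<lambda>X. chain.dim (fillings q (filtration_complex \<kappa> X r)
    (filtration_complex \<kappa> X s) :: ('a list \<Rightarrow> 'f::field) set))"
proof -
  let ?V = "\<lambda>X. fillings q (filtration_complex \<kappa> X r) (filtration_complex \<kappa> X s) :: ('a list \<Rightarrow> 'f::field) set"
  interpret chain_family ?V "Suc (Suc q)" R
  proof
    have supp: "length vs = Suc (Suc q) \<and> set vs \<subseteq> X \<and> \<kappa> (set vs) \<le> ennreal s"
      if "c \<in> ?V X" "c vs \<noteq> 0" for c X vs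
      using that chains_support[of c "Suc q" _ vs] by (auto simp: fillings_def filtration_complex_def)
    fix X Y :: "'a set"
    show "chain.subspace (?V X)" if "finite X"
      using that by (rule fillings_subspace[OF _ filtration_complex_Pow filtration_complex_Pow])
    show "?V X \<subseteq> ?V Y" if "X \<subseteq> Y"
      using that supp by (blast intro: fillings_restrict)
    fix c :: "'a list \<Rightarrow> 'f"
    show "c \<in> ?V Y" if "c \<in> ?V X" "\<And>vs. c vs \<noteq> 0 \<Longrightarrow> set vs \<subseteq> Y"
      using that by (rule fillings_restrict)
    fix vs assume c: "c \<in> ?V X" "c vs \<noteq> 0"
    show "length vs = Suc (Suc q) \<and> vs \<noteq> [] \<and> set vs \<subseteq> X" using supp[OF c] by auto
    fix x y assume "x \<in> set vs" "y \<in> set vs"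
    then show "dist x y \<le> R" using assms[of "set vs" x y] supp[OF c] by simp
  qed
  show ?thesis by (rule tame_dim)
qed

section \<open>The void \<open>\<sigma>\<close>-algebra of configurations\<close>

text \<open>Finite sets carry neither order nor multiplicity: what can be observed of them is which
  Borel sets they avoid.\<close>

definition configurations :: "'a::topological_space set measure" where
  "configurations = sigma {X. finite X} ((\<lambda>B. {X. finite X \<and> X \<inter> B = {}}) ` sets borel)"

lemma space_configurations [simp]: "space configurations = {X. finite X}"
  unfolding configurations_def by (intro space_measure_of) auto

lemma sets_configurations:
  "sets configurations = sigma_sets {X. finite X} ((\<lambda>B. {X. finite X \<and> X \<inter> B = {}}) ` sets borel)"
  unfolding configurations_def by (intro sets_measure_of) auto

lemma void_in_sets: "B \<in> sets borel \<Longrightarrow> {X. finite X \<and> X \<inter> B = {}} \<in> sets configurations"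
  unfolding sets_configurations by auto

text \<open>Avoiding A and avoiding B is avoiding A \<union> B.\<close>

lemma Int_stable_void:
  "Int_stable ((\<lambda>B. {X. finite X \<and> X \<inter> B = {}}) ` sets (borel :: 'a::topological_space measure))"
proof (rule Int_stableI)
  fix a b
  assume "a \<in> (\<lambda>B. {X. finite X \<and> X \<inter> B = {}}) ` sets (borel :: 'a measure)"
    and "b \<in> (\<lambda>B. {X. finite X \<and> X \<inter> B = {}}) ` sets (borel :: 'a measure)"
  then obtain A B where AB: "A \<in> sets (borel :: 'a measure)" "B \<in> sets borel"
      "a = {X. finite X \<and> X \<inter> A = {}}" "b = {X. finite X \<and> X \<inter> B = {}}" by auto
  then have "a \<inter> b = {X. finite X \<and> X \<inter> (A \<union> B) = {}}" by auto
  then show "a \<inter> b \<in> (\<lambda>B. {X. finite X \<and> X \<inter> B = {}}) ` sets borel" using AB by auto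
qed

lemma measurable_configurationsI:
  fixes f :: "'w \<Rightarrow> 'a::topological_space set"
  assumes "\<And>\<omega>. \<omega> \<in> space M \<Longrightarrow> finite (f \<omega>)"
    and "\<And>B. B \<in> sets borel \<Longrightarrow> {\<omega> \<in> space M. f \<omega> \<inter> B = {}} \<in> sets M"
  shows "f \<in> M \<rightarrow>\<^sub>M configurations"
  unfolding configurations_def
proof (rule measurable_measure_of)
  fix A :: "'a set set" assume "A \<in> (\<lambda>B. {X. finite X \<and> X \<inter> B = {}}) ` sets borel"
  then obtain B where B: "B \<in> sets borel" "A = {X. finite X \<and> X \<inter> B = {}}" by auto
  have "f -` A \<inter> space M = {\<omega> \<in> space M. f \<omega> \<inter> B = {}}" using B assms(1) by auto
  then show "f -` A \<inter> space M \<in> sets M" using assms(2)[OF B(1)] by simp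
qed (use assms in auto)

lemma measurable_void:
  assumes "f \<in> M \<rightarrow>\<^sub>M configurations" "B \<in> sets borel"
  shows "{\<omega> \<in> space M. f \<omega> \<inter> B = {}} \<in> sets M"
proof -
  have "f -` {X. finite X \<and> X \<inter> B = {}} \<inter> space M \<in> sets M"
    using assms(2) by (intro measurable_sets[OF assms(1)] void_in_sets)
  also have "f -` {X. finite X \<and> X \<inter> B = {}} \<inter> space M = {\<omega> \<in> space M. f \<omega> \<inter> B = {}}"
    using measurable_space[OF assms(1)] by auto
  finally show ?thesis .
qed

lemma measurable_UN_configurations:
  assumes "finite I" "I \<subseteq> J"
  shows "(\<lambda>x. \<Union>i\<in>I. x i) \<in> PiM J (\<lambda>_. configurations) \<rightarrow>\<^sub>M configurations"
proof (rule measurable_configurationsI)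
  fix B :: "'b set" assume B: "B \<in> sets borel"
  let ?P = "PiM J (\<lambda>_. configurations) :: ('a \<Rightarrow> 'b set) measure"
  have "{x \<in> space ?P. x i \<inter> B = {}} \<in> sets ?P" if "i \<in> I" for i
    using that assms B by (intro measurable_void measurable_component_singleton) auto
  then have "{x \<in> space ?P. \<forall>i\<in>I. x i \<inter> B = {}} \<in> sets ?P"
    using assms by (intro sets.sets_Collect_finite_All) auto
  also have "{x \<in> space ?P. \<forall>i\<in>I. x i \<inter> B = {}} = {x \<in> space ?P. (\<Union>i\<in>I. x i) \<inter> B = {}}" by auto
  finally show "{x \<in> space ?P. (\<Union>i\<in>I. x i) \<inter> B = {}} \<in> sets ?P" .
qed (use assms in \<open>auto simp: space_PiM PiE_def Pi_def\<close>)

lemma measurable_translate_configurations: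
  fixes v :: "'a::euclidean_space"
  shows "(\<lambda>X. (\<lambda>x. x + v) ` X) \<in> configurations \<rightarrow>\<^sub>M configurations"
proof (rule measurable_configurationsI)
  fix B :: "'a set" assume B: "B \<in> sets borel"
  have "(\<lambda>x. x + v) -` B \<inter> space borel \<in> sets borel" using B by (intro measurable_sets) auto
  then have "{X. finite X \<and> X \<inter> (\<lambda>x. x + v) -` B = {}} \<in> sets configurations"
    by (intro void_in_sets) simp
  also have "{X. finite X \<and> X \<inter> (\<lambda>x. x + v) -` B = {}} =
      {X \<in> space configurations. ((\<lambda>x. x + v) ` X) \<inter> B = {}}" by auto
  finally show "{X \<in> space configurations. ((\<lambda>x. x + v) ` X) \<inter> B = {}} \<in> sets configurations" .
qed simp

section \<open>Dyadic cells as measurable labels of the points\<close>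

definition grid :: "real \<Rightarrow> real ^ 'n \<Rightarrow> 'n \<Rightarrow> int" where
  "grid c x = (\<lambda>a. \<lfloor>c * x $ a\<rfloor>)"

lemma grid_vimage_borel [measurable]: "{x :: real ^ 'n. grid c x \<in> Z} \<in> sets borel"
proof -
  have "{x :: real ^ 'n. grid c x = z} \<in> sets borel" for z :: "'n \<Rightarrow> int"
    unfolding grid_def fun_eq_iff by measurable
  then have "(\<Union>z\<in>Z. {x :: real ^ 'n. grid c x = z}) \<in> sets borel"
    by (intro sets.countable_UN') auto
  also have "(\<Union>z\<in>Z. {x :: real ^ 'n. grid c x = z}) = {x. grid c x \<in> Z}" by auto
  finally show ?thesis .
qed

text \<open>Points in a common cell of side 1 / 2^j differ by less than 1 / 2^j in each coordinate.
  The threshold j0 comes from a coordinate in which x and y differ.\<close>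

lemma eventually_grid_neq:
  fixes x y :: "real ^ 'n"
  assumes "x \<noteq> y"
  shows "eventually (\<lambda>j. grid (2 ^ j) x \<noteq> grid (2 ^ j) y) sequentially"
proof -
  obtain a where a: "x $ a \<noteq> y $ a" using assms by (auto simp: vec_eq_iff)
  obtain j0 :: nat where j0: "1 / \<bar>x $ a - y $ a\<bar> < 2 ^ j0" using real_arch_pow[of 2] by auto
  have "grid (2 ^ j) x \<noteq> grid (2 ^ j) y" if "j \<ge> j0" for j
  proof
    assume "grid (2 ^ j) x = grid (2 ^ j) y"
    then have "\<lfloor>2 ^ j * x $ a\<rfloor> = \<lfloor>2 ^ j * y $ a\<rfloor>" unfolding grid_def by (rule fun_cong)
    then have "\<bar>2 ^ j * x $ a - 2 ^ j * y $ a\<bar> < 1" by linarith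
    then have "2 ^ j * \<bar>x $ a - y $ a\<bar> < 1" by (simp add: abs_mult flip: right_diff_distrib)
    moreover have "(2::real) ^ j0 \<le> 2 ^ j" using that by simp
    then have "2 ^ j0 * \<bar>x $ a - y $ a\<bar> \<le> 2 ^ j * \<bar>x $ a - y $ a\<bar>" by (intro mult_right_mono) auto
    ultimately have "2 ^ j0 * \<bar>x $ a - y $ a\<bar> < 1" by linarith
    then show False using j0 a by (simp add: field_simps)
  qed
  then show ?thesis unfolding eventually_sequentially by blast
qed

lemma ex_inj_on_grid:
  assumes "finite (X :: (real ^ 'n) set)"
  shows "\<exists>j. inj_on (grid (2 ^ j)) X"
proof -
  have "eventually (\<lambda>j. \<forall>x\<in>X. \<forall>y\<in>X. x \<noteq> y \<longrightarrow> grid (2 ^ j) x \<noteq> grid (2 ^ j) y) sequentially"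
    using assms eventually_grid_neq by (intro eventually_ball_finite ballI) (auto elim: eventually_mono)
  then obtain j where "\<forall>x\<in>X. \<forall>y\<in>X. x \<noteq> y \<longrightarrow> grid (2 ^ j) x \<noteq> grid (2 ^ j) y"
    unfolding eventually_sequentially by blast
  then show ?thesis unfolding inj_on_def by blast
qed

text \<open>The countably many events \<open>isolated j S\<close> cover the configuration space, and on each of them the
  points are enumerated measurably by the grid cells they occupy.\<close>

definition isolated :: "nat \<Rightarrow> ('n \<Rightarrow> int) set \<Rightarrow> (real ^ 'n) set set" where
  "isolated j S = {X. finite X \<and> grid (2 ^ j) ` X = S \<and> inj_on (grid (2 ^ j)) X}"

text \<open>Injectivity must be expressed by hitting and avoiding fixed sets. Two distinct points of
  one level-j cell have different labels at some level i, so it is enough to exclude, for all z, i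
  and w \<noteq> w', that both parts of cell z with level-i labels w and w' are hit. These are
  countably many conditions.\<close>

lemma isolated_in_sets: "(isolated j S :: (real ^ 'n) set set) \<in> sets configurations"
proof -
  let ?c = "\<lambda>z i w. {x :: real ^ 'n. grid (2 ^ j) x \<in> {z} \<and> grid (2 ^ i) x \<in> {w}}"
  let ?hit = "\<lambda>B X. X \<inter> B \<noteq> {}"
  have hit: "{X \<in> space configurations. ?hit B X} \<in> sets configurations" if "B \<in> sets borel" for B :: "(real ^ 'n) set"
  proof -
    have "space configurations - {X. finite X \<and> X \<inter> B = {}} \<in> sets configurations"
      using that by (intro sets.compl_sets void_in_sets)
    also have "space configurations - {X. finite X \<and> X \<inter> B = {}} = {X \<in> space configurations. ?hit B X}" by auto
    finally show ?thesis .
  qed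
  have c: "?c z i w \<in> sets borel" for z i w
    using sets.Int[OF grid_vimage_borel[of "2 ^ j" "{z}"] grid_vimage_borel[of "2 ^ i" "{w}"]]
    by (simp add: Int_def)
  have 1: "{X \<in> space configurations. \<forall>z\<in>S. ?hit {x. grid (2 ^ j) x \<in> {z}} X} \<in> sets configurations"
    by (intro sets.sets_Collect_countable_Ball hit grid_vimage_borel)
  have 2: "{X. finite X \<and> X \<inter> {x. grid (2 ^ j) x \<in> - S} = {}} \<in> sets configurations"
    by (intro void_in_sets grid_vimage_borel)
  have 3: "{X \<in> space configurations. \<forall>z i w. \<forall>w'\<in>-{w}. \<not> (?hit (?c z i w) X \<and> ?hit (?c z i w') X)} \<in> sets configurations"
    by (intro sets.sets_Collect_countable_All sets.sets_Collect_countable_Ball sets.sets_Collect_neg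
        sets.sets_Collect_conj hit c)
  have "isolated j S = {X \<in> space configurations. \<forall>z\<in>S. ?hit {x. grid (2 ^ j) x \<in> {z}} X} \<inter>
     {X. finite X \<and> X \<inter> {x. grid (2 ^ j) x \<in> - S} = {}} \<inter>
     {X \<in> space configurations. \<forall>z i w. \<forall>w'\<in>-{w}. \<not> (?hit (?c z i w) X \<and> ?hit (?c z i w') X)}"
    (is "_ = ?A \<inter> ?B \<inter> ?C")
  proof (intro set_eqI iffI)
    fix X assume X: "X \<in> isolated j S"
    have "X \<in> ?A" "X \<in> ?B" using X by (auto simp: isolated_def)
    moreover have "X \<in> ?C"
    proof -
      have "False" if "x \<in> X \<inter> ?c z i w" "y \<in> X \<inter> ?c z i w'" "w' \<noteq> w" for x y z i w w'
      proof -
        have "x = y" using that X by (auto simp: isolated_def inj_on_def)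
        then show False using that by auto
      qed
      then have *: "\<not> (?hit (?c z i w) X \<and> ?hit (?c z i w') X)" if "w' \<in> - {w}" for z i w w'
        using that by blast
      have "X \<in> space configurations" using X by (simp add: isolated_def)
      then show ?thesis using * by (intro CollectI conjI allI ballI)
    qed
    ultimately show "X \<in> ?A \<inter> ?B \<inter> ?C" by blast
  next
    fix X assume X: "X \<in> ?A \<inter> ?B \<inter> ?C"
    have "inj_on (grid (2 ^ j)) X"
    proof (rule inj_onI, rule ccontr)
      fix x y assume *: "x \<in> X" "y \<in> X" "grid (2 ^ j) x = grid (2 ^ j) y" "x \<noteq> y"
      obtain i where i: "grid (2 ^ i) x \<noteq> grid (2 ^ i) y"
        using eventually_grid_neq[OF *(4)] unfolding eventually_sequentially by blast
      have "X \<inter> ?c (grid (2 ^ j) x) i (grid (2 ^ i) x) \<noteq> {}" "X \<inter> ?c (grid (2 ^ j) x) i (grid (2 ^ i) y) \<noteq> {}"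
        using * by auto
      then show False using X i by blast
    qed
    moreover have "grid (2 ^ j) ` X = S" using X by auto
    ultimately show "X \<in> isolated j S" using X by (auto simp: isolated_def)
  qed
  then show ?thesis using 1 2 3 by (simp only: sets.Int)
qed

lemma isolated_Int_finite [simp]: "isolated j S \<inter> {X. finite X} = isolated j S"
  by (auto simp: isolated_def)

lemma isolated_bij:
  assumes "X \<in> isolated j S"
  shows "bij_betw (grid (2 ^ j)) X S"
  using assms by (auto simp: isolated_def bij_betw_def)

text \<open>The point in cell z belongs to A exactly when the configuration hits A within that cell,
  which is the complement of a void event.\<close>

lemma measurable_isolated_point:
  fixes S :: "('n::finite \<Rightarrow> int) set"
  assumes z: "z \<in> S"
  shows "(\<lambda>X. inv_into X (grid (2 ^ j)) z) \<in> borel_measurable (restrict_space configurations (isolated j S))"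
proof (rule measurableI)
  fix A :: "(real ^ 'n) set" assume A: "A \<in> sets borel"
  let ?e = "\<lambda>X. inv_into X (grid (2 ^ j)) z" and ?B = "A \<inter> {x. grid (2 ^ j) x \<in> {z}}"
  have sp: "space (restrict_space configurations (isolated j S)) = isolated j S"
    by (auto simp: space_restrict_space isolated_def)
  have "?e -` A \<inter> isolated j S = isolated j S - {X. finite X \<and> X \<inter> ?B = {}}"
  proof (intro set_eqI iffI)
    fix X assume X: "X \<in> ?e -` A \<inter> isolated j S"
    have "z \<in> grid (2 ^ j) ` X" using X z by (auto simp: isolated_def)
    then have "?e X \<in> X" "grid (2 ^ j) (?e X) = z" by (auto intro: inv_into_into f_inv_into_f)
    then show "X \<in> isolated j S - {X. finite X \<and> X \<inter> ?B = {}}" using X by auto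
  next
    fix X assume X: "X \<in> isolated j S - {X. finite X \<and> X \<inter> ?B = {}}"
    then obtain x where x: "x \<in> X" "x \<in> A" "grid (2 ^ j) x = z" by (auto simp: isolated_def)
    then have "?e X = x" using X by (auto simp: isolated_def)
    then show "X \<in> ?e -` A \<inter> isolated j S" using X x by auto
  qed
  moreover have "isolated j S - {X. finite X \<and> X \<inter> ?B = {}} \<in> sets configurations"
    using A by (intro sets.Diff isolated_in_sets void_in_sets sets.Int grid_vimage_borel)
  ultimately show "?e -` A \<inter> space (restrict_space configurations (isolated j S))
      \<in> sets (restrict_space configurations (isolated j S))"
    unfolding sp by (subst sets_restrict_space_iff) (auto simp: isolated_in_sets)
qed auto

text \<open>An enumeration of T turns the points in these cells into a measurable tuple, to which
  the measurable representative \<open>g\<close> of \<kappa> on k-tuples applies.\<close>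

lemma isolated_pattern_in_sets:
  fixes \<kappa> :: "(real ^ 'n) set \<Rightarrow> ennreal"
  assumes \<kappa>: "measurable_on_finite_sets \<kappa>" and T: "T \<subseteq> S" "T \<noteq> {}" "finite T"
  shows "{X \<in> isolated j S. \<kappa> (inv_into X (grid (2 ^ j)) ` T) \<le> ennreal t} \<in> sets configurations"
proof -
  define k where "k = card T"
  have "k \<ge> 1" using T by (simp add: k_def Suc_le_eq card_gt_0_iff)
  then obtain g where g: "g \<in> borel_measurable (PiM {..<k} (\<lambda>_. borel :: (real ^ 'n) measure))"
    and \<kappa>g: "\<And>x. x \<in> space (PiM {..<k} (\<lambda>_. borel)) \<Longrightarrow> \<kappa> (x ` {..<k}) = g x"
    using \<kappa> unfolding measurable_on_finite_sets_def by blast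
  obtain h where h: "bij_betw h {..<k} T"
    using ex_bij_betw_nat_finite[OF T(3)] by (auto simp: k_def atLeast0LessThan)
  let ?R = "restrict_space configurations (isolated j S)"
  let ?x = "\<lambda>X. \<lambda>i\<in>{..<k}. inv_into X (grid (2 ^ j)) (h i)"
  have sp: "space ?R = isolated j S" by (auto simp: space_restrict_space isolated_def)
  have x: "?x \<in> ?R \<rightarrow>\<^sub>M PiM {..<k} (\<lambda>_. borel)"
    using h T by (intro measurable_restrict measurable_isolated_point) (auto simp: bij_betw_def)
  have "?x X ` {..<k} = inv_into X (grid (2 ^ j)) ` T" for X
    using h by (auto simp: bij_betw_def image_image[symmetric])
  then have eq: "\<kappa> (inv_into X (grid (2 ^ j)) ` T) = g (?x X)" for X
    using \<kappa>g[of "?x X"] by (simp add: space_PiM)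
  have "{X \<in> space ?R. g (?x X) \<le> ennreal t} \<in> sets ?R"
    using measurable_compose[OF x g] by measurable
  then show ?thesis unfolding sp eq
    by (subst (asm) sets_restrict_space_iff) (auto simp: isolated_in_sets)
qed

text \<open>On \<open>isolated j S\<close> the value of f is determined by finite data: which sets
  of cell labels have \<kappa> at most r, and which at most s. Every level set of f is therefore a
  countable union of pattern events.\<close>

lemma pattern_invariant_measurable:
  fixes \<kappa> :: "(real ^ 'n) set \<Rightarrow> ennreal"
  assumes \<kappa>: "measurable_on_finite_sets \<kappa>" and f: "pattern_invariant \<kappa> r s f"
  shows "f \<in> configurations \<rightarrow>\<^sub>M count_space UNIV"
proof -
  define E where "E = (\<lambda>j X. inv_into X (grid (2 ^ j)) :: ('n \<Rightarrow> int) \<Rightarrow> real ^ 'n)"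
  define pat where "pat j S t X = {T \<in> Pow S - {{}}. \<kappa> (E j X ` T) \<le> ennreal t}" for j S t X
  have pat_sets: "{X \<in> isolated j S. pat j S t X = P} \<in> sets configurations"
    if S: "finite S" and P: "P \<subseteq> Pow S - {{}}" for j S t P
  proof -
    have "{X \<in> isolated j S. pat j S t X = P} = isolated j S \<inter>
        {X \<in> space configurations. \<forall>T\<in>Pow S - {{}}. X \<in> {X \<in> isolated j S. \<kappa> (E j X ` T) \<le> ennreal t} \<longleftrightarrow> T \<in> P}"
      using P by (auto simp: pat_def isolated_def)
    also have "\<dots> \<in> sets configurations"
    proof (intro sets.Int isolated_in_sets sets.sets_Collect_finite_All)
      fix T assume T: "T \<in> Pow S - {{}}"
      let ?A = "{X \<in> isolated j S. \<kappa> (E j X ` T) \<le> ennreal t}"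
      have A: "?A \<in> sets configurations"
        unfolding E_def using T S by (intro isolated_pattern_in_sets[OF \<kappa>]) (auto intro: finite_subset)
      have "{X \<in> space configurations. (X \<in> ?A) = (T \<in> P)} = (if T \<in> P then ?A else space configurations - ?A)"
        by (auto simp: isolated_def)
      moreover have "(if T \<in> P then ?A else space configurations - ?A) \<in> sets configurations"
        using A sets.compl_sets[OF A] by (simp del: space_configurations)
      ultimately show "{X \<in> space configurations. (X \<in> ?A) = (T \<in> P)} \<in> sets configurations" by (simp only:)
    qed (use S in auto)
    finally show ?thesis .
  qed
  have f_eq: "f X = f Y" if X: "X \<in> isolated j S" and Y: "Y \<in> isolated j S"
    and p: "pat j S r X = pat j S r Y" "pat j S s X = pat j S s Y" for j S X Y
  proof -
    have bX: "bij_betw (E j X) S X" unfolding E_def by (rule bij_betw_inv_into[OF isolated_bij[OF X]])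
    have bY: "bij_betw (grid (2 ^ j)) Y S" by (rule isolated_bij[OF Y])
    \<comment> \<open>Matches the points of Y and X that occupy the same cell.\<close>
    have b: "bij_betw (E j X \<circ> grid (2 ^ j)) Y X" using bY bX by (rule bij_betw_trans)
    have "\<kappa> ((E j X \<circ> grid (2 ^ j)) ` \<sigma>) \<le> ennreal t \<longleftrightarrow> \<kappa> \<sigma> \<le> ennreal t"
      if t: "pat j S t X = pat j S t Y" and \<sigma>: "\<sigma> \<subseteq> Y" "\<sigma> \<noteq> {}" for t \<sigma>
    proof -
      let ?T = "grid (2 ^ j) ` \<sigma>"
      have "E j Y ` ?T = \<sigma>" unfolding E_def using \<sigma> bY by (auto simp: bij_betw_def inv_into_image_cancel)
      moreover have "?T \<in> Pow S - {{}}" using \<sigma> bY by (auto simp: bij_betw_def)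
      moreover have "?T \<in> pat j S t X \<longleftrightarrow> ?T \<in> pat j S t Y" using t by simp
      ultimately show ?thesis by (simp add: pat_def image_comp)
    qed
    then show ?thesis using f b p X Y unfolding pattern_invariant_def by (simp add: isolated_def)
  qed
  have level: "{X \<in> isolated j S. f X = m} \<in> sets configurations" if S: "finite S" for j S m
  proof -
    \<comment> \<open>The pairs of patterns that occur with value m; finitely many, since S is
      finite.\<close>
    let ?G = "{(P, Q). \<exists>X\<in>isolated j S. f X = m \<and> pat j S r X = P \<and> pat j S s X = Q}"
    have G: "?G \<subseteq> Pow (Pow S - {{}}) \<times> Pow (Pow S - {{}})" by (auto simp: pat_def)
    then have "finite ?G" by (rule finite_subset) (use S in auto)
    have "{X \<in> isolated j S. f X = m} =
        (\<Union>PQ\<in>?G. {X \<in> isolated j S. pat j S r X = fst PQ} \<inter> {X \<in> isolated j S. pat j S s X = snd PQ})"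
    proof (intro set_eqI iffI)
      fix X assume X: "X \<in> {X \<in> isolated j S. f X = m}"
      then have "(pat j S r X, pat j S s X) \<in> ?G" by blast
      then show "X \<in> (\<Union>PQ\<in>?G. {X \<in> isolated j S. pat j S r X = fst PQ} \<inter>
          {X \<in> isolated j S. pat j S s X = snd PQ})"
        using X by (intro UN_I) auto
    next
      fix X assume "X \<in> (\<Union>PQ\<in>?G. {X \<in> isolated j S. pat j S r X = fst PQ} \<inter>
          {X \<in> isolated j S. pat j S s X = snd PQ})"
      then obtain Y where "X \<in> isolated j S" "Y \<in> isolated j S" "f Y = m"
          "pat j S r X = pat j S r Y" "pat j S s X = pat j S s Y"
        by auto
      then show "X \<in> {X \<in> isolated j S. f X = m}" using f_eq[of X j S Y] by simp
    qed
    also have "\<dots> \<in> sets configurations"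
      using S G \<open>finite ?G\<close> by (intro sets.finite_UN sets.Int pat_sets) (auto simp: pat_def)
    finally show ?thesis .
  qed
  show ?thesis
    unfolding measurable_count_space_eq2_countable
  proof (intro conjI ballI)
    fix m
    have "f -` {m} \<inter> space configurations = (\<Union>j. \<Union>S\<in>{S. finite S}. {X \<in> isolated j S. f X = m})"
    proof (intro set_eqI iffI)
      fix X assume X: "X \<in> f -` {m} \<inter> space configurations"
      then obtain j where "inj_on (grid (2 ^ j)) X" using ex_inj_on_grid by auto
      then have "X \<in> isolated j (grid (2 ^ j) ` X)" using X by (simp add: isolated_def)
      then show "X \<in> (\<Union>j. \<Union>S\<in>{S. finite S}. {X \<in> isolated j S. f X = m})"
        using X by (intro UN_I[of j] UN_I[of "grid (2 ^ j) ` X"]) auto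
    qed (auto simp: isolated_def)
    also have "\<dots> \<in> sets configurations"
    proof -
      have "(\<Union>S\<in>{S. finite S}. {X \<in> isolated j S. f X = m}) \<in> sets configurations" for j
        using level by (intro sets.countable_UN'' countable_Collect_finite) auto
      then show ?thesis by (intro sets.countable_nat_UN) auto
    qed
    finally show "f -` {m} \<inter> space configurations \<in> sets configurations" .
  qed auto
qed

section \<open>The Efron-Stein inequality\<close>

lemma integrable_of_square:
  fixes f :: "'a \<Rightarrow> real"
  assumes "prob_space M" "f \<in> borel_measurable M" "integrable M (\<lambda>x. (f x)\<^sup>2)"
  shows "integrable M f"
proof -
  interpret prob_space M by (rule assms(1))
  show ?thesis by (rule square_integrable_imp_integrable[OF assms(2,3)])
qed

lemma (in prob_space) expectation_square_le:
  fixes X :: "'a \<Rightarrow> real"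
  assumes "random_variable borel X" "integrable M (\<lambda>x. (X x)\<^sup>2)"
  shows "(expectation X)\<^sup>2 \<le> expectation (\<lambda>x. (X x)\<^sup>2)"
proof -
  have "integrable M X" using integrable_of_square[OF prob_space_axioms assms] .
  then show ?thesis using variance_eq[of X] variance_positive[of X] assms by simp
qed

lemma integrable_square_diff:
  fixes f g :: "'a \<Rightarrow> real"
  assumes "f \<in> borel_measurable M" "g \<in> borel_measurable M"
    "integrable M (\<lambda>x. (f x)\<^sup>2)" "integrable M (\<lambda>x. (g x)\<^sup>2)"
  shows "integrable M (\<lambda>x. (f x - g x)\<^sup>2)"
proof (rule Bochner_Integration.integrable_bound)
  show "integrable M (\<lambda>x. 2 * (f x)\<^sup>2 + 2 * (g x)\<^sup>2)" using assms by simp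
  have "(a - b)\<^sup>2 \<le> 2 * a\<^sup>2 + 2 * b\<^sup>2" for a b :: real
    using zero_le_power2[of "a + b"] unfolding power2_diff power2_sum by linarith
  then show "AE x in M. norm ((f x - g x)\<^sup>2) \<le> norm (2 * (f x)\<^sup>2 + 2 * (g x)\<^sup>2)"
    by (intro always_eventually) (smt (verit) real_norm_def zero_le_power2)
qed (use assms in measurable)

text \<open>Variance decomposition by conditioning on the first coordinate y: the conditional
  variances are bounded by g, and the variance of the conditional mean m by its second moment about
  m c. The section at c has its own integrability hypothesis, since c may be a null point, out of
  reach of almost-sure statements.\<close>

lemma efron_stein_pair:
  fixes h :: "'a \<times> 'b \<Rightarrow> real"
  assumes Q: "prob_space Q" and P: "prob_space P"
    and h [measurable]: "h \<in> borel_measurable (Q \<Otimes>\<^sub>M P)" and c: "c \<in> space Q"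
    and h2: "integrable (Q \<Otimes>\<^sub>M P) (\<lambda>z. (h z)\<^sup>2)"
    and hc: "integrable P (\<lambda>x. (h (c, x))\<^sup>2)"
    and g: "integrable Q g" "AE y in Q. (\<integral>x. (h (y, x))\<^sup>2 \<partial>P) - (\<integral>x. h (y, x) \<partial>P)\<^sup>2 \<le> g y"
    and hd: "integrable (Q \<Otimes>\<^sub>M P) (\<lambda>z. (h z - h (c, snd z))\<^sup>2)"
  shows "(\<integral>z. (h z)\<^sup>2 \<partial>(Q \<Otimes>\<^sub>M P)) - (\<integral>z. h z \<partial>(Q \<Otimes>\<^sub>M P))\<^sup>2
    \<le> (\<integral>y. g y \<partial>Q) + (\<integral>z. (h z - h (c, snd z))\<^sup>2 \<partial>(Q \<Otimes>\<^sub>M P))"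
proof -
  interpret Q: prob_space Q by (rule Q)
  interpret P: prob_space P by (rule P)
  interpret QP: pair_prob_space Q P ..
  define m where "m y = (\<integral>x. h (y, x) \<partial>P)" for y
  define s where "s y = (\<integral>x. (h (y, x))\<^sup>2 \<partial>P)" for y
  define d where "d y = (\<integral>x. (h (y, x) - h (c, x))\<^sup>2 \<partial>P)" for y
  have [measurable]: "m \<in> borel_measurable Q" "(\<lambda>x. h (c, x)) \<in> borel_measurable P"
    unfolding m_def using c by measurable
  have hi: "integrable (Q \<Otimes>\<^sub>M P) h"
    by (rule integrable_of_square[OF _ h h2]) (rule QP.prob_space_axioms)
  have s: "integrable Q s" "(\<integral>y. s y \<partial>Q) = (\<integral>z. (h z)\<^sup>2 \<partial>(Q \<Otimes>\<^sub>M P))"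
    unfolding s_def using QP.integrable_fst'[OF h2] QP.integral_fst'[OF h2] by auto
  have m: "integrable Q m" "(\<integral>y. m y \<partial>Q) = (\<integral>z. h z \<partial>(Q \<Otimes>\<^sub>M P))"
    unfolding m_def using QP.integrable_fst'[OF hi] QP.integral_fst'[OF hi] by auto
  have d: "integrable Q d" "(\<integral>y. d y \<partial>Q) = (\<integral>z. (h z - h (c, snd z))\<^sup>2 \<partial>(Q \<Otimes>\<^sub>M P))"
    unfolding d_def using QP.integrable_fst'[OF hd] QP.integral_fst'[OF hd] by auto
  have AEh: "AE y in Q. integrable P (\<lambda>x. (h (y, x))\<^sup>2)" by (rule QP.AE_integrable_fst'[OF h2])
  have AEd: "AE y in Q. integrable P (\<lambda>x. (h (y, x) - h (c, x))\<^sup>2)"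
    using QP.AE_integrable_fst'[OF hd] by simp
  have ms: "AE y in Q. (m y)\<^sup>2 \<le> s y"
    using AEh AE_space
  proof eventually_elim
    case (elim y)
    then show ?case unfolding m_def s_def by (intro P.expectation_square_le) measurable
  qed
  have m2: "integrable Q (\<lambda>y. (m y)\<^sup>2)"
  proof (rule Bochner_Integration.integrable_bound[OF s(1)])
    show "AE y in Q. norm ((m y)\<^sup>2) \<le> norm (s y)" using ms by eventually_elim auto
  qed measurable
  have md: "AE y in Q. (m y - m c)\<^sup>2 \<le> d y"
    using AEh AEd AE_space
  proof eventually_elim
    case (elim y)
    then have [measurable]: "(\<lambda>x. h (y, x)) \<in> borel_measurable P" by measurable
    have "integrable P (\<lambda>x. h (y, x))" "integrable P (\<lambda>x. h (c, x))"
      using elim hc by (auto intro!: integrable_of_square[OF P])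
    then have "m y - m c = (\<integral>x. h (y, x) - h (c, x) \<partial>P)" by (simp add: m_def)
    then show ?case unfolding d_def using elim by (simp only:) (intro P.expectation_square_le; measurable)
  qed
  \<comment> \<open>The two sides differ by the square of the mean of m minus m c.\<close>
  have "(\<integral>y. (m y)\<^sup>2 \<partial>Q) - (\<integral>y. m y \<partial>Q)\<^sup>2 \<le> (\<integral>y. (m y)\<^sup>2 \<partial>Q) - 2 * m c * (\<integral>y. m y \<partial>Q) + (m c)\<^sup>2"
    using zero_le_power2[of "(\<integral>y. m y \<partial>Q) - m c"] unfolding power2_diff
    by (simp add: algebra_simps)
  also have "\<dots> = (\<integral>y. (m y - m c)\<^sup>2 \<partial>Q)"
    using m m2 by (simp add: power2_diff Q.prob_space algebra_simps)
  also have "\<dots> \<le> (\<integral>y. d y \<partial>Q)"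
    using md m m2 d by (intro integral_mono_AE) (auto intro!: integrable_square_diff)
  finally have 1: "(\<integral>y. (m y)\<^sup>2 \<partial>Q) - (\<integral>y. m y \<partial>Q)\<^sup>2 \<le> (\<integral>y. d y \<partial>Q)" .
  have "(\<integral>y. s y \<partial>Q) - (\<integral>y. (m y)\<^sup>2 \<partial>Q) = (\<integral>y. s y - (m y)\<^sup>2 \<partial>Q)" using s m2 by simp
  also have "\<dots> \<le> (\<integral>y. g y \<partial>Q)"
    using g by (intro integral_mono_AE Bochner_Integration.integrable_diff s m2) (auto simp: s_def m_def)
  finally show ?thesis using 1 s m d by simp
qed

lemma measurable_fun_upd_const:
  assumes "j \<in> I" "c \<in> space (N j)"
  shows "(\<lambda>x. x(j := c)) \<in> PiM I N \<rightarrow>\<^sub>M PiM I N"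
  using assms by (intro measurable_fun_upd[where J=I] measurable_ident measurable_const) auto

text \<open>Induction on the coordinates: \<open>efron_stein_pair\<close> splits off coordinate i,
  and the induction hypothesis is applied to the sections x \<mapsto> f (x(i := y)). A fixed
  reference value c i takes the place of an independent copy, so the factor 1/2 of the resampling
  form is absent.\<close>

lemma efron_stein_PiM:
  fixes f :: "('i \<Rightarrow> 'b) \<Rightarrow> real"
  assumes "finite I" "\<And>i. i \<in> I \<Longrightarrow> prob_space (N i)" "\<And>i. i \<in> I \<Longrightarrow> c i \<in> space (N i)"
    "f \<in> borel_measurable (PiM I N)" "integrable (PiM I N) (\<lambda>x. (f x)\<^sup>2)"
    "\<And>i. i \<in> I \<Longrightarrow> integrable (PiM I N) (\<lambda>x. (f (x(i := c i)))\<^sup>2)"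
  shows "(\<integral>x. (f x)\<^sup>2 \<partial>PiM I N) - (\<integral>x. f x \<partial>PiM I N)\<^sup>2
    \<le> (\<Sum>i\<in>I. \<integral>x. (f x - f (x(i := c i)))\<^sup>2 \<partial>PiM I N)"
  using assms
proof (induction I arbitrary: f rule: finite_induct)
  case empty
  then show ?case by (simp add: PiM_empty lebesgue_integral_count_space_finite)
next
  case (insert i I)
  define P where "P = PiM I N"
  define R where "R = PiM (insert i I) N"
  define \<phi> :: "'b \<times> ('i \<Rightarrow> 'b) \<Rightarrow> 'i \<Rightarrow> 'b" where "\<phi> = (\<lambda>(y, x). x(i := y))"
  have Q: "prob_space (N i)" and P: "prob_space P" and R: "prob_space R"
    unfolding P_def R_def using insert.prems(1) by (auto intro!: prob_space_PiM)
  interpret Q: prob_space "N i" by (rule Q)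
  interpret P: prob_space P by (rule P)
  interpret R: prob_space R by (rule R)
  interpret QP: pair_prob_space "N i" P ..
  have f [measurable]: "f \<in> borel_measurable R" using insert.prems by (simp add: R_def)
  have \<phi> [measurable]: "\<phi> \<in> N i \<Otimes>\<^sub>M P \<rightarrow>\<^sub>M R"
    unfolding \<phi>_def P_def R_def by measurable
  have dist: "distr (N i \<Otimes>\<^sub>M P) R \<phi> = R"
    unfolding \<phi>_def P_def R_def using insert.prems(1) by (intro distr_pair_PiM_eq_PiM) auto
  have upd: "(\<lambda>x. x(j := c j)) \<in> R \<rightarrow>\<^sub>M R" if "j \<in> insert i I" for j
    unfolding R_def using insert.prems(2)[OF that] that by (intro measurable_fun_upd_const)
  have upd_f: "(\<lambda>x. f (x(j := c j))) \<in> borel_measurable R" if "j \<in> insert i I" for j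
    using measurable_compose[OF upd[OF that] f] .
  have int_eq: "integrable R u \<longleftrightarrow> integrable (N i \<Otimes>\<^sub>M P) (\<lambda>z. u (\<phi> z))"
    if "u \<in> borel_measurable R" for u :: "_ \<Rightarrow> real"
    using integrable_distr_eq[OF \<phi> that] dist by simp
  have integral_eq: "(\<integral>x. u x \<partial>R) = (\<integral>z. u (\<phi> z) \<partial>(N i \<Otimes>\<^sub>M P))"
    if "u \<in> borel_measurable R" for u :: "_ \<Rightarrow> real"
    using integral_distr[OF \<phi> that] dist by simp
  define h where "h z = f (\<phi> z)" for z
  have h [measurable]: "h \<in> borel_measurable (N i \<Otimes>\<^sub>M P)" unfolding h_def by measurable
  have h2: "integrable (N i \<Otimes>\<^sub>M P) (\<lambda>z. (h z)\<^sup>2)"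
    unfolding h_def using insert.prems(4) by (subst int_eq[symmetric]) (auto simp: R_def[symmetric])
  have updI: "integrable (N i \<Otimes>\<^sub>M P) (\<lambda>z. (f ((\<phi> z)(j := c j)))\<^sup>2)" if "j \<in> insert i I" for j
    using insert.prems(5)[OF that] unfolding R_def[symmetric]
    by (rule int_eq[THEN iffD1, OF borel_measurable_power[OF upd_f[OF that]]])
  have diffI: "integrable (N i \<Otimes>\<^sub>M P) (\<lambda>z. (f (\<phi> z) - f ((\<phi> z)(j := c j)))\<^sup>2)" if "j \<in> insert i I" for j
    by (intro integrable_square_diff h[unfolded h_def] h2[unfolded h_def] updI[OF that]
        measurable_compose[OF \<phi> upd_f[OF that]])
  have ci: "(\<phi> z)(i := c i) = \<phi> (c i, snd z)" for z by (simp add: \<phi>_def split: prod.split)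
  \<comment> \<open>After the update at i the integrand is constant in the first coordinate, so the
    almost-sure statement about its sections is the statement itself.\<close>
  have hc: "integrable P (\<lambda>x. (h (c i, x))\<^sup>2)"
    using QP.AE_integrable_fst'[OF updI[of i]] by (simp add: ci h_def Q.AE_const)
  have hd: "integrable (N i \<Otimes>\<^sub>M P) (\<lambda>z. (h z - h (c i, snd z))\<^sup>2)"
    using diffI[of i] by (simp add: h_def ci)
  define g where "g y = (\<Sum>j\<in>I. \<integral>x. (f (\<phi> (y, x)) - f ((\<phi> (y, x))(j := c j)))\<^sup>2 \<partial>P)" for y
  have g: "integrable (N i) g"
    unfolding g_def using QP.integrable_fst'[OF diffI] by (intro Bochner_Integration.integrable_sum) auto
  have g': "(\<integral>y. g y \<partial>N i) = (\<Sum>j\<in>I. \<integral>x. (f x - f (x(j := c j)))\<^sup>2 \<partial>R)"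
  proof -
    have "(\<integral>y. \<integral>x. (f (\<phi> (y, x)) - f ((\<phi> (y, x))(j := c j)))\<^sup>2 \<partial>P \<partial>N i) =
        (\<integral>x. (f x - f (x(j := c j)))\<^sup>2 \<partial>R)" if "j \<in> I" for j
      using QP.integral_fst'[OF diffI[of j]] upd_f[of j] that by (simp add: integral_eq)
    moreover have "integrable (N i) (\<lambda>y. \<integral>x. (f (\<phi> (y, x)) - f ((\<phi> (y, x))(j := c j)))\<^sup>2 \<partial>P)"
      if "j \<in> I" for j
      using QP.integrable_fst'[OF diffI[of j]] that by simp
    ultimately show ?thesis
      unfolding g_def by (subst Bochner_Integration.integral_sum) (blast, rule sum.cong[OF refl], blast)
  qed
  \<comment> \<open>The induction hypothesis asks for all these sections at once; finitely many null
    sets of y are discarded.\<close>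
  have "AE y in N i. \<forall>j\<in>I. integrable P (\<lambda>x. (f ((\<phi> (y, x))(j := c j)))\<^sup>2)"
    using QP.AE_integrable_fst'[OF updI] insert.hyps by (intro AE_finite_allI) auto
  then have AEg: "AE y in N i. (\<integral>x. (h (y, x))\<^sup>2 \<partial>P) - (\<integral>x. h (y, x) \<partial>P)\<^sup>2 \<le> g y"
    using QP.AE_integrable_fst'[OF h2] AE_space
  proof eventually_elim
    case (elim y)
    have swap: "(x(j := c j))(i := y) = (x(i := y))(j := c j)" if "j \<in> I" for j x
      using insert.hyps that by (auto simp: fun_upd_twist)
    have "(\<integral>x. (f (x(i := y)))\<^sup>2 \<partial>PiM I N) - (\<integral>x. f (x(i := y)) \<partial>PiM I N)\<^sup>2
      \<le> (\<Sum>j\<in>I. \<integral>x. (f (x(i := y)) - f ((x(j := c j))(i := y)))\<^sup>2 \<partial>PiM I N)"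
    proof (rule insert.IH)
      have "(\<lambda>x. h (y, x)) \<in> borel_measurable P" using elim by measurable
      then show "(\<lambda>x. f (x(i := y))) \<in> borel_measurable (PiM I N)"
        by (simp add: h_def \<phi>_def P_def)
      show "integrable (PiM I N) (\<lambda>x. (f (x(i := y)))\<^sup>2)"
        using elim by (simp add: h_def \<phi>_def P_def)
      show "integrable (PiM I N) (\<lambda>x. (f ((x(j := c j))(i := y)))\<^sup>2)" if "j \<in> I" for j
        using elim that by (simp add: \<phi>_def P_def swap)
    qed (use insert.prems in auto)
    also have "\<dots> = g y"
      unfolding g_def \<phi>_def P_def by (intro sum.cong refl) (simp add: swap)
    finally show ?case by (simp add: h_def \<phi>_def P_def)
  qed
  have "(\<integral>x. (f x)\<^sup>2 \<partial>R) - (\<integral>x. f x \<partial>R)\<^sup>2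
     = (\<integral>z. (h z)\<^sup>2 \<partial>(N i \<Otimes>\<^sub>M P)) - (\<integral>z. h z \<partial>(N i \<Otimes>\<^sub>M P))\<^sup>2"
    unfolding h_def by (simp add: integral_eq)
  also have "\<dots> \<le> (\<integral>y. g y \<partial>N i) + (\<integral>z. (h z - h (c i, snd z))\<^sup>2 \<partial>(N i \<Otimes>\<^sub>M P))"
    using insert.prems(2)[of i] by (intro efron_stein_pair Q P h h2 hc g AEg hd) auto
  also have "(\<integral>z. (h z - h (c i, snd z))\<^sup>2 \<partial>(N i \<Otimes>\<^sub>M P)) = (\<integral>x. (f x - f (x(i := c i)))\<^sup>2 \<partial>R)"
    using upd_f[of i] by (subst integral_eq) (auto simp: h_def ci)
  finally show ?case unfolding g' R_def sum.insert[OF insert.hyps] by (simp only: add.commute)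
qed

text \<open>Independence identifies the joint law with the product of the marginal laws
  \<open>N'\<close>, along which the product form is pulled back.\<close>

lemma (in prob_space) efron_stein:
  fixes f :: "('i \<Rightarrow> 'b) \<Rightarrow> real"
  assumes I: "finite I" "I \<noteq> {}" and ind: "indep_vars N \<xi> I" and c: "\<And>i. i \<in> I \<Longrightarrow> c i \<in> space (N i)"
    and f: "f \<in> borel_measurable (PiM I N)"
    and f2: "integrable M (\<lambda>\<omega>. (f (\<lambda>i\<in>I. \<xi> i \<omega>))\<^sup>2)"
    and fc: "\<And>i. i \<in> I \<Longrightarrow> integrable M (\<lambda>\<omega>. (f ((\<lambda>i\<in>I. \<xi> i \<omega>)(i := c i)))\<^sup>2)"
  shows "variance (\<lambda>\<omega>. f (\<lambda>i\<in>I. \<xi> i \<omega>))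
    \<le> (\<Sum>i\<in>I. expectation (\<lambda>\<omega>. (f (\<lambda>i\<in>I. \<xi> i \<omega>) - f ((\<lambda>i\<in>I. \<xi> i \<omega>)(i := c i)))\<^sup>2))"
proof -
  define N' where "N' i = distr M (N i) (\<xi> i)" for i
  have rv: "\<xi> i \<in> M \<rightarrow>\<^sub>M N i" if "i \<in> I" for i using ind that by (auto simp: indep_vars_def)
  let ?X = "\<lambda>\<omega>. \<lambda>i\<in>I. \<xi> i \<omega>"
  have X: "?X \<in> M \<rightarrow>\<^sub>M PiM I N" using rv by (intro measurable_restrict) auto
  have sets: "sets (PiM I N') = sets (PiM I N)" by (intro sets_PiM_cong) (auto simp: N'_def)
  have f' [measurable]: "f \<in> borel_measurable (PiM I N')"
    using f by (simp add: measurable_cong_sets[OF sets refl])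
  have X': "?X \<in> M \<rightarrow>\<^sub>M PiM I N'" using X by (simp add: measurable_cong_sets[OF refl sets])
  have dist: "distr M (PiM I N') ?X = PiM I N'"
  proof -
    have "distr M (PiM I N') ?X = distr M (PiM I N) ?X" by (rule distr_cong[OF refl sets refl])
    also have "\<dots> = PiM I N'"
      unfolding N'_def by (rule indep_vars_iff_distr_eq_PiM'[OF I(2) rv, THEN iffD1, OF _ ind])
    finally show ?thesis .
  qed
  have upd: "(\<lambda>x. x(j := c j)) \<in> PiM I N' \<rightarrow>\<^sub>M PiM I N'" if "j \<in> I" for j
    using c[OF that] that by (intro measurable_fun_upd_const) (auto simp: N'_def)
  have upd_f: "(\<lambda>x. f (x(j := c j))) \<in> borel_measurable (PiM I N')" if "j \<in> I" for j
    using measurable_compose[OF upd[OF that] f'] .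
  have int_eq: "integrable (PiM I N') u \<longleftrightarrow> integrable M (\<lambda>\<omega>. u (?X \<omega>))"
    if "u \<in> borel_measurable (PiM I N')" for u :: "_ \<Rightarrow> real"
    using integrable_distr_eq[OF X' that] dist by simp
  have integral_eq: "(\<integral>x. u x \<partial>PiM I N') = expectation (\<lambda>\<omega>. u (?X \<omega>))"
    if "u \<in> borel_measurable (PiM I N')" for u :: "_ \<Rightarrow> real"
    using integral_distr[OF X' that] dist by simp
  have fX: "random_variable borel (\<lambda>\<omega>. f (?X \<omega>))" using measurable_compose[OF X f] .
  have "variance (\<lambda>\<omega>. f (?X \<omega>)) = expectation (\<lambda>\<omega>. (f (?X \<omega>))\<^sup>2) - (expectation (\<lambda>\<omega>. f (?X \<omega>)))\<^sup>2"
    by (intro variance_eq integrable_of_square[OF prob_space_axioms fX f2] f2)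
  also have "\<dots> = (\<integral>x. (f x)\<^sup>2 \<partial>PiM I N') - (\<integral>x. f x \<partial>PiM I N')\<^sup>2"
    by (simp add: integral_eq)
  also have "\<dots> \<le> (\<Sum>i\<in>I. \<integral>x. (f x - f (x(i := c i)))\<^sup>2 \<partial>PiM I N')"
  proof (rule efron_stein_PiM[OF I(1) _ _ f'])
    show "prob_space (N' i)" if "i \<in> I" for i unfolding N'_def by (rule prob_space_distr[OF rv[OF that]])
    show "c i \<in> space (N' i)" if "i \<in> I" for i using c[OF that] by (simp add: N'_def)
    show "integrable (PiM I N') (\<lambda>x. (f x)\<^sup>2)" using f2 by (subst int_eq) auto
    show "integrable (PiM I N') (\<lambda>x. (f (x(i := c i)))\<^sup>2)" if "i \<in> I" for i
      using fc[OF that] upd_f[OF that] by (subst int_eq) auto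
  qed
  also have "\<dots> = (\<Sum>i\<in>I. expectation (\<lambda>\<omega>. (f (?X \<omega>) - f ((?X \<omega>)(i := c i)))\<^sup>2))"
    by (intro sum.cong refl integral_eq borel_measurable_power borel_measurable_diff f' upd_f)
  finally show ?thesis .
qed

section \<open>Poisson processes\<close>

text \<open>A single realisation of the process. Atoms may carry multiplicity; within a bounded
  region the number of atoms is still at most the mass, and a Borel set contains no atom exactly
  when it has mass 0.\<close>

locale counting_measure =
  fixes \<phi> :: "'a::euclidean_space measure"
  assumes sets_borel: "sets \<phi> = sets borel"
    and integer_valued: "B \<in> sets borel \<Longrightarrow> bounded B \<Longrightarrow> \<exists>k::nat. emeasure \<phi> B = of_nat k"
begin

lemma atom_ge_1:
  assumes "emeasure \<phi> {x} \<noteq> 0"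
  shows "1 \<le> emeasure \<phi> {x}"
proof -
  obtain k :: nat where "emeasure \<phi> {x} = of_nat k" using integer_valued[of "{x}"] by auto
  with assms show ?thesis by (cases k) auto
qed

lemma card_atoms_le:
  assumes "\<Lambda> \<in> sets borel" "finite T" "T \<subseteq> points_in \<Lambda> \<phi>"
  shows "of_nat (card T) \<le> emeasure \<phi> \<Lambda>"
proof -
  have "of_nat (card T) = (\<Sum>x\<in>T. 1 :: ennreal)" by simp
  also have "\<dots> \<le> (\<Sum>x\<in>T. emeasure \<phi> {x})"
    using assms(3) by (intro sum_mono atom_ge_1) (auto simp: points_in_def)
  also have "\<dots> = emeasure \<phi> T"
    using assms(2) by (intro emeasure_eq_sum_singleton[symmetric]) (auto simp: sets_borel)
  also have "\<dots> \<le> emeasure \<phi> \<Lambda>"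
    using assms by (intro emeasure_mono) (auto simp: points_in_def sets_borel)
  finally show ?thesis .
qed

lemma finite_points_in:
  assumes \<Lambda>: "\<Lambda> \<in> sets borel" "bounded \<Lambda>"
  shows "finite (points_in \<Lambda> \<phi>)"
proof (rule ccontr)
  assume inf: "infinite (points_in \<Lambda> \<phi>)"
  obtain k :: nat where k: "emeasure \<phi> \<Lambda> = of_nat k" using integer_valued[OF \<Lambda>] by auto
  obtain T where T: "finite T" "card T = Suc k" "T \<subseteq> points_in \<Lambda> \<phi>"
    using infinite_arbitrarily_large[OF inf, of "Suc k"] by auto
  have "of_nat (Suc k) \<le> (of_nat k :: ennreal)" using card_atoms_le[OF \<Lambda>(1) T(1,3)] T(2) k by simp
  then show False by (metis Suc_n_not_le_n of_nat_le_iff)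
qed

lemma card_points_in_le:
  assumes "\<Lambda> \<in> sets borel" "bounded \<Lambda>"
  shows "of_nat (card (points_in \<Lambda> \<phi>)) \<le> emeasure \<phi> \<Lambda>"
  using card_atoms_le[OF assms(1) finite_points_in[OF assms]] by simp

text \<open>The masses of the shrinking balls tend to 0; being integers, they are eventually equal
  to 0.\<close>

lemma null_ball:
  assumes \<Lambda>: "\<Lambda> \<in> sets borel" "bounded \<Lambda>" and x: "emeasure \<phi> {x} = 0"
  shows "\<exists>n. emeasure \<phi> (ball x (1 / real (Suc n)) \<inter> \<Lambda>) = 0"
proof -
  let ?A = "\<lambda>n. ball x (1 / real (Suc n)) \<inter> \<Lambda>"
  have A: "?A n \<in> sets borel" "bounded (?A n)" for n using \<Lambda> by (auto intro: bounded_subset)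
  have "(\<lambda>n. emeasure \<phi> (?A n)) \<longlonglongrightarrow> emeasure \<phi> (\<Inter>n. ?A n)"
  proof (rule Lim_emeasure_decseq)
    show "range ?A \<subseteq> sets \<phi>" using A by (auto simp: sets_borel)
    show "decseq ?A"
      by (intro decseq_SucI Int_mono subset_ball) (auto simp: frac_le)
    show "emeasure \<phi> (?A n) \<noteq> \<infinity>" for n using integer_valued[OF A] by (metis ennreal_of_nat_neq_top infinity_ennreal_def)
  qed
  moreover have "emeasure \<phi> (\<Inter>n. ?A n) = 0"
  proof -
    have "y = x" if "\<And>n. y \<in> ?A n" for y
    proof (rule ccontr)
      assume "y \<noteq> x"
      then obtain n where "1 / real (Suc n) < dist x y" using nat_approx_posE[of "dist x y"] by auto
      with that[of n] show False by simp
    qed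
    then have "(\<Inter>n. ?A n) \<subseteq> {x}" by blast
    then have "emeasure \<phi> (\<Inter>n. ?A n) \<le> emeasure \<phi> {x}" by (intro emeasure_mono) (auto simp: sets_borel)
    then show ?thesis using x by simp
  qed
  ultimately have "eventually (\<lambda>n. emeasure \<phi> (?A n) < 1) sequentially"
    by (intro order_tendstoD(2)[of _ 0]) auto
  then obtain n where n: "emeasure \<phi> (?A n) < 1" by (auto simp: eventually_sequentially)
  obtain k :: nat where "emeasure \<phi> (?A n) = of_nat k" using integer_valued[OF A] by auto
  with n have "emeasure \<phi> (?A n) = 0" by (cases k) (auto simp: not_less)
  then show ?thesis by blast
qed

text \<open>An integer-valued measure has no diffuse part: an atomless set is covered by balls that
  are null within \<Lambda>, and by Lindelof countably many of them suffice.\<close>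

lemma points_in_void_iff:
  assumes \<Lambda>: "\<Lambda> \<in> sets borel" "bounded \<Lambda>" and B: "B \<in> sets borel"
  shows "points_in \<Lambda> \<phi> \<inter> B = {} \<longleftrightarrow> emeasure \<phi> (\<Lambda> \<inter> B) = 0"
proof
  assume void: "points_in \<Lambda> \<phi> \<inter> B = {}"
  define F where "F = {ball x (1 / real (Suc n)) | x n. emeasure \<phi> (ball x (1 / real (Suc n)) \<inter> \<Lambda>) = 0}"
  obtain F' where F': "F' \<subseteq> F" "countable F'" "\<Union>F' = \<Union>F"
    using Lindelof[of F] by (auto simp: F_def)
  have null: "U \<inter> \<Lambda> \<in> null_sets \<phi>" if "U \<in> F'" for U
    using that F'(1) \<Lambda>(1) by (auto simp: F_def null_sets_def sets_borel)
  have null_UN: "(\<Union>U\<in>F'. U \<inter> \<Lambda>) \<in> null_sets \<phi>"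
    using null by (intro null_sets_UN' F'(2))
  have "\<Lambda> \<inter> B \<subseteq> (\<Union>U\<in>F'. U \<inter> \<Lambda>)"
  proof
    fix x assume x: "x \<in> \<Lambda> \<inter> B"
    then have "emeasure \<phi> {x} = 0" using void by (auto simp: points_in_def)
    then obtain n where "emeasure \<phi> (ball x (1 / real (Suc n)) \<inter> \<Lambda>) = 0"
      using null_ball[OF \<Lambda>] by blast
    then have "ball x (1 / real (Suc n)) \<in> F" unfolding F_def by blast
    moreover have "x \<in> ball x (1 / real (Suc n))" by simp
    ultimately have "x \<in> \<Union>F'" unfolding F'(3) by blast
    then show "x \<in> (\<Union>U\<in>F'. U \<inter> \<Lambda>)" using x by blast
  qed
  then have "\<Lambda> \<inter> B \<in> null_sets \<phi>"
    using \<Lambda> B by (intro null_sets_subset[OF null_UN]) (auto simp: sets_borel)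
  then show "emeasure \<phi> (\<Lambda> \<inter> B) = 0" by auto
next
  assume 0: "emeasure \<phi> (\<Lambda> \<inter> B) = 0"
  have "emeasure \<phi> {x} = 0" if "x \<in> \<Lambda> \<inter> B" for x
  proof -
    have "emeasure \<phi> {x} \<le> emeasure \<phi> (\<Lambda> \<inter> B)"
      using that \<Lambda> B by (intro emeasure_mono) (auto simp: sets_borel)
    then show ?thesis using 0 by simp
  qed
  then show "points_in \<Lambda> \<phi> \<inter> B = {}" by (auto simp: points_in_def)
qed

end

locale poisson_process =
  fixes M :: "'w measure" and \<Phi> :: "'w \<Rightarrow> 'a::euclidean_space measure"
  assumes poisson: "homogeneous_poisson_process 1 M \<Phi>"

sublocale poisson_process \<subseteq> prob_space M
  using poisson by (simp add: homogeneous_poisson_process_def point_process_def)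

context poisson_process
begin

lemma counting: "\<omega> \<in> space M \<Longrightarrow> counting_measure (\<Phi> \<omega>)"
  using poisson by (simp add: counting_measure_def homogeneous_poisson_process_def point_process_def)

lemma count_measurable: "B \<in> sets borel \<Longrightarrow> (\<lambda>\<omega>. emeasure (\<Phi> \<omega>) B) \<in> borel_measurable M"
  using poisson by (simp add: homogeneous_poisson_process_def point_process_def)

lemma count_prob:
  "B \<in> sets borel \<Longrightarrow> bounded B \<Longrightarrow> prob {\<omega> \<in> space M. emeasure (\<Phi> \<omega>) B = of_nat k} =
    measure lborel B ^ k / fact k * exp (- measure lborel B)"
  using poisson by (simp add: homogeneous_poisson_process_def)

lemma count_indep:
  fixes B :: "nat \<Rightarrow> 'a set"
  assumes "finite I" "disjoint_family_on B I" "\<And>i. i \<in> I \<Longrightarrow> B i \<in> sets borel \<and> bounded (B i)"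
  shows "indep_vars (\<lambda>_. borel) (\<lambda>i \<omega>. emeasure (\<Phi> \<omega>) (B i)) I"
  using poisson assms by (simp add: homogeneous_poisson_process_def)

abbreviation points :: "'a set \<Rightarrow> 'w \<Rightarrow> 'a set" where
  "points \<Lambda> \<omega> \<equiv> points_in \<Lambda> (\<Phi> \<omega>)"

lemma finite_points: "\<Lambda> \<in> sets borel \<Longrightarrow> bounded \<Lambda> \<Longrightarrow> \<omega> \<in> space M \<Longrightarrow> finite (points \<Lambda> \<omega>)"
  using counting_measure.finite_points_in[OF counting] .

lemma void_event:
  assumes "\<Lambda> \<in> sets borel" "bounded \<Lambda>" "B \<in> sets borel"
  shows "{\<omega> \<in> space M. points \<Lambda> \<omega> \<inter> B = {}} = {\<omega> \<in> space M. emeasure (\<Phi> \<omega>) (\<Lambda> \<inter> B) = 0}"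
  using counting_measure.points_in_void_iff[OF counting assms] by auto

lemma points_measurable:
  assumes "\<Lambda> \<in> sets borel" "bounded \<Lambda>"
  shows "points \<Lambda> \<in> M \<rightarrow>\<^sub>M configurations"
proof (rule measurable_configurationsI)
  fix B :: "'a set" assume B: "B \<in> sets borel"
  have "(\<lambda>\<omega>. emeasure (\<Phi> \<omega>) (\<Lambda> \<inter> B)) -` {0} \<inter> space M \<in> sets M"
    using assms B by (intro measurable_sets[OF count_measurable]) auto
  also have "(\<lambda>\<omega>. emeasure (\<Phi> \<omega>) (\<Lambda> \<inter> B)) -` {0} \<inter> space M = {\<omega> \<in> space M. points \<Lambda> \<omega> \<inter> B = {}}"
    using void_event[OF assms B] by auto
  finally show "{\<omega> \<in> space M. points \<Lambda> \<omega> \<inter> B = {}} \<in> sets M" .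
qed (rule finite_points[OF assms])

lemma void_prob:
  assumes "\<Lambda> \<in> sets borel" "bounded \<Lambda>" "B \<in> sets borel"
  shows "prob {\<omega> \<in> space M. points \<Lambda> \<omega> \<inter> B = {}} = exp (- measure lborel (\<Lambda> \<inter> B))"
  using count_prob[of "\<Lambda> \<inter> B" 0] assms unfolding void_event[OF assms]
  by (auto intro: bounded_subset)

text \<open>Independence need only be checked on the intersection-stable generator of void events.
  There it becomes independence of the counts on the disjoint sets \<Lambda> i \<inter> B i.\<close>

lemma points_indep:
  fixes \<Lambda> :: "'i \<Rightarrow> 'a set"
  assumes I: "finite I" "I \<noteq> {}" and disj: "disjoint_family_on \<Lambda> I"
    and \<Lambda>: "\<And>i. i \<in> I \<Longrightarrow> \<Lambda> i \<in> sets borel" "\<And>i. i \<in> I \<Longrightarrow> bounded (\<Lambda> i)"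
  shows "indep_vars (\<lambda>_. configurations) (\<lambda>i. points (\<Lambda> i)) I"
proof -
  let ?E = "(\<lambda>B. {X. finite X \<and> X \<inter> B = {}}) ` sets (borel :: 'a measure)"
  show ?thesis
  proof (subst indep_vars_finite[OF I(2,1), where E="\<lambda>_. ?E"])
    show "sets configurations = sigma_sets (space configurations) ?E"
      by (simp add: sets_configurations)
    show "random_variable configurations (points (\<Lambda> i))" if "i \<in> I" for i
      using points_measurable[OF \<Lambda>[OF that]] .
    show "Int_stable ?E" by (rule Int_stable_void)
    show "space configurations \<in> ?E" by (intro image_eqI[of _ _ "{}"]) auto
    show "?E \<subseteq> Pow (space configurations)" by auto
    show "\<forall>A\<in>I \<rightarrow> ?E. prob (\<Inter>j\<in>I. points (\<Lambda> j) -` A j \<inter> space M) =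
        (\<Prod>j\<in>I. prob (points (\<Lambda> j) -` A j \<inter> space M))"
    proof
      fix A assume A: "A \<in> I \<rightarrow> ?E"
      have "\<forall>i\<in>I. \<exists>B. B \<in> sets borel \<and> A i = {X. finite X \<and> X \<inter> B = {}}"
        using Pi_mem[OF A] by blast
      then obtain B where B: "\<And>i. i \<in> I \<Longrightarrow> B i \<in> sets borel"
          "\<And>i. i \<in> I \<Longrightarrow> A i = {X. finite X \<and> X \<inter> B i = {}}" by metis
      let ?C = "\<lambda>i. (\<lambda>\<omega>. emeasure (\<Phi> \<omega>) (\<Lambda> i \<inter> B i)) -` {0} \<inter> space M"
      have eq: "points (\<Lambda> i) -` A i \<inter> space M = ?C i" if "i \<in> I" for i
        using void_event[OF \<Lambda>[OF that] B(1)[OF that]] finite_points[OF \<Lambda>[OF that]] B(2)[OF that] by auto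
      \<comment> \<open>The independence clause of the process is stated for families indexed by
        natural numbers.\<close>
      obtain h where h: "bij_betw h {0..<card I} I" using ex_bij_betw_nat_finite[OF I(1)] by blast
      let ?N = "{0..<card I}"
      have hI: "h n \<in> I" if "n \<in> ?N" for n using h that by (auto simp: bij_betw_def)
      have N: "?N \<noteq> {}" using I by auto
      have "indep_vars (\<lambda>_. borel) (\<lambda>n \<omega>. emeasure (\<Phi> \<omega>) (\<Lambda> (h n) \<inter> B (h n))) ?N"
      proof (rule count_indep)
        show "disjoint_family_on (\<lambda>n. \<Lambda> (h n) \<inter> B (h n)) ?N"
          unfolding disjoint_family_on_def
        proof (intro ballI impI)
          fix m n assume *: "m \<in> ?N" "n \<in> ?N" "m \<noteq> n"
          then have "h m \<noteq> h n" using h by (auto simp: bij_betw_def inj_on_def)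
          then have "\<Lambda> (h m) \<inter> \<Lambda> (h n) = {}" using disj hI * by (auto simp: disjoint_family_on_def)
          then show "\<Lambda> (h m) \<inter> B (h m) \<inter> (\<Lambda> (h n) \<inter> B (h n)) = {}" by auto
        qed
        show "\<Lambda> (h n) \<inter> B (h n) \<in> sets borel \<and> bounded (\<Lambda> (h n) \<inter> B (h n))" if "n \<in> ?N" for n
          using \<Lambda> B(1) hI[OF that] by (auto intro: bounded_subset)
      qed simp
      then have "prob (\<Inter>n\<in>?N. ?C (h n)) = (\<Prod>n\<in>?N. prob (?C (h n)))"
        using N by (intro indep_varsD_finite) auto
      moreover have "(\<Inter>n\<in>?N. ?C (h n)) = (\<Inter>i\<in>I. ?C i)"
      proof -
        have "(\<Inter>i\<in>h ` ?N. ?C i) = (\<Inter>n\<in>?N. ?C (h n))" by (simp only: image_image)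
        then show ?thesis using h by (simp only: bij_betw_imp_surj_on)
      qed
      moreover have "(\<Prod>n\<in>?N. prob (?C (h n))) = (\<Prod>i\<in>I. prob (?C i))"
        by (rule prod.reindex_bij_betw[OF h])
      moreover have "(\<Inter>i\<in>I. points (\<Lambda> i) -` A i \<inter> space M) = (\<Inter>i\<in>I. ?C i)"
        by (rule INF_cong[OF refl]) (rule eq)
      moreover have "(\<Prod>i\<in>I. prob (points (\<Lambda> i) -` A i \<inter> space M)) = (\<Prod>i\<in>I. prob (?C i))"
        by (rule prod.cong[OF refl]) (simp only: eq)
      ultimately show "prob (\<Inter>j\<in>I. points (\<Lambda> j) -` A j \<inter> space M) =
        (\<Prod>j\<in>I. prob (points (\<Lambda> j) -` A j \<inter> space M))" by simp
    qed
  qed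
qed

text \<open>The probability of a void event depends only on the volume of the avoided region, which
  is translation invariant, and void events determine the law.\<close>

lemma law_translate:
  assumes \<Lambda>: "\<Lambda> \<in> sets borel" "bounded \<Lambda>"
  shows "distr M configurations (points ((\<lambda>x. x + v) ` \<Lambda>)) =
    distr M configurations (\<lambda>\<omega>. (\<lambda>x. x + v) ` points \<Lambda> \<omega>)" (is "?L = ?R")
proof -
  let ?\<Lambda> = "(\<lambda>x. x + v) ` \<Lambda>"
  let ?E = "(\<lambda>B. {X. finite X \<and> X \<inter> B = {}}) ` sets (borel :: 'a measure)"
  have pre: "(\<lambda>x. x + w) -` B \<in> sets borel" if "B \<in> sets borel" for B :: "'a set" and w
    using measurable_sets[of "\<lambda>x. x + w" borel borel B] that by simp
  have tr: "(\<lambda>x. x + v) ` S = (\<lambda>x. x + (- v)) -` S" for S :: "'a set"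
    by (auto simp: image_iff) (metis add.commute diff_add_cancel uminus_add_conv_diff)
  have \<Lambda>': "?\<Lambda> \<in> sets borel" "bounded ?\<Lambda>"
    using pre[OF \<Lambda>(1), of "- v"] bounded_translation[OF \<Lambda>(2), of v] unfolding tr[symmetric]
    by (simp_all add: add.commute)
  note mL = points_measurable[OF \<Lambda>']
  note mR = measurable_compose[OF points_measurable[OF \<Lambda>] measurable_translate_configurations[of v]]
  show ?thesis
  proof (rule measure_eqI_generator_eq[where E="?E" and \<Omega>="{X. finite X}" and A="\<lambda>_. {X. finite X}"])
    show "Int_stable ?E" by (rule Int_stable_void)
    show "emeasure ?L a = emeasure ?R a" if "a \<in> ?E" for a
    proof -
      from that obtain B where B: "a = {X. finite X \<and> X \<inter> B = {}}" "B \<in> sets borel" by (rule imageE)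
      then have a: "a \<in> sets configurations" by (simp add: void_in_sets)
      let ?S = "\<Lambda> \<inter> (\<lambda>x. x + v) -` B"
      have S: "?S \<in> sets borel" using \<Lambda> pre[OF B(2)] by auto
      have "?\<Lambda> \<inter> B = (+) (- v) -` ?S \<inter> space lborel" by (auto simp: tr)
      moreover have "measure (distr lborel borel ((+) (- v))) ?S = measure lborel ((+) (- v) -` ?S \<inter> space lborel)"
        by (rule measure_distr) (use S in auto)
      ultimately have "measure lborel (?\<Lambda> \<inter> B) = measure (distr lborel borel ((+) (- v))) ?S"
        by (simp only:)
      then have vol: "measure lborel (?\<Lambda> \<inter> B) = measure lborel ?S"
        unfolding lborel_distr_plus .
      have "points ?\<Lambda> -` a \<inter> space M = {\<omega> \<in> space M. points ?\<Lambda> \<omega> \<inter> B = {}}"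
        using finite_points[OF \<Lambda>'] B by auto
      moreover have "(\<lambda>\<omega>. (\<lambda>x. x + v) ` points \<Lambda> \<omega>) -` a \<inter> space M =
          {\<omega> \<in> space M. points \<Lambda> \<omega> \<inter> (\<lambda>x. x + v) -` B = {}}"
        using finite_points[OF \<Lambda>] B by auto
      ultimately show ?thesis
        using a vol void_prob[OF \<Lambda>' B(2)] void_prob[OF \<Lambda> pre[OF B(2)]]
        by (simp add: emeasure_distr[OF mL a] emeasure_distr[OF mR a] emeasure_eq_measure)
    qed
    show "range (\<lambda>_::nat. {X. finite X}) \<subseteq> ?E" by (auto intro!: image_eqI[of _ _ "{}"])
    show "emeasure ?L {X. finite X} \<noteq> \<infinity>" for i :: nat
      using finite_measure.emeasure_finite[OF prob_space.finite_measure[OF prob_space_distr[OF mL]]] by simp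
  qed (auto simp: sets_configurations)
qed

text \<open>Supplies the square-integrable majorant of the increments, which are bounded by a power
  of the number of points in a cube.\<close>

lemma count_moment_integrable:
  assumes \<Lambda>: "\<Lambda> \<in> sets borel" "bounded \<Lambda>"
  shows "integrable M (\<lambda>\<omega>. enn2real (emeasure (\<Phi> \<omega>) \<Lambda>) ^ p)"
proof -
  define vol where "vol = measure lborel \<Lambda>"
  define N where "N k = {\<omega> \<in> space M. emeasure (\<Phi> \<omega>) \<Lambda> = of_nat k}" for k :: nat
  have [measurable]: "(\<lambda>\<omega>. emeasure (\<Phi> \<omega>) \<Lambda>) \<in> borel_measurable M" by (rule count_measurable[OF \<Lambda>(1)])
  have N [measurable]: "N k \<in> sets M" for k unfolding N_def by measurable
  \<comment> \<open>k^p / p! is one term of the series of exp k. With this bound the moment series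
    is dominated by the exponential series with parameter e * vol.\<close>
  have bound: "real k ^ p \<le> fact p * exp 1 ^ k" for k
  proof -
    have s: "(\<lambda>n. real k ^ n /\<^sub>R fact n) sums exp (real k)" by (rule exp_converges)
    have "(\<Sum>n\<in>{p}. real k ^ n /\<^sub>R fact n) \<le> (\<Sum>n. real k ^ n /\<^sub>R fact n)"
      using s by (intro sum_le_suminf) (auto simp: sums_iff)
    then have "real k ^ p / fact p \<le> exp (real k)" using s by (simp add: sums_iff field_simps)
    then show ?thesis by (simp add: field_simps exp_of_nat_mult[symmetric])
  qed
  have summ: "summable (\<lambda>k. real k ^ p * (vol ^ k / fact k * exp (- vol)))"
  proof (rule summable_comparison_test')
    show "summable (\<lambda>k. (fact p * exp (- vol)) * (inverse (fact k) * (exp 1 * vol) ^ k))"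
      by (intro summable_mult summable_exp)
    fix k :: nat
    have "real k ^ p * (vol ^ k / fact k * exp (- vol)) \<le> (fact p * exp 1 ^ k) * (vol ^ k / fact k * exp (- vol))"
      using bound[of k] by (intro mult_right_mono) (auto simp: vol_def)
    then show "norm (real k ^ p * (vol ^ k / fact k * exp (- vol)))
        \<le> (fact p * exp (- vol)) * (inverse (fact k) * (exp 1 * vol) ^ k)"
      by (simp add: power_mult_distrib field_simps vol_def)
  qed
  have "(\<integral>\<^sup>+\<omega>. ennreal (enn2real (emeasure (\<Phi> \<omega>) \<Lambda>) ^ p) \<partial>M)
      = (\<integral>\<^sup>+\<omega>. (\<Sum>k. ennreal (real k ^ p) * indicator (N k) \<omega>) \<partial>M)"
  proof (rule nn_integral_cong)
    fix \<omega> assume \<omega>: "\<omega> \<in> space M"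
    then obtain k :: nat where k: "emeasure (\<Phi> \<omega>) \<Lambda> = of_nat k"
      using counting_measure.integer_valued[OF counting \<Lambda>] by blast
    have "(\<Sum>j. ennreal (real j ^ p) * indicator (N j) \<omega>) = (\<Sum>j\<in>{k}. ennreal (real j ^ p) * indicator (N j) \<omega>)"
      using k by (intro suminf_finite) (auto simp: N_def indicator_def)
    then show "ennreal (enn2real (emeasure (\<Phi> \<omega>) \<Lambda>) ^ p) = (\<Sum>k. ennreal (real k ^ p) * indicator (N k) \<omega>)"
      using k \<omega> by (simp add: N_def indicator_def)
  qed
  also have "\<dots> = (\<Sum>k. ennreal (real k ^ p) * emeasure M (N k))"
    by (subst nn_integral_suminf) (auto simp: nn_integral_cmult_indicator)
  also have "\<dots> = (\<Sum>k. ennreal (real k ^ p * (vol ^ k / fact k * exp (- vol))))"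
  proof (rule arg_cong[where f=suminf], rule ext)
    fix k
    have "0 \<le> vol" by (simp add: vol_def)
    then show "ennreal (real k ^ p) * emeasure M (N k) = ennreal (real k ^ p * (vol ^ k / fact k * exp (- vol)))"
      unfolding N_def emeasure_eq_measure count_prob[OF \<Lambda>] vol_def[symmetric] by (simp add: ennreal_mult[symmetric])
  qed
  also have "\<dots> < \<infinity>"
  proof -
    have "(\<Sum>k. ennreal (real k ^ p * (vol ^ k / fact k * exp (- vol)))) \<noteq> \<top>"
      by (rule ennreal_suminf_neq_top[OF summ]) (simp add: vol_def)
    then show ?thesis by (simp add: less_top)
  qed
  finally show ?thesis by (intro integrableI_nonneg) auto
qed

lemma card_points_le:
  assumes "\<Lambda> \<in> sets borel" "bounded \<Lambda>" "\<omega> \<in> space M"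
  shows "real (card (points \<Lambda> \<omega>)) \<le> enn2real (emeasure (\<Phi> \<omega>) \<Lambda>)"
proof -
  obtain k :: nat where k: "emeasure (\<Phi> \<omega>) \<Lambda> = of_nat k"
    using counting_measure.integer_valued[OF counting[OF assms(3)] assms(1,2)] by blast
  then show ?thesis using counting_measure.card_points_in_le[OF counting[OF assms(3)] assms(1,2)] by simp
qed

end

section \<open>Gaussian limits of characteristic functions\<close>

text \<open>A central limit theorem with a moving argument: normalising by the volume of the window
  instead of the number of blocks changes the argument by a factor that is only asymptotically
  constant. The sequence m will count the blocks.\<close>

lemma char_power_limit:
  assumes \<mu>: "real_distribution \<mu>" and int2: "integrable \<mu> (\<lambda>x. x\<^sup>2)"
    and mean: "(\<integral>x. x \<partial>\<mu>) = 0" and var: "(\<integral>x. x\<^sup>2 \<partial>\<mu>) = v"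
    and m: "filterlim m at_top sequentially" and s: "s \<longlonglongrightarrow> s0"
  shows "(\<lambda>n. char \<mu> (s n / sqrt (real (m n))) ^ m n) \<longlonglongrightarrow> exp (- (v * s0\<^sup>2 / 2))"
proof -
  interpret \<mu>: real_distribution \<mu> by (rule \<mu>)
  have int1: "integrable \<mu> (\<lambda>x. x)"
    by (rule \<mu>.square_integrable_imp_integrable[OF _ int2]) simp
  have v: "v \<ge> 0" unfolding var[symmetric] by (rule Bochner_Integration.integral_nonneg) auto
  \<comment> \<open>Second-order expansion of \<open>char \<mu>\<close> at s0 / sqrt (m n), whose
    power has the exponential limit.\<close>
  define b where "b n = 1 + (- (v * s0\<^sup>2 / 2)) / real (m n)" for n
  define u where "u n = s n / sqrt (real (m n))" for n
  \<comment> \<open>Third-order remainder, truncated at 6 * x^2: dominated convergence then works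
    with second moments only.\<close>
  define I where "I n = (\<integral>x. min (6 * x\<^sup>2) (\<bar>u n\<bar> * \<bar>x\<bar> ^ 3) \<partial>\<mu>)" for n
  have mreal: "filterlim (\<lambda>n. real (m n)) at_top sequentially"
    using filterlim_compose[OF filterlim_real_sequentially m] .
  have u: "u \<longlonglongrightarrow> 0"
    unfolding u_def
    by (intro tendsto_divide_0[OF s] filterlim_at_top_imp_at_infinity filterlim_compose[OF sqrt_at_top mreal])
  have I: "I \<longlonglongrightarrow> 0"
  proof -
    have "I \<longlonglongrightarrow> (\<integral>x. 0 \<partial>\<mu>)"
      unfolding I_def
    proof (rule integral_dominated_convergence[where w="\<lambda>x. 6 * x\<^sup>2"])
      show "AE x in \<mu>. (\<lambda>n. min (6 * x\<^sup>2) (\<bar>u n\<bar> * \<bar>x\<bar> ^ 3)) \<longlonglongrightarrow> 0"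
      proof (intro always_eventually allI)
        fix x :: real
        have "(\<lambda>n. min (6 * x\<^sup>2) (\<bar>u n\<bar> * \<bar>x\<bar> ^ 3)) \<longlonglongrightarrow> min (6 * x\<^sup>2) (\<bar>0\<bar> * \<bar>x\<bar> ^ 3)"
          by (intro tendsto_intros u)
        then show "(\<lambda>n. min (6 * x\<^sup>2) (\<bar>u n\<bar> * \<bar>x\<bar> ^ 3)) \<longlonglongrightarrow> 0" by simp
      qed
    qed (use int2 in auto)
    then show ?thesis by simp
  qed
  define err where "err n = (s n)\<^sup>2 / 6 * I n + v / 2 * \<bar>s0\<^sup>2 - (s n)\<^sup>2\<bar>" for n
  have err: "err \<longlonglongrightarrow> 0"
  proof -
    have "err \<longlonglongrightarrow> s0\<^sup>2 / 6 * 0 + v / 2 * \<bar>s0\<^sup>2 - s0\<^sup>2\<bar>"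
      unfolding err_def by (intro tendsto_intros I s) auto
    then show ?thesis by simp
  qed
  have "eventually (\<lambda>n. norm (char \<mu> (u n) ^ m n - complex_of_real (b n ^ m n)) \<le> err n) sequentially"
    using filterlim_at_top[THEN iffD1, OF mreal, rule_format, of "max 1 (v * s0\<^sup>2)"]
  proof eventually_elim
    case (elim n)
    then have m1: "real (m n) \<ge> 1" and m2: "v * s0\<^sup>2 \<le> real (m n)" by auto
    have sq: "(u n)\<^sup>2 = (s n)\<^sup>2 / real (m n)" using m1 by (simp add: u_def power_divide)
    \<comment> \<open>Powers are compared through their bases, which must lie in the unit disc; this
      is why n was taken large enough for m n \<ge> v * s0^2.\<close>
    have b: "\<bar>b n\<bar> \<le> 1"
      using m1 m2 v by (auto simp: b_def abs_le_iff field_simps)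
    have "norm (char \<mu> (u n) ^ m n - complex_of_real (b n) ^ m n)
        \<le> real (m n) * norm (char \<mu> (u n) - complex_of_real (b n))"
      using b by (intro norm_power_diff \<mu>.cmod_char_le_1) simp
    also have "norm (char \<mu> (u n) - complex_of_real (b n)) \<le>
        norm (char \<mu> (u n) - (1 - (u n)\<^sup>2 * v / 2)) + norm (complex_of_real (1 - (u n)\<^sup>2 * v / 2 - b n))"
      using norm_triangle_ineq[of "char \<mu> (u n) - (1 - (u n)\<^sup>2 * v / 2)" "complex_of_real (1 - (u n)\<^sup>2 * v / 2 - b n)"]
      by simp
    also have "norm (char \<mu> (u n) - (1 - (u n)\<^sup>2 * v / 2)) \<le> (u n)\<^sup>2 / 6 * I n"
      unfolding I_def by (rule \<mu>.char_approx3[OF int1 mean int2]) (simp add: mean var)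
    also have "norm (complex_of_real (1 - (u n)\<^sup>2 * v / 2 - b n)) = v / 2 * \<bar>s0\<^sup>2 - (s n)\<^sup>2\<bar> / real (m n)"
    proof -
      have "1 - (u n)\<^sup>2 * v / 2 - b n = v / 2 * (s0\<^sup>2 - (s n)\<^sup>2) / real (m n)"
        using m1 by (simp add: sq b_def field_simps)
      then show ?thesis unfolding norm_of_real using v by (simp add: abs_mult)
    qed
    finally have "norm (char \<mu> (u n) ^ m n - complex_of_real (b n) ^ m n)
        \<le> real (m n) * ((u n)\<^sup>2 / 6 * I n + v / 2 * \<bar>s0\<^sup>2 - (s n)\<^sup>2\<bar> / real (m n))"
      by (simp add: mult_left_mono)
    also have "\<dots> = err n" using m1 by (simp add: sq err_def field_simps)
    finally show ?case by simp
  qed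
  then have diff: "(\<lambda>n. char \<mu> (u n) ^ m n - complex_of_real (b n ^ m n)) \<longlonglongrightarrow> 0"
    using err by (rule Lim_null_comparison)
  have "(\<lambda>n. (1 + (- (v * s0\<^sup>2 / 2)) / real n) ^ n) \<longlonglongrightarrow> exp (- (v * s0\<^sup>2 / 2))"
    by (rule tendsto_exp_limit_sequentially)
  then have "(\<lambda>n. b n ^ m n) \<longlonglongrightarrow> exp (- (v * s0\<^sup>2 / 2))"
    unfolding b_def by (rule filterlim_compose[OF _ m])
  then have "(\<lambda>n. complex_of_real (b n ^ m n)) \<longlonglongrightarrow> complex_of_real (exp (- (v * s0\<^sup>2 / 2)))"
    by (rule tendsto_of_real)
  from tendsto_add[OF diff this] show ?thesis by (simp add: u_def exp_of_real)
qed

lemma real_distribution_normal: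
  assumes "v \<ge> 0"
  shows "real_distribution (normal_distribution \<mu> v)"
proof (cases "v = 0")
  case True
  then show ?thesis
    by (simp add: normal_distribution_def real_distribution_def real_distribution_axioms_def prob_space_return)
next
  case False
  then have "prob_space (density lborel (normal_density \<mu> (sqrt v)))"
    using assms by (intro prob_space_normal_density) auto
  then show ?thesis using False
    by (simp add: normal_distribution_def real_distribution_def real_distribution_axioms_def)
qed

text \<open>For v > 0 the standard normal law is scaled by sqrt v; for v = 0 the law is the point
  mass at 0.\<close>

lemma char_normal:
  assumes v: "v \<ge> 0"
  shows "char (normal_distribution 0 v) t = exp (- (v * t\<^sup>2 / 2))"
proof (cases "v = 0")
  case True
  then show ?thesis by (simp add: normal_distribution_def char_def integral_return)
next
  case False
  with v have v: "v > 0" by simp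
  interpret std: real_distribution std_normal_distribution by (rule real_dist_normal_dist)
  have "distributed std_normal_distribution lborel (\<lambda>x. x) std_normal_density"
    unfolding distributed_def by (auto simp: distr_id2)
  then have "distributed std_normal_distribution lborel (\<lambda>x. 0 + sqrt v * x) (normal_density (0 + sqrt v * 0) (\<bar>sqrt v\<bar> * 1))"
    using v by (intro std.normal_density_affine) auto
  then have d: "distr std_normal_distribution lborel (\<lambda>x. sqrt v * x) = density lborel (normal_density 0 (sqrt v))"
    using v by (simp add: distributed_def)
  have "char (normal_distribution 0 v) t = char (distr std_normal_distribution lborel (\<lambda>x. sqrt v * x)) t"
    using v by (simp add: normal_distribution_def d)
  also have "\<dots> = char std_normal_distribution (t * sqrt v)"
    unfolding char_def by (subst integral_distr) (auto simp: mult.assoc)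
  also have "\<dots> = exp (- (v * t\<^sup>2 / 2))"
  proof -
    have "- ((t * sqrt v)\<^sup>2) / 2 = - (v * t\<^sup>2 / 2)" using v by (simp add: power_mult_distrib)
    then show ?thesis by (simp only: char_std_normal_distribution)
  qed
  finally show ?thesis .
qed

text \<open>x \<mapsto> exp(itx) has Lipschitz constant |t|, and a first absolute moment is at most
  the root of the second moment.\<close>

lemma (in prob_space) char_diff_le:
  assumes X: "random_variable borel X" and Y: "random_variable borel Y"
    and int: "integrable M (\<lambda>\<omega>. (X \<omega> - Y \<omega>)\<^sup>2)"
  shows "cmod (char (distr M borel X) t - char (distr M borel Y) t)
    \<le> \<bar>t\<bar> * sqrt (expectation (\<lambda>\<omega>. (X \<omega> - Y \<omega>)\<^sup>2))"
proof -
  note [measurable] = X Y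
  have i: "integrable M (\<lambda>\<omega>. iexp (t * Z \<omega>))" if "random_variable borel Z" for Z
    using that by (intro integrable_const_bound[where B=1]) auto
  have int1: "integrable M (\<lambda>\<omega>. \<bar>X \<omega> - Y \<omega>\<bar>)"
    by (rule integrable_abs, rule integrable_of_square[OF prob_space_axioms _ int]) measurable
  have "cmod (iexp (t * x) - iexp (t * y)) \<le> \<bar>t\<bar> * \<bar>x - y\<bar>" for x y
  proof -
    have "iexp (t * x) - iexp (t * y) = iexp (t * y) * (iexp (t * (x - y)) - 1)"
      by (simp add: algebra_simps exp_add[symmetric])
    then have "cmod (iexp (t * x) - iexp (t * y)) = cmod (iexp (t * (x - y)) - 1)"
      by (simp add: norm_mult)
    also have "\<dots> \<le> \<bar>t * (x - y)\<bar>" using iexp_approx1[of "t * (x - y)" 0] by simp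
    finally show ?thesis by (simp add: abs_mult)
  qed
  then have le: "cmod (iexp (t * X \<omega>) - iexp (t * Y \<omega>)) \<le> \<bar>t\<bar> * \<bar>X \<omega> - Y \<omega>\<bar>" for \<omega> .
  have "char (distr M borel X) t - char (distr M borel Y) t = (\<integral>\<omega>. iexp (t * X \<omega>) - iexp (t * Y \<omega>) \<partial>M)"
  proof -
    have "char (distr M borel Z) t = (\<integral>\<omega>. iexp (t * Z \<omega>) \<partial>M)" if "random_variable borel Z" for Z
      unfolding char_def using that by (intro integral_distr) auto
    then show ?thesis
      by (simp only: X Y Bochner_Integration.integral_diff[OF i[OF X] i[OF Y]])
  qed
  also have "cmod \<dots> \<le> (\<integral>\<omega>. cmod (iexp (t * X \<omega>) - iexp (t * Y \<omega>)) \<partial>M)"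
    by (rule integral_norm_bound)
  also have "\<dots> \<le> (\<integral>\<omega>. \<bar>t\<bar> * \<bar>X \<omega> - Y \<omega>\<bar> \<partial>M)"
    using int1 by (intro integral_mono le integrable_norm Bochner_Integration.integrable_diff i X Y) auto
  also have "\<dots> = \<bar>t\<bar> * expectation (\<lambda>\<omega>. \<bar>X \<omega> - Y \<omega>\<bar>)" by simp
  also have "\<dots> \<le> \<bar>t\<bar> * sqrt (expectation (\<lambda>\<omega>. (X \<omega> - Y \<omega>)\<^sup>2))"
  proof (intro mult_left_mono real_le_rsqrt)
    have "(expectation (\<lambda>\<omega>. \<bar>X \<omega> - Y \<omega>\<bar>))\<^sup>2 \<le> expectation (\<lambda>\<omega>. \<bar>X \<omega> - Y \<omega>\<bar>\<^sup>2)"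
      using int by (intro expectation_square_le) auto
    then show "(expectation (\<lambda>\<omega>. \<bar>X \<omega> - Y \<omega>\<bar>))\<^sup>2 \<le> expectation (\<lambda>\<omega>. (X \<omega> - Y \<omega>)\<^sup>2)" by simp
  qed simp
  finally show ?thesis .
qed

text \<open>By compactness some subsequence of the variances v k converges to a limit v0. For a
  given accuracy one index of this subsequence is fixed before n grows, so the whole sequence in n
  converges.\<close>

lemma gaussian_limit_of_approximations:
  fixes \<phi> :: "nat \<Rightarrow> real \<Rightarrow> complex" and \<psi> :: "nat \<Rightarrow> nat \<Rightarrow> real \<Rightarrow> complex"
  assumes v: "\<And>k. 0 \<le> v k" "\<And>k. v k \<le> C"
    and \<psi>: "\<And>k t. (\<lambda>n. \<psi> k n t) \<longlonglongrightarrow> exp (- (v k * t\<^sup>2 / 2))"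
    and e: "e \<longlonglongrightarrow> (0::real)"
    and close: "\<And>k. eventually (\<lambda>n. \<forall>t. cmod (\<phi> n t - \<psi> k n t) \<le> \<bar>t\<bar> * e k) sequentially"
  shows "\<exists>v0\<ge>0. \<forall>t. (\<lambda>n. \<phi> n t) \<longlonglongrightarrow> exp (- (v0 * t\<^sup>2 / 2))"
proof -
  have "\<forall>k. v k \<in> {0..C}" using v by auto
  then obtain v0 r where v0: "v0 \<in> {0..C}" and r: "strict_mono r" and lim: "(v \<circ> r) \<longlonglongrightarrow> v0"
    using compact_Icc[of 0 C] unfolding compact_eq_seq_compact_metric seq_compact_def by metis
  have "(\<lambda>n. \<phi> n t) \<longlonglongrightarrow> exp (- (v0 * t\<^sup>2 / 2))" for t
  proof (rule tendstoI)
    fix \<epsilon> :: real assume \<epsilon>: "\<epsilon> > 0"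
    have "(\<lambda>j. \<bar>t\<bar> * e (r j)) \<longlonglongrightarrow> \<bar>t\<bar> * 0"
      using LIMSEQ_subseq_LIMSEQ[OF e r] by (intro tendsto_intros) (simp add: comp_def)
    then have 1: "eventually (\<lambda>j. \<bar>t\<bar> * e (r j) < \<epsilon> / 3) sequentially"
      using \<epsilon> by (intro order_tendstoD(2)[of _ "\<bar>t\<bar> * 0"]) auto
    have "(\<lambda>j. complex_of_real (exp (- (v (r j) * t\<^sup>2 / 2)))) \<longlonglongrightarrow> complex_of_real (exp (- (v0 * t\<^sup>2 / 2)))"
      using lim by (intro tendsto_intros) (auto simp: comp_def)
    then have 2: "eventually (\<lambda>j. dist (complex_of_real (exp (- (v (r j) * t\<^sup>2 / 2))))
        (complex_of_real (exp (- (v0 * t\<^sup>2 / 2)))) < \<epsilon> / 3) sequentially"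
      using \<epsilon> by (intro tendstoD) auto
    obtain j where j: "\<bar>t\<bar> * e (r j) < \<epsilon> / 3"
        "dist (complex_of_real (exp (- (v (r j) * t\<^sup>2 / 2)))) (complex_of_real (exp (- (v0 * t\<^sup>2 / 2)))) < \<epsilon> / 3"
      using eventually_happens[OF eventually_conj[OF 1 2]] by auto
    have 3: "eventually (\<lambda>n. dist (\<psi> (r j) n t) (exp (- (v (r j) * t\<^sup>2 / 2))) < \<epsilon> / 3) sequentially"
      using \<epsilon> by (intro tendstoD[OF \<psi>]) auto
    show "eventually (\<lambda>n. dist (\<phi> n t) (exp (- (v0 * t\<^sup>2 / 2))) < \<epsilon>) sequentially"
      using close[of "r j"] 3
    proof eventually_elim
      case (elim n)
      have "dist (\<phi> n t) (\<psi> (r j) n t) \<le> \<bar>t\<bar> * e (r j)" using elim by (simp add: dist_norm)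
      then show ?case
        using elim(2) j
          dist_triangle[of "\<phi> n t" "exp (- (v0 * t\<^sup>2 / 2)) :: complex" "\<psi> (r j) n t"]
          dist_triangle[of "\<psi> (r j) n t" "exp (- (v0 * t\<^sup>2 / 2)) :: complex" "exp (- (v (r j) * t\<^sup>2 / 2))"]
        by (simp add: exp_of_real)
    qed
  qed
  then show ?thesis using v0 by auto
qed

section \<open>Increments over lattice cells\<close>

definition cells :: "('n \<Rightarrow> int) set \<Rightarrow> (real ^ 'n) set" where
  "cells A = {x. grid 1 x \<in> A}"

definition cube :: "('n \<Rightarrow> int) \<Rightarrow> nat \<Rightarrow> ('n \<Rightarrow> int) set" where
  "cube j k = {i. \<forall>a. \<bar>i a - j a\<bar> \<le> int k}"

abbreviation shift :: "('n \<Rightarrow> int) \<Rightarrow> ('n \<Rightarrow> int) set \<Rightarrow> ('n \<Rightarrow> int) set" where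
  "shift j A \<equiv> (\<lambda>i a. i a + j a) ` A"

lemma finite_card_functions:
  assumes "finite S"
  shows "finite {i :: 'n::finite \<Rightarrow> 'b. \<forall>a. i a \<in> S}" "card {i :: 'n \<Rightarrow> 'b. \<forall>a. i a \<in> S} = card S ^ CARD('n)"
proof -
  have "{i :: 'n \<Rightarrow> 'b. \<forall>a. i a \<in> S} = PiE UNIV (\<lambda>_. S)" by (auto simp: PiE_def Pi_def)
  then show "finite {i :: 'n \<Rightarrow> 'b. \<forall>a. i a \<in> S}" "card {i :: 'n \<Rightarrow> 'b. \<forall>a. i a \<in> S} = card S ^ CARD('n)"
    using assms by (auto simp: card_PiE intro: finite_PiE)
qed

lemma finite_cube [simp]: "finite (cube (j :: 'n::finite \<Rightarrow> int) k)"
proof (rule finite_subset)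
  define S where "S = (\<Union>a. {j a - int k .. j a + int k})"
  show "cube j k \<subseteq> {i. \<forall>a. i a \<in> S}"
  proof (intro subsetI CollectI allI)
    fix i a assume "i \<in> cube j k"
    then have "i a \<in> {j a - int k .. j a + int k}" unfolding cube_def by (auto simp: abs_le_iff dest: spec[of _ a])
    then show "i a \<in> S" by (auto simp: S_def)
  qed
  show "finite {i :: 'n \<Rightarrow> int. \<forall>a. i a \<in> S}" by (intro finite_card_functions) (simp add: S_def)
qed

lemma center_in_cube [simp]: "j \<in> cube j k"
  by (simp add: cube_def)

lemma cube_mono: "k \<le> l \<Longrightarrow> cube j k \<subseteq> cube j l"
  by (auto simp: cube_def intro: order_trans[of _ "int k"])

lemma finite_subset_cube:
  fixes A :: "('n::finite \<Rightarrow> int) set"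
  assumes "finite A"
  obtains k where "A \<subseteq> cube j k"
proof
  \<comment> \<open>The sum of all coordinate distances bounds each single one.\<close>
  show "A \<subseteq> cube j (nat (\<Sum>i\<in>A. \<Sum>a\<in>UNIV. \<bar>i a - j a\<bar>))"
  proof
    fix i assume i: "i \<in> A"
    have "\<bar>i a - j a\<bar> \<le> (\<Sum>i\<in>A. \<Sum>a\<in>UNIV. \<bar>i a - j a\<bar>)" for a
    proof -
      have "\<bar>i a - j a\<bar> \<le> (\<Sum>a\<in>UNIV. \<bar>i a - j a\<bar>)"
        by (rule member_le_sum) auto
      also have "\<dots> \<le> (\<Sum>i\<in>A. \<Sum>a\<in>UNIV. \<bar>i a - j a\<bar>)"
        using i assms by (intro member_le_sum) (auto intro: sum_nonneg)
      finally show ?thesis .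
    qed
    moreover have "0 \<le> (\<Sum>i\<in>A. \<Sum>a\<in>UNIV. \<bar>i a - j a\<bar>)" by (intro sum_nonneg) auto
    ultimately show "i \<in> cube j (nat (\<Sum>i\<in>A. \<Sum>a\<in>UNIV. \<bar>i a - j a\<bar>))" by (simp add: cube_def)
  qed
qed

lemma cells_borel [simp]: "cells A \<in> sets borel"
  unfolding cells_def by (rule grid_vimage_borel)

lemma cells_bounded:
  fixes A :: "('n::finite \<Rightarrow> int) set"
  assumes "finite A"
  shows "bounded (cells A)"
proof -
  have "bounded (cells {i})" for i :: "'n \<Rightarrow> int"
  proof (rule bounded_subset[OF bounded_cbox])
    show "cells {i} \<subseteq> cbox (\<chi> a. of_int (i a)) (\<chi> a. of_int (i a) + 1)"
    proof
      fix x assume "x \<in> cells {i}"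
      then have "\<lfloor>x $ a\<rfloor> = i a" for a by (auto simp: cells_def grid_def fun_eq_iff)
      then have "of_int (i a) \<le> x $ a \<and> x $ a \<le> of_int (i a) + 1" for a
        using floor_correct[of "x $ a"] by simp
      then show "x \<in> cbox (\<chi> a. of_int (i a)) (\<chi> a. of_int (i a) + 1)" by (simp add: mem_box_cart)
    qed
  qed
  then have "bounded (\<Union>i\<in>A. cells {i})" using assms by (intro bounded_UN) auto
  also have "(\<Union>i\<in>A. cells {i}) = cells A" by (auto simp: cells_def)
  finally show ?thesis .
qed

lemma cells_shift: "cells (shift j A) = (\<lambda>x. x + (\<chi> a. of_int (j a))) ` cells A"
proof -
  let ?v = "(\<chi> a. of_int (j a)) :: real ^ 'a"
  have g: "grid 1 (x + ?v) = (\<lambda>a. grid 1 x a + j a)" for x by (simp add: grid_def)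
  have "x \<in> (\<lambda>x. x + ?v) ` cells A" if x: "x \<in> cells (shift j A)" for x
  proof -
    obtain i where i: "i \<in> A" "grid 1 x = (\<lambda>a. i a + j a)" using x by (auto simp: cells_def)
    have "grid 1 (x - ?v) = i"
    proof
      fix a show "grid 1 (x - ?v) a = i a" using fun_cong[OF i(2), of a] by (simp add: grid_def)
    qed
    then show ?thesis using i(1) by (intro image_eqI[of _ _ "x - ?v"]) (auto simp: cells_def)
  qed
  moreover have "x \<in> cells (shift j A)" if "x \<in> (\<lambda>x. x + ?v) ` cells A" for x
    using that g by (auto simp: cells_def)
  ultimately show ?thesis by blast
qed

text \<open>Coordinates at distance at most R have integer parts at distance at most the ceiling of
  R. Hence the points felt by an increment at cell j lie in a fixed cube around j.\<close>

lemma near_cells_subset: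
  assumes "\<exists>y\<in>cells {j}. dist x y \<le> R"
  shows "x \<in> cells (cube j (nat \<lceil>R\<rceil>))"
proof -
  obtain y where y: "y \<in> cells {j}" "dist x y \<le> R" using assms by blast
  have "\<bar>\<lfloor>x $ a\<rfloor> - j a\<bar> \<le> int (nat \<lceil>R\<rceil>)" for a
  proof -
    have "\<bar>x $ a - y $ a\<bar> \<le> R" using y(2) dist_vec_nth_le[of x a y] by (simp add: dist_real_def)
    moreover have "j a = \<lfloor>y $ a\<rfloor>" using y(1) by (auto simp: cells_def grid_def)
    ultimately show ?thesis by linarith
  qed
  then show ?thesis by (simp add: cells_def cube_def grid_def)
qed

lemma measurable_Diff_configurations:
  assumes "(C :: 'a::topological_space set) \<in> sets borel"
  shows "(\<lambda>X. X - C) \<in> configurations \<rightarrow>\<^sub>M configurations"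
proof (rule measurable_configurationsI)
  fix B :: "'a set" assume "B \<in> sets borel"
  then have "{X. finite X \<and> X \<inter> (B - C) = {}} \<in> sets configurations"
    using assms by (intro void_in_sets) auto
  also have "{X. finite X \<and> X \<inter> (B - C) = {}} = {X \<in> space configurations. (X - C) \<inter> B = {}}" by auto
  finally show "{X \<in> space configurations. (X - C) \<inter> B = {}} \<in> sets configurations" .
qed simp

section \<open>Stabilization of increments in L2\<close>

locale lattice_poisson = poisson_process M \<Phi>
  for M :: "'w measure" and \<Phi> :: "'w \<Rightarrow> (real ^ 'n) measure"
begin

abbreviation pt :: "('n \<Rightarrow> int) set \<Rightarrow> 'w \<Rightarrow> (real ^ 'n) set" where
  "pt A \<equiv> points (cells A)"

lemma pt_Un: "pt (A \<union> B) \<omega> = pt A \<omega> \<union> pt B \<omega>"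
  and pt_Int: "pt (A \<inter> B) \<omega> = pt A \<omega> \<inter> pt B \<omega>"
  and pt_Diff: "pt (A - B) \<omega> = pt A \<omega> - cells B"
  and pt_empty [simp]: "pt {} \<omega> = {}"
  and pt_UN: "pt A \<omega> = (\<Union>i\<in>A. pt {i} \<omega>)"
  by (auto simp: points_in_def cells_def)

lemma pt_mono: "A \<subseteq> B \<Longrightarrow> pt A \<omega> \<subseteq> pt B \<omega>"
  by (auto simp: points_in_def cells_def)

lemma finite_pt: "finite A \<Longrightarrow> \<omega> \<in> space M \<Longrightarrow> finite (pt A \<omega>)"
  by (intro finite_points cells_bounded) auto

lemma pt_measurable: "finite A \<Longrightarrow> pt A \<in> M \<rightarrow>\<^sub>M configurations"
  by (intro points_measurable cells_bounded) auto

text \<open>j may lie outside A, and the increment is then 0. This default covers the cells that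
  belong to no block.\<close>

definition incr :: "((real ^ 'n) set \<Rightarrow> real) \<Rightarrow> ('n \<Rightarrow> int) \<Rightarrow> ('n \<Rightarrow> int) set \<Rightarrow> 'w \<Rightarrow> real" where
  "incr F j A \<omega> = F (pt A \<omega>) - F (pt (A - {j}) \<omega>)"

lemma functional_measurable:
  assumes "F \<in> borel_measurable configurations" "finite A"
  shows "(\<lambda>\<omega>. F (pt A \<omega>)) \<in> borel_measurable M"
  using measurable_compose[OF pt_measurable[OF assms(2)] assms(1)] .

lemma incr_measurable:
  assumes "F \<in> borel_measurable configurations" "finite A"
  shows "incr F j A \<in> borel_measurable M"
  unfolding incr_def using assms by (intro borel_measurable_diff functional_measurable) auto

lemma law_points_translate:
  fixes F :: "(real ^ 'n) set \<Rightarrow> 'b::{second_countable_topology, banach}"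
  assumes F: "F \<in> borel_measurable configurations" and \<Lambda>: "\<Lambda> \<in> sets borel" "bounded \<Lambda>"
  shows "distr M borel (\<lambda>\<omega>. F (points ((\<lambda>x. x + v) ` \<Lambda>) \<omega>)) = distr M borel (\<lambda>\<omega>. F ((\<lambda>x. x + v) ` points \<Lambda> \<omega>))"
proof -
  have pre: "(\<lambda>x. x - v) -` \<Lambda> \<in> sets borel"
    using measurable_sets[of "\<lambda>x. x - v" borel borel \<Lambda>] \<Lambda>(1) by simp
  have "(\<lambda>x. x + v) ` \<Lambda> = (\<lambda>x. x - v) -` \<Lambda>" by (force simp: image_iff)
  then have \<Lambda>': "(\<lambda>x. x + v) ` \<Lambda> \<in> sets borel" "bounded ((\<lambda>x. x + v) ` \<Lambda>)"
    using pre bounded_translation[OF \<Lambda>(2), of v] by (simp_all add: add.commute)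
  have "distr M borel (\<lambda>\<omega>. F (points ((\<lambda>x. x + v) ` \<Lambda>) \<omega>))
      = distr (distr M configurations (points ((\<lambda>x. x + v) ` \<Lambda>))) borel F"
    by (subst distr_distr[OF F points_measurable[OF \<Lambda>']]) (simp add: comp_def)
  also have "\<dots> = distr (distr M configurations (\<lambda>\<omega>. (\<lambda>x. x + v) ` points \<Lambda> \<omega>)) borel F"
    by (simp only: law_translate[OF \<Lambda>])
  also have "\<dots> = distr M borel (\<lambda>\<omega>. F ((\<lambda>x. x + v) ` points \<Lambda> \<omega>))"
    by (subst distr_distr[OF F measurable_compose[OF points_measurable[OF \<Lambda>] measurable_translate_configurations]])
      (simp add: comp_def)
  finally show ?thesis .
qed

text \<open>The squared increment is a functional G of the configuration alone, and shifting region
  and cell together amounts in law to translating the configuration.\<close>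

lemma expectation_incr_shift:
  assumes F: "F \<in> borel_measurable configurations"
    and tr: "\<And>X v. finite X \<Longrightarrow> F ((\<lambda>x. x + v) ` X) = F X" and A: "finite A"
  shows "expectation (\<lambda>\<omega>. (incr F j (shift j A) \<omega>)\<^sup>2) = expectation (\<lambda>\<omega>. (incr F (\<lambda>_. 0) A \<omega>)\<^sup>2)"
proof -
  let ?v = "(\<chi> a. of_int (j a)) :: real ^ 'n" and ?z = "\<lambda>_. 0 :: int"
  let ?T = "\<lambda>X. (\<lambda>x. x + ?v) ` X"
  define G where "G X = (F X - F (X - cells {j}))\<^sup>2" for X
  have G: "G \<in> borel_measurable configurations"
    unfolding G_def
    using measurable_compose[OF measurable_Diff_configurations[OF cells_borel] F] F by measurable
  have cj: "cells {j} = ?T (cells {?z})" using cells_shift[of j "{?z}"] by simp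
  have meas: "(\<lambda>\<omega>. G (?T (pt A \<omega>))) \<in> borel_measurable M"
    using measurable_compose[OF measurable_compose[OF pt_measurable[OF A] measurable_translate_configurations] G] .
  have meas': "(\<lambda>\<omega>. G (points (?T (cells A)) \<omega>)) \<in> borel_measurable M"
    using A unfolding cells_shift[symmetric] by (intro functional_measurable[OF G]) auto
  have "expectation (\<lambda>\<omega>. (incr F j (shift j A) \<omega>)\<^sup>2) = expectation (\<lambda>\<omega>. G (points (?T (cells A)) \<omega>))"
    by (simp add: incr_def pt_Diff G_def cells_shift)
  also have "\<dots> = (\<integral>x. x \<partial>distr M borel (\<lambda>\<omega>. G (points (?T (cells A)) \<omega>)))"
    using meas' by (subst integral_distr) auto
  also have "\<dots> = (\<integral>x. x \<partial>distr M borel (\<lambda>\<omega>. G (?T (pt A \<omega>))))"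
    by (subst law_points_translate[OF G cells_borel cells_bounded[OF A]]) simp
  also have "\<dots> = expectation (\<lambda>\<omega>. G (?T (pt A \<omega>)))"
    using meas by (subst integral_distr) auto
  also have "\<dots> = expectation (\<lambda>\<omega>. (incr F ?z A \<omega>)\<^sup>2)"
  proof (rule Bochner_Integration.integral_cong[OF refl])
    fix \<omega> assume \<omega>: "\<omega> \<in> space M"
    have "?T (pt A \<omega>) - cells {j} = ?T (pt A \<omega> - cells {?z})"
      unfolding cj by (subst image_set_diff) (auto simp: inj_on_def)
    then show "G (?T (pt A \<omega>)) = (incr F ?z A \<omega>)\<^sup>2"
      using finite_pt[OF A \<omega>] by (simp add: G_def incr_def pt_Diff tr)
  qed
  finally show ?thesis .
qed

text \<open>What remains of supermodularity in L2, in a form that survives differences of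
  functionals. \<delta> k bounds the influence on the increment at j of everything beyond the cube
  of radius k; L is the crude bound for cells near an edge. The choice B = {} turns the last
  condition into a bound on second moments of increments.\<close>

definition stabilizing :: "((real ^ 'n) set \<Rightarrow> real) \<Rightarrow> real \<Rightarrow> (nat \<Rightarrow> real) \<Rightarrow> bool" where
  "stabilizing F L \<delta> \<longleftrightarrow> F \<in> borel_measurable configurations \<and>
     (\<forall>X v. finite X \<longrightarrow> F ((\<lambda>x. x + v) ` X) = F X) \<and>
     (\<forall>A. finite A \<longrightarrow> integrable M (\<lambda>\<omega>. (F (pt A \<omega>))\<^sup>2)) \<and> \<delta> \<longlonglongrightarrow> 0 \<and>
     (\<forall>j A B k. finite A \<longrightarrow> B \<subseteq> A \<longrightarrow> cube j k \<subseteq> B \<longrightarrow>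
        expectation (\<lambda>\<omega>. (incr F j A \<omega> - incr F j B \<omega>)\<^sup>2) \<le> \<delta> k) \<and>
     (\<forall>j A B. finite A \<longrightarrow> B \<subseteq> A \<longrightarrow> expectation (\<lambda>\<omega>. (incr F j A \<omega> - incr F j B \<omega>)\<^sup>2) \<le> L)"

lemma incr_square_integrable:
  assumes "F \<in> borel_measurable configurations" "\<And>A. finite A \<Longrightarrow> integrable M (\<lambda>\<omega>. (F (pt A \<omega>))\<^sup>2)" "finite A"
  shows "integrable M (\<lambda>\<omega>. (incr F j A \<omega>)\<^sup>2)"
  unfolding incr_def using assms by (intro integrable_square_diff functional_measurable) auto

text \<open>L is the limit of the second moments \<open>e k\<close> of the increment seen from the
  cube of radius k, and \<delta> k = L - e k. Every finite region lies in some cube, so its second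
  moment is at most L; a region containing the cube of radius k has second moment at least e
  k.\<close>

lemma tame_stabilizing:
  assumes f: "tame p R f" and meas: "f \<in> configurations \<rightarrow>\<^sub>M count_space UNIV"
    and tr: "\<And>X v. finite X \<Longrightarrow> f ((\<lambda>x. x + v) ` X) = f X"
  shows "\<exists>L \<delta>. stabilizing (\<lambda>X. real (f X)) L \<delta>"
proof -
  let ?F = "\<lambda>X. real (f X)" and ?z = "\<lambda>_. 0 :: int"
  have super: "f X + f Y \<le> f (X \<union> Y) + f (X \<inter> Y)" if "finite X" "finite Y" for X Y
    using f that unfolding tame_def by blast
  have mono: "f X \<le> f Y" if "finite Y" "X \<subseteq> Y" for X Y
    using f that unfolding tame_def by blast
  have remove: "f X \<le> f (X - C) + card {x \<in> X. \<exists>y\<in>C. dist x y \<le> R} ^ p" if "finite X" for X C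
    using f that unfolding tame_def by blast
  have f0: "f {} = 0" using f unfolding tame_def by blast
  have F: "?F \<in> borel_measurable configurations"
    using measurable_compose[OF meas, of real borel] by simp
  define N where "N A \<omega> = enn2real (emeasure (\<Phi> \<omega>) (cells A))" for A \<omega>
  have N_int: "integrable M (\<lambda>\<omega>. (N A \<omega> ^ p)\<^sup>2)" if "finite A" for A
    unfolding N_def power_mult[symmetric]
    by (rule count_moment_integrable[OF cells_borel cells_bounded[OF that]])
  have card_le: "real (card (pt A \<omega>)) \<le> N A \<omega>" if "finite A" "\<omega> \<in> space M" for A \<omega>
    unfolding N_def using that by (intro card_points_le cells_bounded) auto
  have incr0: "0 \<le> incr ?F j A \<omega>" if "finite A" "\<omega> \<in> space M" for j A \<omega>
    using mono[OF finite_pt[OF that], of "pt (A - {j}) \<omega>"] pt_mono[of "A - {j}" A \<omega>] by (simp add: incr_def)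
  have incr_mono: "incr ?F j B \<omega> \<le> incr ?F j A \<omega>" if "finite A" "B \<subseteq> A" "\<omega> \<in> space M" for j A B \<omega>
  proof (cases "j \<in> B")
    case True
    have fin: "finite (pt B \<omega>)" "finite (pt (A - {j}) \<omega>)"
      using that finite_subset by (auto intro!: finite_pt)
    \<comment> \<open>Monotonicity of increments is supermodularity for the points of B and of A -
      {j}.\<close>
    have "pt B \<omega> \<union> pt (A - {j}) \<omega> = pt A \<omega>"
      unfolding pt_Un[symmetric] using True that by (intro arg_cong[where f="\<lambda>A. pt A \<omega>"]) auto
    moreover have "pt B \<omega> \<inter> pt (A - {j}) \<omega> = pt (B - {j}) \<omega>"
      unfolding pt_Int[symmetric] using True that by (intro arg_cong[where f="\<lambda>A. pt A \<omega>"]) auto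
    ultimately show ?thesis using super[OF fin] by (simp add: incr_def)
  next
    case False
    then show ?thesis using incr0[OF that(1,3), of j] by (simp add: incr_def)
  qed
  define K where "K = nat \<lceil>R\<rceil>"
  \<comment> \<open>The bound does not depend on A, which keeps the second moments bounded along
    growing cubes.\<close>
  have incr_le: "incr ?F j A \<omega> \<le> N (cube j K) \<omega> ^ p" if "finite A" "\<omega> \<in> space M" for j A \<omega>
  proof -
    have "{x \<in> pt A \<omega>. \<exists>y\<in>cells {j}. dist x y \<le> R} \<subseteq> pt (cube j K) \<omega>"
      using near_cells_subset[of j _ R] by (auto simp: points_in_def K_def)
    then have "card {x \<in> pt A \<omega>. \<exists>y\<in>cells {j}. dist x y \<le> R} \<le> card (pt (cube j K) \<omega>)"
      using that by (intro card_mono finite_pt) auto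
    then have "card {x \<in> pt A \<omega>. \<exists>y\<in>cells {j}. dist x y \<le> R} ^ p \<le> card (pt (cube j K) \<omega>) ^ p"
      by (intro power_mono) auto
    then have "f (pt A \<omega>) \<le> f (pt A \<omega> - cells {j}) + card (pt (cube j K) \<omega>) ^ p"
      using remove[OF finite_pt[OF that], of "cells {j}"] by linarith
    then have "real (f (pt A \<omega>)) \<le> real (f (pt A \<omega> - cells {j}) + card (pt (cube j K) \<omega>) ^ p)"
      by (rule of_nat_mono)
    then have "incr ?F j A \<omega> \<le> real (card (pt (cube j K) \<omega>)) ^ p" by (simp add: incr_def pt_Diff)
    also have "\<dots> \<le> N (cube j K) \<omega> ^ p" using that by (intro power_mono card_le) auto
    finally show ?thesis .
  qed
  have F_int: "integrable M (\<lambda>\<omega>. (?F (pt A \<omega>))\<^sup>2)" if A: "finite A" for A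
  proof (rule Bochner_Integration.integrable_bound[OF N_int[OF A]])
    show "(\<lambda>\<omega>. (?F (pt A \<omega>))\<^sup>2) \<in> borel_measurable M"
      using functional_measurable[OF F A] by measurable
    show "AE \<omega> in M. norm ((?F (pt A \<omega>))\<^sup>2) \<le> norm ((N A \<omega> ^ p)\<^sup>2)"
      using AE_space
    proof eventually_elim
      case (elim \<omega>)
      have fin: "finite (pt A \<omega>)" using finite_pt[OF A elim] .
      have "card {x \<in> pt A \<omega>. \<exists>y\<in>pt A \<omega>. dist x y \<le> R} ^ p \<le> card (pt A \<omega>) ^ p"
        using fin by (intro power_mono card_mono) auto
      then have "f (pt A \<omega>) \<le> card (pt A \<omega>) ^ p"
        using remove[OF fin, of "pt A \<omega>"] f0 by simp
      then have "?F (pt A \<omega>) \<le> real (card (pt A \<omega>)) ^ p" by (metis of_nat_le_iff of_nat_power)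
      also have "\<dots> \<le> N A \<omega> ^ p" using A elim by (intro power_mono card_le) auto
      finally show ?case by (simp add: power_mono)
    qed
  qed
  note incr_int = incr_square_integrable[OF F F_int]
  note incr_meas = incr_measurable[OF F]
  define e where "e k = expectation (\<lambda>\<omega>. (incr ?F ?z (cube ?z k) \<omega>)\<^sup>2)" for k
  have e_shift: "expectation (\<lambda>\<omega>. (incr ?F j (cube j k) \<omega>)\<^sup>2) = e k" for j k
  proof -
    have "cube j k = shift j (cube ?z k)"
    proof (intro set_eqI iffI)
      fix i assume "i \<in> cube j k"
      then have "(\<lambda>a. i a - j a) \<in> cube ?z k" by (simp add: cube_def)
      then show "i \<in> shift j (cube ?z k)" by (intro image_eqI[of _ _ "\<lambda>a. i a - j a"]) auto
    qed (auto simp: cube_def)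
    then show ?thesis
      using expectation_incr_shift[OF F, of "cube ?z k" j] tr by (simp add: e_def)
  qed
  have sq_mono: "expectation (\<lambda>\<omega>. (incr ?F j B \<omega>)\<^sup>2) \<le> expectation (\<lambda>\<omega>. (incr ?F j A \<omega>)\<^sup>2)"
    if "finite A" "B \<subseteq> A" for j A B
    using that finite_subset[OF that(2,1)]
    by (intro integral_mono incr_int power_mono incr_mono incr0)
  have "incseq e"
    unfolding e_def by (intro incseq_SucI sq_mono finite_cube cube_mono) simp
  moreover have e_le: "e k \<le> expectation (\<lambda>\<omega>. (N (cube ?z K) \<omega> ^ p)\<^sup>2)" for k
    unfolding e_def by (intro integral_mono incr_int N_int power_mono incr_le incr0) auto
  ultimately obtain L where L: "e \<longlonglongrightarrow> L" "\<And>k. e k \<le> L"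
    using incseq_convergent[of e] by blast
  have sq_le: "expectation (\<lambda>\<omega>. (incr ?F j A \<omega>)\<^sup>2) \<le> L" if A: "finite A" for j A
  proof -
    obtain k where k: "A \<subseteq> cube j k" using finite_subset_cube[OF A] .
    show ?thesis using sq_mono[OF finite_cube k, of j] e_shift[of j k] L(2)[of k] by simp
  qed
  have diff: "expectation (\<lambda>\<omega>. (incr ?F j A \<omega> - incr ?F j B \<omega>)\<^sup>2)
      \<le> L - expectation (\<lambda>\<omega>. (incr ?F j B \<omega>)\<^sup>2)" if A: "finite A" and B: "B \<subseteq> A" for j A B
  proof -
    have fB: "finite B" using A B finite_subset by blast
    have "expectation (\<lambda>\<omega>. (incr ?F j A \<omega> - incr ?F j B \<omega>)\<^sup>2)
        \<le> expectation (\<lambda>\<omega>. (incr ?F j A \<omega>)\<^sup>2 - (incr ?F j B \<omega>)\<^sup>2)"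
    proof (rule integral_mono)
      show "integrable M (\<lambda>\<omega>. (incr ?F j A \<omega> - incr ?F j B \<omega>)\<^sup>2)"
        by (intro integrable_square_diff incr_meas incr_int A fB)
      show "integrable M (\<lambda>\<omega>. (incr ?F j A \<omega>)\<^sup>2 - (incr ?F j B \<omega>)\<^sup>2)"
        by (intro Bochner_Integration.integrable_diff incr_int A fB)
      fix \<omega> assume \<omega>: "\<omega> \<in> space M"
      have "(a - b)\<^sup>2 \<le> a\<^sup>2 - b\<^sup>2" if "0 \<le> b" "b \<le> a" for a b :: real
      proof -
        have "0 \<le> 2 * b * (a - b)" using that by simp
        then show ?thesis by (simp add: power2_eq_square algebra_simps)
      qed
      then show "(incr ?F j A \<omega> - incr ?F j B \<omega>)\<^sup>2 \<le> (incr ?F j A \<omega>)\<^sup>2 - (incr ?F j B \<omega>)\<^sup>2"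
        using incr0[OF fB \<omega>] incr_mono[OF A B \<omega>] by blast
    qed
    also have "\<dots> = expectation (\<lambda>\<omega>. (incr ?F j A \<omega>)\<^sup>2) - expectation (\<lambda>\<omega>. (incr ?F j B \<omega>)\<^sup>2)"
      using incr_int A fB by simp
    finally show ?thesis using sq_le[OF A, of j] by linarith
  qed
  have "stabilizing ?F L (\<lambda>k. L - e k)"
    unfolding stabilizing_def
  proof (intro conjI allI impI)
    show "(\<lambda>k. L - e k) \<longlonglongrightarrow> 0" using tendsto_diff[OF tendsto_const L(1), of L] by simp
  next
    fix j A B k assume "finite A" "B \<subseteq> A" "cube j k \<subseteq> (B :: ('n \<Rightarrow> int) set)"
    then show "expectation (\<lambda>\<omega>. (incr ?F j A \<omega> - incr ?F j B \<omega>)\<^sup>2) \<le> L - e k"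
      using diff[of A B j] sq_mono[of B "cube j k" j] e_shift[of j k] finite_subset[of B A] by simp
  next
    fix j A B assume AB: "finite A" "B \<subseteq> (A :: ('n \<Rightarrow> int) set)"
    have "0 \<le> expectation (\<lambda>\<omega>. (incr ?F j B \<omega>)\<^sup>2)" by (rule Bochner_Integration.integral_nonneg) simp
    then show "expectation (\<lambda>\<omega>. (incr ?F j A \<omega> - incr ?F j B \<omega>)\<^sup>2) \<le> L" using diff[OF AB, of j] by linarith
  qed (use F F_int tr in auto)
  then show ?thesis by blast
qed

lemma stabilizingD:
  assumes "stabilizing F L \<delta>"
  shows "F \<in> borel_measurable configurations" "finite X \<Longrightarrow> F ((\<lambda>x. x + v) ` X) = F X"
    "finite A \<Longrightarrow> integrable M (\<lambda>\<omega>. (F (pt A \<omega>))\<^sup>2)" "\<delta> \<longlonglongrightarrow> 0"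
    "finite A \<Longrightarrow> B \<subseteq> A \<Longrightarrow> cube j k \<subseteq> B \<Longrightarrow>
       expectation (\<lambda>\<omega>. (incr F j A \<omega> - incr F j B \<omega>)\<^sup>2) \<le> \<delta> k"
    "finite A \<Longrightarrow> B \<subseteq> A \<Longrightarrow> expectation (\<lambda>\<omega>. (incr F j A \<omega> - incr F j B \<omega>)\<^sup>2) \<le> L"
  using assms by (simp_all add: stabilizing_def)

text \<open>Here the minus sign is harmless: increments are linear in the functional and the square
  absorbs the signs.\<close>

lemma stabilizing_combine:
  assumes "stabilizing F1 L1 \<delta>1" "stabilizing F2 L2 \<delta>2" "stabilizing F3 L3 \<delta>3"
  shows "stabilizing (\<lambda>X. F1 X - F2 X + F3 X) (3 * (L1 + L2 + L3)) (\<lambda>k. 3 * (\<delta>1 k + \<delta>2 k + \<delta>3 k))"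
proof -
  \<comment> \<open>The right side minus the left side is (x + y)^2 + (x - z)^2 + (y + z)^2.\<close>
  have sq: "(x - y + z)\<^sup>2 \<le> 3 * (x\<^sup>2 + y\<^sup>2 + z\<^sup>2)" for x y z :: real
    using zero_le_power2[of "x + y"] zero_le_power2[of "x - z"] zero_le_power2[of "y + z"]
    by (simp add: power2_eq_square algebra_simps)
  note meas = assms[THEN stabilizingD(1)]
  note int = assms[THEN stabilizingD(3)]
  define F where "F X = F1 X - F2 X + F3 X" for X
  have F: "F \<in> borel_measurable configurations" unfolding F_def using meas by measurable
  have incr_F: "incr F j A \<omega> = incr F1 j A \<omega> - incr F2 j A \<omega> + incr F3 j A \<omega>" for j A \<omega>
    by (simp add: incr_def F_def)
  have le: "expectation (\<lambda>\<omega>. (incr F j A \<omega> - incr F j B \<omega>)\<^sup>2) \<le> 3 * (c1 + c2 + c3)"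
    if AB: "finite A" "B \<subseteq> A" and c: "expectation (\<lambda>\<omega>. (incr F1 j A \<omega> - incr F1 j B \<omega>)\<^sup>2) \<le> c1"
      "expectation (\<lambda>\<omega>. (incr F2 j A \<omega> - incr F2 j B \<omega>)\<^sup>2) \<le> c2"
      "expectation (\<lambda>\<omega>. (incr F3 j A \<omega> - incr F3 j B \<omega>)\<^sup>2) \<le> c3" for j A B c1 c2 c3
  proof -
    have fB: "finite B" using AB finite_subset by blast
    have di: "integrable M (\<lambda>\<omega>. (incr G j A \<omega> - incr G j B \<omega>)\<^sup>2)"
      if "G \<in> borel_measurable configurations" "\<And>A. finite A \<Longrightarrow> integrable M (\<lambda>\<omega>. (G (pt A \<omega>))\<^sup>2)" for G
      using that AB fB by (intro integrable_square_diff incr_measurable incr_square_integrable) auto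
    note d = di[OF meas(1) int(1)] di[OF meas(2) int(2)] di[OF meas(3) int(3)]
    let ?d = "\<lambda>G \<omega>. incr G j A \<omega> - incr G j B \<omega>"
    have pointwise: "(?d F \<omega>)\<^sup>2 \<le> 3 * ((?d F1 \<omega>)\<^sup>2 + (?d F2 \<omega>)\<^sup>2 + (?d F3 \<omega>)\<^sup>2)" for \<omega>
      using sq[of "?d F1 \<omega>" "?d F2 \<omega>" "?d F3 \<omega>"] by (simp add: incr_F algebra_simps)
    have "expectation (\<lambda>\<omega>. (?d F \<omega>)\<^sup>2) \<le> expectation (\<lambda>\<omega>. 3 * ((?d F1 \<omega>)\<^sup>2 + (?d F2 \<omega>)\<^sup>2 + (?d F3 \<omega>)\<^sup>2))"
    proof (rule integral_mono)
      have int_bound: "integrable M (\<lambda>\<omega>. 3 * ((?d F1 \<omega>)\<^sup>2 + (?d F2 \<omega>)\<^sup>2 + (?d F3 \<omega>)\<^sup>2))"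
        using d by (intro integrable_mult_right Bochner_Integration.integrable_add)
      then show "integrable M (\<lambda>\<omega>. (?d F \<omega>)\<^sup>2)"
      proof (rule Bochner_Integration.integrable_bound)
        show "(\<lambda>\<omega>. (?d F \<omega>)\<^sup>2) \<in> borel_measurable M"
          using AB fB F by (intro borel_measurable_power borel_measurable_diff incr_measurable)
        show "AE \<omega> in M. norm ((?d F \<omega>)\<^sup>2) \<le> norm (3 * ((?d F1 \<omega>)\<^sup>2 + (?d F2 \<omega>)\<^sup>2 + (?d F3 \<omega>)\<^sup>2))"
          using pointwise by (intro always_eventually allI) (simp add: abs_of_nonneg)
      qed
      show "integrable M (\<lambda>\<omega>. 3 * ((?d F1 \<omega>)\<^sup>2 + (?d F2 \<omega>)\<^sup>2 + (?d F3 \<omega>)\<^sup>2))" by (rule int_bound)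
    qed (rule pointwise)
    also have "\<dots> = 3 * (expectation (\<lambda>\<omega>. (?d F1 \<omega>)\<^sup>2) + expectation (\<lambda>\<omega>. (?d F2 \<omega>)\<^sup>2)
        + expectation (\<lambda>\<omega>. (?d F3 \<omega>)\<^sup>2))"
      using d by simp
    also have "\<dots> \<le> 3 * (c1 + c2 + c3)" by (intro mult_left_mono add_mono c) simp
    finally show ?thesis .
  qed
  have "stabilizing F (3 * (L1 + L2 + L3)) (\<lambda>k. 3 * (\<delta>1 k + \<delta>2 k + \<delta>3 k))"
    unfolding stabilizing_def
  proof (intro conjI allI impI)
    fix X v assume "finite (X :: (real ^ 'n) set)"
    then show "F ((\<lambda>x. x + v) ` X) = F X" using assms[THEN stabilizingD(2)] by (simp add: F_def)
  next
    fix A assume A: "finite (A :: ('n \<Rightarrow> int) set)"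
    show "integrable M (\<lambda>\<omega>. (F (pt A \<omega>))\<^sup>2)"
    proof (rule Bochner_Integration.integrable_bound)
      show "integrable M (\<lambda>\<omega>. 3 * ((F1 (pt A \<omega>))\<^sup>2 + (F2 (pt A \<omega>))\<^sup>2 + (F3 (pt A \<omega>))\<^sup>2))"
        using int[OF A] by (intro integrable_mult_right Bochner_Integration.integrable_add)
      show "(\<lambda>\<omega>. (F (pt A \<omega>))\<^sup>2) \<in> borel_measurable M"
        using A F by (intro borel_measurable_power functional_measurable)
      show "AE \<omega> in M. norm ((F (pt A \<omega>))\<^sup>2) \<le> norm (3 * ((F1 (pt A \<omega>))\<^sup>2 + (F2 (pt A \<omega>))\<^sup>2 + (F3 (pt A \<omega>))\<^sup>2))"
        using sq by (intro always_eventually allI) (simp add: F_def abs_of_nonneg)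
    qed
  next
    have "(\<lambda>k. 3 * (\<delta>1 k + \<delta>2 k + \<delta>3 k)) \<longlonglongrightarrow> 3 * (0 + 0 + 0)"
      by (intro tendsto_intros assms[THEN stabilizingD(4)])
    then show "(\<lambda>k. 3 * (\<delta>1 k + \<delta>2 k + \<delta>3 k)) \<longlonglongrightarrow> 0" by simp
  next
    fix j A B k assume "finite A" "B \<subseteq> A" "cube j k \<subseteq> (B :: ('n \<Rightarrow> int) set)"
    then show "expectation (\<lambda>\<omega>. (incr F j A \<omega> - incr F j B \<omega>)\<^sup>2) \<le> 3 * (\<delta>1 k + \<delta>2 k + \<delta>3 k)"
      by (intro le assms[THEN stabilizingD(5)])
  next
    fix j A B assume "finite A" "B \<subseteq> (A :: ('n \<Rightarrow> int) set)"
    then show "expectation (\<lambda>\<omega>. (incr F j A \<omega> - incr F j B \<omega>)\<^sup>2) \<le> 3 * (L1 + L2 + L3)"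
      by (intro le assms[THEN stabilizingD(6)])
  qed (rule F)
  then show ?thesis unfolding F_def .
qed

end

section \<open>Decomposition into blocks\<close>

lemma integrable_square_sum:
  fixes g :: "'t \<Rightarrow> 'a \<Rightarrow> real"
  assumes "finite T" "\<And>t. t \<in> T \<Longrightarrow> g t \<in> borel_measurable M" "\<And>t. t \<in> T \<Longrightarrow> integrable M (\<lambda>x. (g t x)\<^sup>2)"
  shows "integrable M (\<lambda>x. (\<Sum>t\<in>T. g t x)\<^sup>2)"
  using assms
proof (induction T rule: finite_induct)
  case (insert t T)
  have "integrable M (\<lambda>x. (g t x - (- (\<Sum>t\<in>T. g t x)))\<^sup>2)"
    using insert by (intro integrable_square_diff) auto
  then show ?case using insert.hyps by simp
qed simp

context lattice_poisson
begin

lemma incr_outside: "j \<notin> A \<Longrightarrow> incr F j A \<omega> = 0"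
  by (simp add: incr_def)

text \<open>Emptying cell j changes the approximation error by the difference between the increments
  seen from W and from the one block containing j. Cells of G lie deep inside their block and cost
  \<delta> k; each remaining cell costs at most L.\<close>

lemma variance_block_approximation:
  fixes blk :: "'t \<Rightarrow> ('n \<Rightarrow> int) set"
  assumes stab: "stabilizing F L \<delta>" and W: "finite W" "W \<noteq> {}"
    and T: "finite T" "disjoint_family_on blk T" "\<And>t. t \<in> T \<Longrightarrow> blk t \<subseteq> W"
    and G: "G \<subseteq> W" "\<And>j. j \<in> G \<Longrightarrow> \<exists>t\<in>T. cube j k \<subseteq> blk t"
  shows "integrable M (\<lambda>\<omega>. (F (pt W \<omega>) - (\<Sum>t\<in>T. F (pt (blk t) \<omega>)))\<^sup>2)" (is ?int)
    and "variance (\<lambda>\<omega>. F (pt W \<omega>) - (\<Sum>t\<in>T. F (pt (blk t) \<omega>)))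
    \<le> real (card G) * \<delta> k + real (card (W - G)) * L" (is ?var)
proof -
  note F = stabilizingD(1)[OF stab] and F_int = stabilizingD(3)[OF stab]
  have fblk: "finite (blk t)" if "t \<in> T" for t using T(3)[OF that] W(1) by (rule finite_subset)
  let ?X = "\<lambda>\<omega>. \<lambda>i\<in>W. pt {i} \<omega>"
  \<comment> \<open>The error as a function of the independent configurations in single
    cells.\<close>
  define \<Psi> where "\<Psi> x = F (\<Union>i\<in>W. x i) - (\<Sum>t\<in>T. F (\<Union>i\<in>blk t. x i))" for x :: "('n \<Rightarrow> int) \<Rightarrow> (real ^ 'n) set"
  have UN: "(\<Union>i\<in>A. ?X \<omega> i) = pt A \<omega>" if "A \<subseteq> W" for A \<omega>
    using that by (subst pt_UN) auto
  have UN_upd: "(\<Union>i\<in>A. ((?X \<omega>)(j := {})) i) = pt (A - {j}) \<omega>" if "A \<subseteq> W" for A j \<omega>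
    using that by (subst pt_UN[of "A - {j}"]) (auto split: if_splits)
  have \<Psi>X: "\<Psi> (?X \<omega>) = F (pt W \<omega>) - (\<Sum>t\<in>T. F (pt (blk t) \<omega>))" for \<omega>
    unfolding \<Psi>_def
    by (intro arg_cong2[where f="(-)"] sum.cong refl) (simp_all only: UN[OF order_refl] UN[OF T(3)])
  have \<Psi>_upd: "\<Psi> ((?X \<omega>)(j := {})) = F (pt (W - {j}) \<omega>) - (\<Sum>t\<in>T. F (pt (blk t - {j}) \<omega>))" for \<omega> j
    unfolding \<Psi>_def
    by (intro arg_cong2[where f="(-)"] sum.cong refl) (simp_all only: UN_upd[OF order_refl] UN_upd[OF T(3)])
  have sq: "integrable M (\<lambda>\<omega>. (F (pt (W - Z) \<omega>) - (\<Sum>t\<in>T. F (pt (blk t - Z) \<omega>)))\<^sup>2)" for Z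
    using W T(1) fblk
    by (intro integrable_square_diff integrable_square_sum borel_measurable_sum functional_measurable[OF F] F_int) auto
  show ?int using sq[of "{}"] by simp
  have \<Psi>_meas: "\<Psi> \<in> borel_measurable (PiM W (\<lambda>_. configurations))"
    unfolding \<Psi>_def using W(1) T(3) fblk
    by (intro borel_measurable_diff borel_measurable_sum
        measurable_compose[OF measurable_UN_configurations F]) auto
  have indep: "indep_vars (\<lambda>_. configurations) (\<lambda>i. pt {i}) W"
    by (intro points_indep W cells_borel cells_bounded) (auto simp: disjoint_family_on_def cells_def)
  \<comment> \<open>The reference value of every coordinate is the empty configuration.\<close>
  have "variance (\<lambda>\<omega>. \<Psi> (?X \<omega>)) \<le> (\<Sum>j\<in>W. expectation (\<lambda>\<omega>. (\<Psi> (?X \<omega>) - \<Psi> ((?X \<omega>)(j := {})))\<^sup>2))"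
  proof (rule efron_stein[OF W indep _ \<Psi>_meas])
    show "integrable M (\<lambda>\<omega>. (\<Psi> (?X \<omega>))\<^sup>2)" unfolding \<Psi>X using sq[of "{}"] by simp
    show "integrable M (\<lambda>\<omega>. (\<Psi> ((?X \<omega>)(j := {})))\<^sup>2)" for j unfolding \<Psi>_upd by (rule sq)
  qed simp
  also have "\<dots> \<le> (\<Sum>j\<in>W. if j \<in> G then \<delta> k else L)"
  proof (rule sum_mono)
    fix j assume j: "j \<in> W"
    have diff: "\<Psi> (?X \<omega>) - \<Psi> ((?X \<omega>)(j := {})) = incr F j W \<omega> - (\<Sum>t\<in>T. incr F j (blk t) \<omega>)" for \<omega>
      unfolding \<Psi>X \<Psi>_upd incr_def by (simp add: sum_subtractf)
    show "expectation (\<lambda>\<omega>. (\<Psi> (?X \<omega>) - \<Psi> ((?X \<omega>)(j := {})))\<^sup>2) \<le> (if j \<in> G then \<delta> k else L)"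
    proof (cases "\<exists>t\<in>T. j \<in> blk t")
      case True
      then obtain t where t: "t \<in> T" "j \<in> blk t" by blast
      have out: "j \<notin> blk u" if "u \<in> T" "u \<noteq> t" for u
        using T(2) t that unfolding disjoint_family_on_def by blast
      have "(\<Sum>u\<in>T. incr F j (blk u) \<omega>) = (\<Sum>u\<in>{t}. incr F j (blk u) \<omega>)" for \<omega>
        using T(1) t out by (intro sum.mono_neutral_right) (auto simp: incr_outside)
      then have eq: "\<Psi> (?X \<omega>) - \<Psi> ((?X \<omega>)(j := {})) = incr F j W \<omega> - incr F j (blk t) \<omega>" for \<omega>
        unfolding diff by simp
      have "cube j k \<subseteq> blk t" if jG: "j \<in> G"
      proof -
        obtain u where u: "u \<in> T" "cube j k \<subseteq> blk u" using G(2)[OF jG] by blast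
        then have "j \<in> blk u" using center_in_cube by blast
        then show ?thesis using out u by blast
      qed
      then show ?thesis
        unfolding eq using stabilizingD(5)[OF stab W(1) T(3)[OF t(1)], of j k] stabilizingD(6)[OF stab W(1) T(3)[OF t(1)], of j]
        by auto
    next
      case False
      \<comment> \<open>A cell in no block is compared with the empty region, where the increment is
        0.\<close>
      then have eq: "\<Psi> (?X \<omega>) - \<Psi> ((?X \<omega>)(j := {})) = incr F j W \<omega> - incr F j {} \<omega>" for \<omega>
        unfolding diff by (simp add: incr_outside)
      have "j \<notin> G"
      proof
        assume "j \<in> G"
        then obtain u where "u \<in> T" "cube j k \<subseteq> blk u" using G(2) by blast
        then show False using False center_in_cube by blast
      qed
      then show ?thesis unfolding eq using stabilizingD(6)[OF stab W(1), of "{}" j] by simp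
    qed
  qed
  also have "\<dots> = real (card G) * \<delta> k + real (card (W - G)) * L"
    using W(1) G(1) by (simp add: sum.If_cases Int_absorb1 Diff_eq)
  finally show ?var unfolding \<Psi>X .
qed

lemma law_functional_translate:
  assumes F: "F \<in> borel_measurable configurations" "\<And>X v. finite X \<Longrightarrow> F ((\<lambda>x. x + v) ` X) = F X"
    and \<Lambda>: "\<Lambda> \<in> sets borel" "bounded \<Lambda>"
  shows "distr M borel (\<lambda>\<omega>. F (points ((\<lambda>x. x + v) ` \<Lambda>) \<omega>)) = distr M borel (\<lambda>\<omega>. F (points \<Lambda> \<omega>) :: real)"
  unfolding law_points_translate[OF F(1) \<Lambda>]
  by (intro distr_cong refl) (simp add: F(2) finite_points[OF \<Lambda>])

end

section \<open>Boxes, blocks and their cores\<close>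

definition lattice_box :: "nat \<Rightarrow> ('n \<Rightarrow> int) set" where
  "lattice_box n = {i. \<forall>a. i a \<in> {0..<int n}}"

definition block :: "nat \<Rightarrow> ('n \<Rightarrow> int) \<Rightarrow> ('n \<Rightarrow> int) set" where
  "block l t = shift (\<lambda>a. int l * t a) (lattice_box l)"

lemma finite_lattice_box [simp]: "finite (lattice_box n :: ('n::finite \<Rightarrow> int) set)"
  and card_lattice_box: "card (lattice_box n :: ('n::finite \<Rightarrow> int) set) = n ^ CARD('n)"
  unfolding lattice_box_def by (simp_all add: finite_card_functions del: atLeastLessThan_iff)

lemma in_block_iff: "i \<in> block l t \<longleftrightarrow> (\<forall>a. int l * t a \<le> i a \<and> i a < int l * t a + int l)"
proof
  assume *: "\<forall>a. int l * t a \<le> i a \<and> i a < int l * t a + int l"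
  have "(\<lambda>a. i a - int l * t a) \<in> lattice_box l"
    unfolding lattice_box_def mem_Collect_eq
  proof
    fix a show "i a - int l * t a \<in> {0..<int l}" using *[rule_format, of a] by simp
  qed
  then show "i \<in> block l t" unfolding block_def by (intro image_eqI[of _ _ "\<lambda>a. i a - int l * t a"]) auto
qed (auto simp: block_def lattice_box_def)

text \<open>Integer division recovers the index of a block from any of its cells, whence distinct
  blocks are disjoint.\<close>

lemma block_div:
  assumes "i \<in> block l t"
  shows "t = (\<lambda>a. i a div int l)"
proof
  fix a
  have "int l * t a \<le> i a" "i a < int l * t a + int l" using assms by (auto simp: in_block_iff)
  then show "t a = i a div int l" by (intro int_div_pos_eq[symmetric, of _ _ _ "i a - int l * t a"]) auto
qed

lemma block_subset_lattice_box:
  assumes "t \<in> lattice_box m" "l * m \<le> n"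
  shows "block l t \<subseteq> lattice_box n"
proof
  fix i assume i: "i \<in> block l t"
  show "i \<in> lattice_box n"
    unfolding lattice_box_def mem_Collect_eq
  proof
    fix a
    have t: "0 \<le> t a" "t a + 1 \<le> int m" using assms(1) by (auto simp: lattice_box_def dest: spec[of _ a])
    have ia: "int l * t a \<le> i a" "i a < int l * t a + int l" using i by (auto simp: in_block_iff)
    have "int l * t a + int l = int l * (t a + 1)" by (simp add: algebra_simps)
    also have "\<dots> \<le> int l * int m" using t by (intro mult_left_mono) auto
    also have "\<dots> \<le> int n" using assms(2) by (metis of_nat_le_iff of_nat_mult)
    finally show "i a \<in> {0..<int n}" using t ia by (auto intro: order_trans[of _ "int l * t a"])
  qed
qed

text \<open>The cells whose cube of radius k fits into their block. The condition is imposed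
  coordinate by coordinate, so counting is one-dimensional. The half-open range keeps j - k at least
  l * u and j + k at most l * u + l - 1.\<close>

definition core :: "nat \<Rightarrow> nat \<Rightarrow> nat \<Rightarrow> ('n \<Rightarrow> int) set" where
  "core k l m = {i. \<forall>a. i a \<in> (\<Union>u\<in>{0..<int m}. {int l * u + int k ..< int l * u + int l - int k})}"

lemma card_core:
  assumes "2 * k \<le> l" "0 < l"
  shows "finite (core k l m :: ('n::finite \<Rightarrow> int) set)"
    "card (core k l m :: ('n::finite \<Rightarrow> int) set) = (m * (l - 2 * k)) ^ CARD('n)"
proof -
  let ?S = "\<lambda>u. {int l * u + int k ..< int l * u + int l - int k}"
  have "x div int l = u" if "x \<in> ?S u" for x u
    using that by (intro int_div_pos_eq[of _ _ _ "x - int l * u"]) auto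
  then have disj: "?S u \<inter> ?S u' = {}" if "u \<noteq> u'" for u u' using that by blast
  have "card (\<Union>u\<in>{0..<int m}. ?S u) = (\<Sum>u\<in>{0..<int m}. card (?S u))"
    using disj by (intro card_UN_disjoint) auto
  also have "card (?S u) = l - 2 * k" for u
  proof -
    have "card (?S u) = nat (int l - 2 * int k)" by (simp add: algebra_simps)
    then show ?thesis using assms by linarith
  qed
  then have "(\<Sum>u\<in>{0..<int m}. card (?S u)) = m * (l - 2 * k)" by simp
  finally have card: "card (\<Union>u\<in>{0..<int m}. ?S u) = m * (l - 2 * k)" .
  have fin: "finite (\<Union>u\<in>{0..<int m}. ?S u)" by simp
  show "finite (core k l m :: ('n::finite \<Rightarrow> int) set)"
    "card (core k l m :: ('n::finite \<Rightarrow> int) set) = (m * (l - 2 * k)) ^ CARD('n)"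
    using finite_card_functions[OF fin, where 'n='n] unfolding card core_def .
qed

lemma core_block:
  assumes "j \<in> core k l m"
  obtains t where "t \<in> lattice_box m" "cube j k \<subseteq> block l t"
proof -
  have "\<forall>a. \<exists>u. u \<in> {0..<int m} \<and> j a \<in> {int l * u + int k ..< int l * u + int l - int k}"
    using assms unfolding core_def by blast
  then obtain t where t: "\<And>a. t a \<in> {0..<int m}"
      "\<And>a. j a \<in> {int l * t a + int k ..< int l * t a + int l - int k}" by metis
  have "i \<in> block l t" if "i \<in> cube j k" for i
    unfolding in_block_iff
  proof
    fix a
    have "\<bar>i a - j a\<bar> \<le> int k" using that by (simp add: cube_def)
    then show "int l * t a \<le> i a \<and> i a < int l * t a + int l" using t(2)[of a] by auto
  qed
  then show ?thesis using t(1) by (intro that[of t]) (auto simp: lattice_box_def)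
qed

text \<open>n div l and n / l differ by less than 1, whence the error bound 1 / n.\<close>

lemma tendsto_div_over:
  assumes "0 < l"
  shows "(\<lambda>n. real (n div l) / real n) \<longlonglongrightarrow> 1 / real l"
proof -
  have "(\<lambda>n. real (n div l) / real n - 1 / real l) \<longlonglongrightarrow> 0"
  proof (rule Lim_null_comparison)
    show "\<forall>\<^sub>F n in sequentially. norm (real (n div l) / real n - 1 / real l) \<le> 1 / real n"
      using eventually_gt_at_top[of 0]
    proof eventually_elim
      case (elim n)
      have n: "real n = real l * real (n div l) + real (n mod l)"
        by (metis mult_div_mod_eq of_nat_add of_nat_mult)
      have "real (n div l) / real n - 1 / real l = - (real (n mod l) / (real l * real n))"
        using elim assms n by (simp add: field_simps)
      moreover have "real (n mod l) / (real l * real n) \<le> real l / (real l * real n)"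
        using assms by (intro divide_right_mono) auto
      ultimately show ?case using assms by simp
    qed
    show "(\<lambda>n. 1 / real n) \<longlonglongrightarrow> 0" by (rule lim_1_over_n)
  qed
  then show ?thesis by (simp add: LIM_zero_iff)
qed

section \<open>The central limit theorem on lattice boxes\<close>

context lattice_poisson
begin

text \<open>The blocks are disjoint translates of one box, so their functionals are independent with
  a common law. The divisor c stays free because it will be dictated by the window, not by the
  blocks.\<close>

lemma block_sum_char:
  assumes stab: "stabilizing F L \<delta>" and m: "0 < m" and l: "0 < l"
  defines "\<mu> \<equiv> distr M borel (\<lambda>\<omega>. F (pt (lattice_box l) \<omega>) - expectation (\<lambda>\<omega>. F (pt (lattice_box l) \<omega>)))"
  shows "char (distr M borel (\<lambda>\<omega>. \<Sum>t\<in>lattice_box m. (F (pt (block l t) \<omega>) - expectation (\<lambda>\<omega>. F (pt (block l t) \<omega>))) / c)) s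
    = char \<mu> (s / c) ^ (m ^ CARD('n))"
proof -
  note F = stabilizingD(1)[OF stab] and tr = stabilizingD(2)[OF stab]
  have fin: "finite (block l t)" for t :: "'n \<Rightarrow> int" by (simp add: block_def)
  let ?Y = "\<lambda>t \<omega>. F (pt (block l t) \<omega>)"
  define E where "E = expectation (\<lambda>\<omega>. F (pt (lattice_box l) \<omega>))"
  define h where "h x = (x - E) / c" for x :: real
  have h [measurable]: "h \<in> borel_measurable borel" unfolding h_def by measurable
  have law: "distr M borel (?Y t) = distr M borel (\<lambda>\<omega>. F (pt (lattice_box l) \<omega>))" for t
    unfolding block_def cells_shift by (intro law_functional_translate F tr cells_borel cells_bounded) auto
  have Em: "expectation (?Y t) = E" for t
  proof -
    have "expectation (?Y t) = (\<integral>x. x \<partial>distr M borel (?Y t))"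
      using functional_measurable[OF F fin] by (subst integral_distr) auto
    also have "\<dots> = E" unfolding law E_def
      using functional_measurable[OF F finite_lattice_box] by (subst integral_distr) auto
    finally show ?thesis .
  qed
  have ne: "lattice_box m \<noteq> ({} :: ('n \<Rightarrow> int) set)"
    using m by (auto simp: lattice_box_def intro!: exI[of _ "\<lambda>_. 0"])
  have "indep_vars (\<lambda>_. configurations) (\<lambda>t. pt (block l t)) (lattice_box m)"
  proof (intro points_indep ne finite_lattice_box cells_borel cells_bounded fin)
    show "disjoint_family_on (\<lambda>t. cells (block l t)) (lattice_box m)"
      unfolding disjoint_family_on_def cells_def using block_div by blast
  qed
  then have "indep_vars (\<lambda>_. borel) (\<lambda>t \<omega>. h (F (pt (block l t) \<omega>))) (lattice_box m)"
    by (rule indep_vars_compose2) (use measurable_compose[OF F h] in auto)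
  then have "char (distr M borel (\<lambda>\<omega>. \<Sum>t\<in>lattice_box m. h (?Y t \<omega>))) s = (\<Prod>t\<in>lattice_box m. char (distr M borel (\<lambda>\<omega>. h (?Y t \<omega>))) s)"
    by (rule char_distr_sum)
  also have "\<dots> = (\<Prod>t\<in>(lattice_box m :: ('n \<Rightarrow> int) set). char \<mu> (s / c))"
  proof (rule prod.cong[OF refl])
    fix t :: "'n \<Rightarrow> int"
    have "distr M borel (\<lambda>\<omega>. h (?Y t \<omega>)) = distr (distr M borel (?Y t)) borel h"
      using functional_measurable[OF F fin] by (subst distr_distr) (auto simp: comp_def)
    also have "\<dots> = distr M borel (\<lambda>\<omega>. h (F (pt (lattice_box l) \<omega>)))"
      unfolding law using functional_measurable[OF F finite_lattice_box] by (subst distr_distr) (auto simp: comp_def)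
    finally have "char (distr M borel (\<lambda>\<omega>. h (?Y t \<omega>))) s = expectation (\<lambda>\<omega>. iexp (s * h (F (pt (lattice_box l) \<omega>))))"
      unfolding char_def using functional_measurable[OF F finite_lattice_box]
      by (simp only:) (subst integral_distr, auto)
    also have "\<dots> = char \<mu> (s / c)"
      unfolding char_def \<mu>_def using functional_measurable[OF F finite_lattice_box]
      by (subst integral_distr) (auto simp: h_def E_def)
    finally show "char (distr M borel (\<lambda>\<omega>. h (?Y t \<omega>))) s = char \<mu> (s / c)" .
  qed
  finally show ?thesis by (simp add: h_def Em card_lattice_box)
qed

text \<open>The limit in n is taken before the limit in k: for a fixed block side the block sum
  becomes Gaussian, and for large n its normalised squared L2 distance to the window functional is
  at most \<open>b k\<close>.\<close>

lemma stabilizing_clt: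
  assumes stab: "stabilizing F L \<delta>"
  shows "\<exists>v\<ge>0. \<forall>s. (\<lambda>n. char (distr M borel
      (\<lambda>\<omega>. (F (pt (lattice_box n) \<omega>) - expectation (\<lambda>\<omega>. F (pt (lattice_box n) \<omega>))) / real n powr (real CARD('n) / 2))) s)
    \<longlonglongrightarrow> exp (- (v * s\<^sup>2 / 2))"
proof -
  note F = stabilizingD(1)[OF stab] and F_int = stabilizingD(3)[OF stab]
  note F_meas = functional_measurable[OF F]
  let ?d = "CARD('n)"
  \<comment> \<open>Margins of width k in blocks of side (k + 1)^2: the width tends to infinity, so
    \<delta> k vanishes, yet the margins fill a vanishing fraction of each block.\<close>
  define l where "l k = (k + 1)\<^sup>2" for k :: nat
  have l: "0 < l k" "2 * k \<le> l k" for k by (auto simp: l_def power2_eq_square)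
  define c where "c n = real n powr (real ?d / 2)" for n
  have c2: "(c n)\<^sup>2 = real n ^ ?d" if "0 < n" for n
  proof -
    have "(c n)\<^sup>2 = real n powr (real ?d)" using that by (simp add: c_def power2_eq_square powr_add[symmetric])
    then show ?thesis using that by (simp add: powr_realpow)
  qed
  define E where "E A = expectation (\<lambda>\<omega>. F (pt A \<omega>))" for A
  define X where "X n \<omega> = (F (pt (lattice_box n) \<omega>) - E (lattice_box n)) / c n" for n \<omega>
  define Y where "Y k n \<omega> = (\<Sum>t\<in>lattice_box (n div l k). (F (pt (block (l k) t) \<omega>) - E (block (l k) t)) / c n)" for k n \<omega>
  define \<mu> where "\<mu> k = distr M borel (\<lambda>\<omega>. F (pt (lattice_box (l k)) \<omega>) - E (lattice_box (l k)))" for k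
  define var where "var k = variance (\<lambda>\<omega>. F (pt (lattice_box (l k)) \<omega>))" for k
  \<comment> \<open>The variance of one block per unit volume.\<close>
  define v where "v k = var k * (1 / real (l k)) ^ ?d" for k
  \<comment> \<open>\<delta> k pays for the core and L for the fraction outside it; 1 / Suc k makes
    room for a strict inequality in the limit over n.\<close>
  define b where "b k = \<delta> k + L * (1 - (real (l k - 2 * k) / real (l k)) ^ ?d) + 1 / real (Suc k)" for k
  have finblk: "finite (block (l k) t)" for k and t :: "'n \<Rightarrow> int" by (simp add: block_def)
  have F1: "integrable M (\<lambda>\<omega>. F (pt A \<omega>))" if "finite A" for A
    using integrable_of_square[OF prob_space_axioms F_meas[OF that] F_int[OF that]] .
  have X_meas: "X n \<in> borel_measurable M" for n unfolding X_def using F_meas[OF finite_lattice_box] by measurable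
  have Y_meas: "Y k n \<in> borel_measurable M" for k n
    unfolding Y_def using F_meas[OF finblk] by measurable
  have \<delta>0: "0 \<le> \<delta> k" for k
  proof -
    have "0 \<le> expectation (\<lambda>\<omega>. (incr F (\<lambda>_. 0) (cube (\<lambda>_. 0) k) \<omega> - incr F (\<lambda>_. 0) (cube (\<lambda>_. 0) k) \<omega>)\<^sup>2)"
      by simp
    also have "\<dots> \<le> \<delta> k" by (rule stabilizingD(5)[OF stab finite_cube order_refl order_refl])
    finally show ?thesis .
  qed
  have L0: "0 \<le> L"
  proof -
    have "0 \<le> expectation (\<lambda>\<omega>. (incr F (\<lambda>_. 0) {} \<omega> - incr F (\<lambda>_. 0) {} \<omega>)\<^sup>2)"
      by simp
    also have "\<dots> \<le> L" by (rule stabilizingD(6)[OF stab finite.emptyI order_refl])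
    finally show ?thesis .
  qed
  have box_ne: "lattice_box n \<noteq> ({} :: ('n \<Rightarrow> int) set)" if "0 < n" for n
    using that by (auto simp: lattice_box_def intro!: exI[of _ "\<lambda>_. 0"])
  \<comment> \<open>With no blocks and an empty core the approximation bound is a plain variance
    bound of L per cell.\<close>
  have var_le: "var k \<le> real (l k) ^ ?d * L" for k
    using variance_block_approximation(2)[OF stab finite_lattice_box box_ne[OF l(1)],
        where T="{} :: unit set" and G="{}" and blk="\<lambda>_. {}"]
    by (simp add: var_def card_lattice_box disjoint_family_on_def)
  have var0: "0 \<le> var k" for k unfolding var_def by (rule variance_positive)
  have v: "0 \<le> v k" "v k \<le> L" for k
  proof -
    show "0 \<le> v k" using var0 by (simp add: v_def)
    have "v k \<le> (real (l k) ^ ?d * L) * (1 / real (l k)) ^ ?d"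
      unfolding v_def using var_le[of k] by (intro mult_right_mono) auto
    also have "\<dots> = L" using l(1)[of k] by (simp add: power_divide)
    finally show "v k \<le> L" .
  qed
  have close: "eventually (\<lambda>n. \<forall>s. cmod (char (distr M borel (X n)) s - char (distr M borel (Y k n)) s)
      \<le> \<bar>s\<bar> * sqrt (b k)) sequentially" for k
  proof -
    \<comment> \<open>The variance bound divided by the volume n^N, before the limit in n.\<close>
    define g where "g n = \<delta> k + L * (1 - (real (n div l k) / real n * real (l k - 2 * k)) ^ ?d)" for n
    have "g \<longlonglongrightarrow> \<delta> k + L * (1 - (1 / real (l k) * real (l k - 2 * k)) ^ ?d)"
      unfolding g_def by (intro tendsto_intros tendsto_div_over l)
    moreover have "\<delta> k + L * (1 - (1 / real (l k) * real (l k - 2 * k)) ^ ?d) < b k" by (simp add: b_def)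
    ultimately have "eventually (\<lambda>n. g n < b k) sequentially" by (rule order_tendstoD(2))
    then show ?thesis using eventually_gt_at_top[of 0]
    proof eventually_elim
      case (elim n)
      define m where "m = n div l k"
      define T where "T = (lattice_box m :: ('n \<Rightarrow> int) set)"
      define W where "W = (lattice_box n :: ('n \<Rightarrow> int) set)"
      define G where "G = (core k (l k) m :: ('n \<Rightarrow> int) set)"
      define Rm where "Rm \<omega> = F (pt W \<omega>) - (\<Sum>t\<in>T. F (pt (block (l k) t) \<omega>))" for \<omega>
      have blkW: "block (l k) t \<subseteq> W" if "t \<in> T" for t
        using that unfolding T_def W_def by (rule block_subset_lattice_box) (simp add: m_def)
      have cG: "\<exists>t\<in>T. cube j k \<subseteq> block (l k) t" if "j \<in> G" for j
        using core_block[OF that[unfolded G_def]] unfolding T_def by metis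
      have GW: "G \<subseteq> W" using cG blkW center_in_cube by blast
      have disj: "disjoint_family_on (block (l k)) T"
        unfolding disjoint_family_on_def using block_div by blast
      have finWT: "finite W" "W \<noteq> {}" "finite T" unfolding W_def T_def using box_ne elim by auto
      note approx = variance_block_approximation[OF stab finWT disj blkW GW cG, folded Rm_def]
      have fG: "finite G" using GW finWT(1) by (rule finite_subset)
      have cardG: "card G = (m * (l k - 2 * k)) ^ ?d" unfolding G_def using l by (intro card_core) auto
      have cardW: "card W = n ^ ?d" unfolding W_def by (rule card_lattice_box)
      have card_le: "card G \<le> card W" using GW finWT(1) by (rule card_mono[rotated])
      have n0: "0 < real n ^ ?d" using elim by simp
      have "variance Rm \<le> real (card G) * \<delta> k + real (card (W - G)) * L" by (rule approx(2))
      also have "real (card (W - G)) = real n ^ ?d - (real m * real (l k - 2 * k)) ^ ?d"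
        using card_Diff_subset[OF fG GW] card_le cardG cardW by (simp add: of_nat_diff)
      also have "real (card G) * \<delta> k \<le> real n ^ ?d * \<delta> k"
        using card_le cardW \<delta>0 by (intro mult_right_mono) (metis of_nat_le_iff of_nat_power)+
      also have "real n ^ ?d * \<delta> k + (real n ^ ?d - (real m * real (l k - 2 * k)) ^ ?d) * L = real n ^ ?d * g n"
        using elim(2) by (simp add: g_def m_def field_simps)
      also have "\<dots> \<le> real n ^ ?d * b k" using elim by (intro mult_left_mono) auto
      finally have varR: "variance Rm \<le> real n ^ ?d * b k" by simp
      have intR: "integrable M (\<lambda>\<omega>. (Rm \<omega>)\<^sup>2)" by (rule approx(1))
      have ER: "expectation Rm = E W - (\<Sum>t\<in>T. E (block (l k) t))"
        unfolding Rm_def E_def using F1 finblk finWT by simp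
      \<comment> \<open>Both sums have the same divisor c n, so their difference is the centred
        remainder.\<close>
      have XY: "X n \<omega> - Y k n \<omega> = (Rm \<omega> - expectation Rm) / c n" for \<omega>
        unfolding X_def Y_def ER Rm_def m_def[symmetric] T_def[symmetric] W_def[symmetric]
        by (simp add: sum_subtractf diff_divide_distrib sum_divide_distrib)
      have Rm_meas: "Rm \<in> borel_measurable M"
        unfolding Rm_def using F_meas finblk finWT(1) by measurable
      have "integrable M (\<lambda>\<omega>. (Rm \<omega> - expectation Rm)\<^sup>2)"
        by (intro integrable_square_diff Rm_meas intR) auto
      then have intXY: "integrable M (\<lambda>\<omega>. (X n \<omega> - Y k n \<omega>)\<^sup>2)"
        unfolding XY power_divide by simp
      have "expectation (\<lambda>\<omega>. (X n \<omega> - Y k n \<omega>)\<^sup>2) = variance Rm / (c n)\<^sup>2"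
        unfolding XY power_divide by simp
      also have "\<dots> \<le> b k" using varR n0 elim(2) by (simp add: c2 field_simps)
      finally have le: "expectation (\<lambda>\<omega>. (X n \<omega> - Y k n \<omega>)\<^sup>2) \<le> b k" .
      show ?case
      proof
        fix s
        have "cmod (char (distr M borel (X n)) s - char (distr M borel (Y k n)) s)
          \<le> \<bar>s\<bar> * sqrt (expectation (\<lambda>\<omega>. (X n \<omega> - Y k n \<omega>)\<^sup>2))"
          by (rule char_diff_le[OF X_meas Y_meas intXY])
        also have "\<dots> \<le> \<bar>s\<bar> * sqrt (b k)" using le by (intro mult_left_mono) auto
        finally show "cmod (char (distr M borel (X n)) s - char (distr M borel (Y k n)) s) \<le> \<bar>s\<bar> * sqrt (b k)" .
      qed
    qed
  qed
  have lim: "(\<lambda>n. char (distr M borel (Y k n)) s) \<longlonglongrightarrow> exp (- (v k * s\<^sup>2 / 2))" for k s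
  proof -
    define m where "m n = (n div l k) ^ ?d" for n
    \<comment> \<open>Chosen so that w n / sqrt (m n) = s / c n once a block fits. Its convergence
      supplies the moving argument of \<open>char_power_limit\<close>, and its limit turns the block
      variance into v k.\<close>
    define w where "w n = s * sqrt ((real (n div l k) / real n) ^ ?d)" for n
    have div_top: "filterlim (\<lambda>n. n div l k) at_top sequentially"
      unfolding filterlim_at_top eventually_sequentially
      using l(1)[of k] by (metis div_le_mono nonzero_mult_div_cancel_right not_gr0)
    have m_top: "filterlim m at_top sequentially"
    proof (rule filterlim_at_top_mono[OF div_top])
      have "x \<le> x ^ ?d" for x :: nat by (cases "x = 0") (auto intro!: self_le_power)
      then show "eventually (\<lambda>n. n div l k \<le> m n) sequentially" by (simp add: m_def)
    qed
    have "w \<longlonglongrightarrow> s * sqrt ((1 / real (l k)) ^ ?d)"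
      unfolding w_def by (intro tendsto_intros tendsto_div_over l)
    moreover have meas: "(\<lambda>\<omega>. F (pt (lattice_box (l k)) \<omega>) - E (lattice_box (l k))) \<in> borel_measurable M"
      using F_meas[OF finite_lattice_box] by measurable
    moreover have "integrable M (\<lambda>\<omega>. (F (pt (lattice_box (l k)) \<omega>) - E (lattice_box (l k)))\<^sup>2)"
      by (intro integrable_square_diff F_meas F_int finite_lattice_box) auto
    ultimately have "(\<lambda>n. char (\<mu> k) (w n / sqrt (real (m n))) ^ m n) \<longlonglongrightarrow>
        exp (- (var k * (s * sqrt ((1 / real (l k)) ^ ?d))\<^sup>2 / 2))"
      using F1[OF finite_lattice_box]
      by (intro char_power_limit m_top)
        (auto simp: \<mu>_def integrable_distr_eq integral_distr var_def E_def prob_space intro!: real_distribution_distr)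
    also have "var k * (s * sqrt ((1 / real (l k)) ^ ?d))\<^sup>2 = v k * s\<^sup>2"
      by (simp add: v_def power_mult_distrib)
    finally show ?thesis
    proof (rule Lim_transform_eventually)
      show "eventually (\<lambda>n. char (\<mu> k) (w n / sqrt (real (m n))) ^ m n = char (distr M borel (Y k n)) s) sequentially"
        using eventually_ge_at_top[of "l k"]
      proof eventually_elim
        case (elim n)
        \<comment> \<open>n \<ge> l k guarantees at least one block.\<close>
        then have n: "0 < n" "0 < n div l k" using l(1)[of k] by (auto simp: div_greater_zero_iff)
        have quot: "sqrt ((real (n div l k) / real n) ^ ?d) / sqrt (real (m n)) = 1 / c n"
        proof -
          have "c n = sqrt (real n ^ ?d)" using c2[OF n(1)] by (metis abs_of_nonneg c_def powr_ge_zero real_sqrt_abs)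
          then show ?thesis using n by (simp add: m_def power_divide real_sqrt_divide)
        qed
        have "w n / sqrt (real (m n)) = s * (sqrt ((real (n div l k) / real n) ^ ?d) / sqrt (real (m n)))"
          by (simp add: w_def)
        also have "\<dots> = s / c n" unfolding quot by simp
        finally have "w n / sqrt (real (m n)) = s / c n" .
        then show ?case
          using block_sum_char[OF stab n(2) l(1), where c="c n" and s=s]
          by (simp add: \<mu>_def Y_def[abs_def] E_def m_def)
      qed
    qed
  qed
  have b_lim: "(\<lambda>k. sqrt (b k)) \<longlonglongrightarrow> 0"
  proof -
    have "(\<lambda>k. real (l k - 2 * k) / real (l k)) \<longlonglongrightarrow> 1"
    proof -
      \<comment> \<open>(k + 1)^2 - 2 * k = k^2 + 1.\<close>
      have "real (l k - 2 * k) / real (l k) = ((real k)\<^sup>2 + 1) / (real k + 1)\<^sup>2" for k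
        using l(2)[of k] by (simp add: of_nat_diff l_def power2_eq_square algebra_simps)
      moreover have "(\<lambda>k. ((real k)\<^sup>2 + 1) / (real k + 1)\<^sup>2) \<longlonglongrightarrow> 1" by real_asymp
      ultimately show ?thesis by simp
    qed
    then have "b \<longlonglongrightarrow> 0 + L * (1 - 1 ^ ?d) + 0"
      unfolding b_def
      by (intro tendsto_intros stabilizingD(4)[OF stab] LIMSEQ_Suc[OF lim_1_over_n])
    then have "(\<lambda>k. sqrt (b k)) \<longlonglongrightarrow> sqrt 0" by (intro tendsto_real_sqrt) simp
    then show ?thesis by simp
  qed
  have "\<exists>v0\<ge>0. \<forall>s. (\<lambda>n. char (distr M borel (X n)) s) \<longlonglongrightarrow> exp (- (v0 * s\<^sup>2 / 2))"
    by (rule gaussian_limit_of_approximations[OF v lim b_lim close])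
  then show ?thesis unfolding X_def E_def c_def .
qed

end

section \<open>From lattice boxes to the centred windows\<close>

lemma window_borel: "window n \<in> sets borel"
  unfolding window_def by measurable

lemma window_bounded: "bounded (window n)"
proof (rule bounded_subset[OF bounded_cbox])
  show "window n \<subseteq> cbox (\<chi> a. - (real n / 2)) (\<chi> a. real n / 2)"
    by (auto simp: window_def mem_box_cart less_imp_le)
qed

text \<open>For odd n the window is not a union of lattice cells. It is a translate of a lattice
  box, by half-integers in that case, and translation does not change the laws.\<close>

lemma window_eq: "window n = (\<lambda>x. x + (\<chi> a. - (real n / 2))) ` cells (lattice_box n)"
proof -
  let ?v = "(\<chi> a. - (real n / 2)) :: real ^ 'a"
  have cell: "x \<in> cells (lattice_box n) \<longleftrightarrow> (\<forall>a. 0 \<le> x $ a \<and> x $ a < real n)" for x :: "real ^ 'a"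
    by (simp add: cells_def lattice_box_def grid_def floor_less_iff)
  have "x \<in> (\<lambda>x. x + ?v) ` cells (lattice_box n)" if "x \<in> window n" for x
  proof -
    have "- (real n / 2) \<le> x $ a \<and> x $ a < real n / 2" for a using that by (simp add: window_def)
    then have "0 \<le> (x - ?v) $ a \<and> (x - ?v) $ a < real n" for a
      by (simp only: vector_minus_component vec_lambda_beta) (smt (verit) field_sum_of_halves)
    then have "x - ?v \<in> cells (lattice_box n)" unfolding cell by blast
    then show ?thesis by (intro image_eqI[of _ _ "x - ?v"]) auto
  qed
  moreover have "x + ?v \<in> window n" if "x \<in> cells (lattice_box n)" for x
    unfolding window_def mem_Collect_eq
  proof
    fix a
    have "0 \<le> x $ a \<and> x $ a < real n" using that by (simp add: cell)
    then show "- (real n / 2) \<le> (x + ?v) $ a \<and> (x + ?v) $ a < real n / 2" by (simp add: field_simps)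
  qed
  ultimately show ?thesis by blast
qed

theorem theorem4p11:
  fixes M :: "'w measure"
    and \<Phi> :: "'w \<Rightarrow> (real ^ 'n) measure"
    and \<kappa> :: "(real ^ 'n) set \<Rightarrow> ennreal"
    and r s :: real
    and q :: nat
  assumes "homogeneous_poisson_process 1 M \<Phi>"
    and "filtration_function \<kappa>"
    and "r \<ge> 0" and "s \<ge> 0"
  defines "\<beta> \<equiv> window_betti TYPE('f::field) \<kappa> q r s \<Phi>"
  shows "(\<forall>n. integrable M (\<beta> n)) \<and>
    (\<exists>\<sigma>2\<ge>0. converges_in_distribution M
       (\<lambda>n \<omega>. (\<beta> n \<omega> - integral\<^sup>L M (\<beta> n)) / real n powr (real CARD('n) / 2))
       (normal_distribution 0 \<sigma>2))"
proof -
  interpret lattice_poisson M \<Phi> by unfold_locales (rule assms(1))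
  note \<kappa> = assms(2)
  \<comment> \<open>The three terms of \<open>persistent_betti_eq\<close>.\<close>
  define f1 f2 f3 :: "(real ^ 'n) set \<Rightarrow> nat" where
    "f1 X = chain.dim (cycles q (filtration_complex \<kappa> X r) :: ((real ^ 'n) list \<Rightarrow> 'f) set)" and
    "f2 X = chain.dim (fillings q (filtration_complex \<kappa> X r) (filtration_complex \<kappa> X s) ::
      ((real ^ 'n) list \<Rightarrow> 'f) set)" and
    "f3 X = chain.dim (cycles (Suc q) (filtration_complex \<kappa> X s) :: ((real ^ 'n) list \<Rightarrow> 'f) set)" for X
  have \<kappa>_meas: "measurable_on_finite_sets \<kappa>" using \<kappa> by (simp add: filtration_function_def)
  obtain R1 where R1: "\<And>x y \<sigma>. finite \<sigma> \<Longrightarrow> \<kappa> \<sigma> \<le> ennreal r \<Longrightarrow> x \<in> \<sigma> \<Longrightarrow> y \<in> \<sigma> \<Longrightarrow> dist x y \<le> R1"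
    using filtration_diameter[OF \<kappa>] by metis
  obtain R2 where R2: "\<And>x y \<sigma>. finite \<sigma> \<Longrightarrow> \<kappa> \<sigma> \<le> ennreal s \<Longrightarrow> x \<in> \<sigma> \<Longrightarrow> y \<in> \<sigma> \<Longrightarrow> dist x y \<le> R2"
    using filtration_diameter[OF \<kappa>] by metis
  have tame: "tame (Suc q) R1 f1" "tame (Suc (Suc q)) R2 f2" "tame (Suc (Suc q)) R2 f3"
  proof -
    show "tame (Suc q) R1 f1" unfolding f1_def by (rule tame_cycles[OF R1])
    show "tame (Suc (Suc q)) R2 f2" unfolding f2_def by (rule tame_fillings[OF R2])
    show "tame (Suc (Suc q)) R2 f3" unfolding f3_def by (rule tame_cycles[OF R2])
  qed
  have pattern: "pattern_invariant \<kappa> r s f1" "pattern_invariant \<kappa> r s f2" "pattern_invariant \<kappa> r s f3"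
  proof -
    show "pattern_invariant \<kappa> r s f1" unfolding f1_def by (rule pattern_invariant_cycles) simp
    show "pattern_invariant \<kappa> r s f2" unfolding f2_def by (rule pattern_invariant_fillings)
    show "pattern_invariant \<kappa> r s f3" unfolding f3_def by (rule pattern_invariant_cycles) simp
  qed
  have "\<exists>L \<delta>. stabilizing (\<lambda>X. real (f X)) L \<delta>" if "tame p R f" "pattern_invariant \<kappa> r s f" for p R f
    using tame_stabilizing[OF that(1) pattern_invariant_measurable[OF \<kappa>_meas that(2)]
        pattern_invariant_translation[OF that(2) \<kappa>]] .
  then obtain L1 L2 L3 \<delta>1 \<delta>2 \<delta>3 where "stabilizing (\<lambda>X. real (f1 X)) L1 \<delta>1"
      "stabilizing (\<lambda>X. real (f2 X)) L2 \<delta>2" "stabilizing (\<lambda>X. real (f3 X)) L3 \<delta>3"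
    using tame pattern by metis
  note stab = stabilizing_combine[OF this]
  define F where "F X = real (f1 X) - real (f2 X) + real (f3 X)" for X
  note stab = stab[folded F_def]
  note F = stabilizingD(1)[OF stab] and tr = stabilizingD(2)[OF stab] and F_int = stabilizingD(3)[OF stab]
  have betti_eq: "real (persistent_betti TYPE('f) q r s (filtration_complex \<kappa> X)) = F X" if "finite X" for X
    unfolding F_def f1_def f2_def f3_def
    by (rule persistent_betti_eq[OF that filtration_complex_Pow filtration_complex_Pow])
  have \<beta>_eq: "\<beta> n \<omega> = F (points (window n) \<omega>)" if "\<omega> \<in> space M" for n \<omega>
    using betti_eq[OF finite_points[OF window_borel window_bounded that]]
    by (simp add: \<beta>_def window_betti_def)
  let ?G = "\<lambda>n \<omega>. F (pt (lattice_box n) \<omega>)"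
  have G_meas: "?G n \<in> borel_measurable M" for n by (rule functional_measurable[OF F finite_lattice_box])
  have \<beta>_meas: "\<beta> n \<in> borel_measurable M" for n
    using measurable_compose[OF points_measurable[OF window_borel window_bounded] F]
    by (rule measurable_cong[THEN iffD2, rotated]) (rule \<beta>_eq)
  \<comment> \<open>Window and lattice box see different points of the same sample, so only the laws
    agree; integrability, mean and weak limit depend on nothing else.\<close>
  have law: "distr M borel (\<beta> n) = distr M borel (?G n)" for n
  proof -
    have "distr M borel (\<beta> n) = distr M borel (\<lambda>\<omega>. F (points (window n) \<omega>))"
      by (intro distr_cong refl \<beta>_eq)
    also have "\<dots> = distr M borel (?G n)"
      unfolding window_eq by (intro law_functional_translate F tr cells_borel cells_bounded) auto
    finally show ?thesis .
  qed
  have "integrable M (\<beta> n)" for n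
  proof -
    have "integrable M (?G n)"
      by (rule integrable_of_square[OF prob_space_axioms G_meas F_int]) simp
    then have "integrable (distr M borel (?G n)) (\<lambda>x. x)" using G_meas by (subst integrable_distr_eq) auto
    then show ?thesis unfolding law[symmetric] using \<beta>_meas by (subst (asm) integrable_distr_eq) auto
  qed
  moreover have E: "integral\<^sup>L M (\<beta> n) = integral\<^sup>L M (?G n)" for n
  proof -
    have "integral\<^sup>L M (\<beta> n) = (\<integral>x. x \<partial>distr M borel (\<beta> n))" using \<beta>_meas by (subst integral_distr) auto
    also have "\<dots> = integral\<^sup>L M (?G n)" unfolding law using G_meas by (subst integral_distr) auto
    finally show ?thesis .
  qed
  let ?c = "\<lambda>n. real n powr (real CARD('n) / 2)"
  let ?Z = "\<lambda>n \<omega>. (\<beta> n \<omega> - integral\<^sup>L M (\<beta> n)) / ?c n"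
  have Z_meas: "?Z n \<in> borel_measurable M" for n using \<beta>_meas by measurable
  have Z_law: "distr M borel (?Z n) = distr M borel (\<lambda>\<omega>. (?G n \<omega> - integral\<^sup>L M (?G n)) / ?c n)" for n
  proof -
    let ?h = "\<lambda>x. (x - integral\<^sup>L M (?G n)) / ?c n"
    have "distr M borel (?Z n) = distr (distr M borel (\<beta> n)) borel ?h"
      using \<beta>_meas by (subst distr_distr) (auto simp: comp_def E)
    also have "\<dots> = distr M borel (\<lambda>\<omega>. ?h (?G n \<omega>))"
      unfolding law using G_meas by (subst distr_distr) (auto simp: comp_def)
    finally show ?thesis .
  qed
  obtain v where v: "v \<ge> 0" and lim: "\<And>t. (\<lambda>n. char (distr M borel (?Z n)) t) \<longlonglongrightarrow> exp (- (v * t\<^sup>2 / 2))"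
    using stabilizing_clt[OF stab] unfolding Z_law by blast
  \<comment> \<open>Levy's continuity theorem; v = 0 is included as the point mass at 0.\<close>
  have "weak_conv_m (\<lambda>n. distr M borel (?Z n)) (normal_distribution 0 v)"
    using lim Z_meas
    by (intro levy_continuity real_distribution_distr real_distribution_normal[OF v]) (simp_all add: char_normal[OF v])
  then have "converges_in_distribution M ?Z (normal_distribution 0 v)"
    using Z_meas by (simp add: converges_in_distribution_def)
  ultimately show ?thesis using v by blast
qed

end
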